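(* Let $t>0$, $\alpha\in\mathbb{R}$, and let $\lambda_{k}\in\mathbb{R}$ ($k>0$) be such that the limit $$\alpha^{\ast}:=\lim_{k\uparrow\infty}k^{1/2}\lambda_{k}\alpha\in[-\infty,+\infty]$$ exists. Then for every starting measure $\mu\in\mathcal{M}$ satisfying $\langle\mu,\phi\rangle<\infty$, we have the convergence in $\mathcal{M}$ $$\lim_{k\uparrow\infty}k^{-1/2}\,\mathbb{E}_{\mu}\big[X_{kt}^{\lambda_{k}\alpha}(k^{1/2}\,dy)\big]\,=\,\big\langle\mu,\vartheta_{t}^{\alpha^{\ast}}(\,\cdot\,,y)\big\rangle\,dy .$$
   Context: Notation. $\dot{\mathbb{R}}^{3}:=\mathbb{R}^{3}\setminus\{0\}$. For a measure $\nu$ on $\dot{\mathbb{R}}^3$ and $c>0$, $\nu(c\,dy)$ denotes the measure $A\mapsto\nu(cA)$, $cA=\{cx:x\in A\}$; $\langle\nu,f\rangle:=\int f\,d\nu$. $\mathbb{E}_\mu[X(dy)]$ denotes the mean (intensity) measure of a random measure $X$. Kernels. The free heat kernel is $p_{t}(x,y):=(4\pi t)^{-3/2}\exp(-|y-x|^{2}/4t)$, and $p_{t}(r):=(4\pi t)^{-3/2}\exp(-r^{2}/4t)$ for $r\ge0$. For $\alpha\in\mathbb{R}$, $t>0$, $x,y\in\dot{\mathbb{R}}^{3}$, the one-point-interaction heat kernel is $$p_{t}^{\alpha}(x,y):=p_{t}(x,y)+\frac{2t}{|x||y|}\,p_{t}(|x|+|y|)-\frac{8\pi\alpha t}{|x||y|}\int_{0}^{\infty}e^{-4\pi\alpha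 u}\,p_{t}(u+|x|+|y|)\,du ,$$ with $S_t^\alpha\varphi(x):=\int_{\dot{\mathbb{R}}^3}\varphi(y)\,p_t^\alpha(x,y)\,dy$. For $\alpha\in\mathbb{R}$, $t>0$, $x,y\in\dot{\mathbb{R}}^{3}$ set $$\vartheta_{t}^{\alpha}(x,y):=\frac{2t}{|x|\,|y|}\,p_{t}(|y|)-\frac{8\pi\alpha t}{|x|\,|y|}\int_{0}^{\infty}e^{-4\pi\alpha u}\,p_{t}(u+|y|)\,du ,$$ and $\vartheta_t^{+\infty}(x,y):\equiv0$, $\vartheta_t^{-\infty}(x,y):\equiv+\infty$. Function and measure spaces. Let $\phi(x):=|x|^{-1}$ on $\dot{\mathbb{R}}^{3}$. Fix $\varrho\in(1,2)$. $\mathcal{H}$ is the Banach space of (classes of) measurable functions $\varphi$ on $\dot{\mathbb{R}}^{3}$ with $\|\varphi\|_{\mathcal{H}}:=\big(\int_{\dot{\mathbb{R}}^{3}}\phi(x)|\varphi(x)|^{\varrho}dx\big)^{1/\varrho}<\infty$. $\Phi$ is the set of all continuous functions $\varphi:\dot{\mathbb{R}}^{3}\to\mathbb{R}$ with $\varphi\in\mathcal{H}$ and $0\le\varphi\le C\phi$ for some constant $C=C_\varphi>0$, with the topology inherited from $\mathcal{H}$. $\mathcal{M}$ is the set of all Radon measures $\mu$ on $\dot{\mathbb{R}}^{3}$ with $\langle\mu,\varphi\rangle<\infty$ for all $\varphi\in\Phi$, endowed with the vague topology: convergence in $\mathcal{M}$ means convergence of the integrals of every $\varphi\in\mathcal{C}_{\mathrm{com}}^{+}(\dot{\mathbb{R}}^{3})$,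 the non-negative continuous functions on $\dot{\mathbb{R}}^3$ with compact support (note $\mathcal{C}_{\mathrm{com}}^{+}\subset\Phi$). When $\alpha^\ast=-\infty$ the right-hand side is the measure with density $\langle\mu,+\infty\rangle$, and the convergence is understood in the same way, as convergence in $[0,+\infty]$ of the integrals of each $\varphi\in\mathcal{C}_{\mathrm{com}}^{+}$, with the convention $0\cdot\infty=0$. Process (existence and characterization are known from Fleischmann and Mueller, 2004). Fix a branching rate $\eta>0$ and $0<\beta<1$. For each $\alpha\in\mathbb{R}$, $X^{\alpha}=(X^\alpha_t)_{t\ge 0}$ (super-Brownian motion in $\mathbb{R}^3$ with a single point source) is the $\mathcal{M}$-valued time-homogeneous Markov process whose laws $\mathbb{P}_\mu$ (started at deterministic $\mu\in\mathcal{M}$) satisfy, for all $\varphi\in\Phi$ and $t>0$, $$-\log\mathbb{E}_{\mu}\exp\langle X_{t}^{\alpha},-\varphi\rangle=\langle\mu,v(t,\cdot)\rangle,$$ where $v$ is the unique non-negative $\Phi$-valued solution of $$v(t,x)=S_t^\alpha\varphi(x)-\eta\int_{0}^{t}ds\int_{\dot{\mathbb{R}}^{3}}dy\ p_{t-s}^{\alpha}(x,y)\,v^{1+\beta}(s,y),\qquad t>0,\ x\in\dot{\mathbb{R}}^{3}.$$ Its first moments are given by $\mathbb{E}_{\mu}\langle X_{t}^{\alpha},\varphi\rangle=\langle\mu,S_{t}^{\alpha}\varphi\rangle$ for all $\mu\in\mathcal{M}$, $t\ge0$, $\varphi\in\Phi$. *)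

theory Defs
  imports "HOL-Probability.Probability"
begin

text \<open>Functions on the punctured space are total functions on \<^typ>\<open>real^3\<close> whose value at the
  origin is never used; measures on it have the origin removed from their space.\<close>

abbreviation punctured :: "(real^3) set" where
  "punctured \<equiv> - {0}"

abbreviation punctured_borel :: "(real^3) measure" where
  "punctured_borel \<equiv> restrict_space borel punctured"

abbreviation punctured_lborel :: "(real^3) measure" where
  "punctured_lborel \<equiv> restrict_space lborel punctured"

definition gauss :: "real \<Rightarrow> real \<Rightarrow> real" where
  "gauss t r = (4 * pi * t) powr (- 3 / 2) * exp (- (r\<^sup>2 / (4 * t)))"

definition heat_kernel :: "real \<Rightarrow> real^3 \<Rightarrow> real^3 \<Rightarrow> real" where
  "heat_kernel t x y = gauss t (norm (y - x))"

definition point_kernel :: "real \<Rightarrow> real \<Rightarrow> real^3 \<Rightarrow> real^3 \<Rightarrow> real" where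
  "point_kernel \<alpha> t x y =
     heat_kernel t x y
     + 2 * t / (norm x * norm y) * gauss t (norm x + norm y)
     - 8 * pi * \<alpha> * t / (norm x * norm y)
         * (LBINT u:{0..}. exp (- 4 * pi * \<alpha> * u) * gauss t (u + norm x + norm y))"

definition point_semigroup :: "real \<Rightarrow> real \<Rightarrow> (real^3 \<Rightarrow> real) \<Rightarrow> real^3 \<Rightarrow> real" where
  "point_semigroup \<alpha> t \<phi> x = (LINT y|punctured_lborel. \<phi> y * point_kernel \<alpha> t x y)"

definition vartheta :: "real \<Rightarrow> real \<Rightarrow> real^3 \<Rightarrow> real^3 \<Rightarrow> real" where
  "vartheta \<alpha> t x y =
     2 * t / (norm x * norm y) * gauss t (norm y)
     - 8 * pi * \<alpha> * t / (norm x * norm y)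
         * (LBINT u:{0..}. exp (- 4 * pi * \<alpha> * u) * gauss t (u + norm y))"

text \<open>The coercion to \<^typ>\<open>ennreal\<close> truncates nothing: for \<open>t > 0\<close> the real kernel is nonnegative
  (trivially if \<open>\<alpha> \<le> 0\<close>; for \<open>\<alpha> > 0\<close> integrate by parts, \<open>gauss t\<close> being decreasing on the
  positive half-line).\<close>

definition ext_vartheta :: "ereal \<Rightarrow> real \<Rightarrow> real^3 \<Rightarrow> real^3 \<Rightarrow> ennreal" where
  "ext_vartheta a t x y =
     (case a of ereal \<alpha> \<Rightarrow> ennreal (vartheta \<alpha> t x y) | PInfty \<Rightarrow> 0 | MInfty \<Rightarrow> \<infinity>)"

definition weight :: "real^3 \<Rightarrow> real" where
  "weight x = 1 / norm x"

definition weighted_Lp :: "real \<Rightarrow> (real^3 \<Rightarrow> real) set" where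
  "weighted_Lp \<rho> = {\<phi> \<in> borel_measurable punctured_borel.
     (\<integral>\<^sup>+x. ennreal (weight x * \<bar>\<phi> x\<bar> powr \<rho>) \<partial>punctured_lborel) < \<infinity>}"

definition test_functions :: "real \<Rightarrow> (real^3 \<Rightarrow> real) set" where
  "test_functions \<rho> = {\<phi> \<in> weighted_Lp \<rho>. continuous_on punctured \<phi> \<and>
     (\<exists>C>0. \<forall>x\<in>punctured. 0 \<le> \<phi> x \<and> \<phi> x \<le> C * weight x)}"

definition Ccom_plus :: "(real^3 \<Rightarrow> real) set" where
  "Ccom_plus = {f. continuous_on punctured f \<and> (\<forall>x\<in>punctured. 0 \<le> f x) \<and>
     (\<exists>K. compact K \<and> K \<subseteq> punctured \<and> (\<forall>x\<in>punctured - K. f x = 0))}"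

text \<open>On the punctured space, which is locally compact with countable base, a Borel measure is
  Radon as soon as it is finite on compact sets.\<close>

definition tempered_measures :: "real \<Rightarrow> (real^3) measure set" where
  "tempered_measures \<rho> = {\<mu>. sets \<mu> = sets punctured_borel \<and>
     (\<forall>K. compact K \<and> K \<subseteq> punctured \<longrightarrow> emeasure \<mu> K < \<infinity>) \<and>
     (\<forall>\<phi>\<in>test_functions \<rho>. (\<integral>\<^sup>+x. ennreal (\<phi> x) \<partial>\<mu>) < \<infinity>)}"

definition vague_topology :: "real \<Rightarrow> (real^3) measure topology" where
  "vague_topology \<rho> = topology_generated_by
     {{\<mu> \<in> tempered_measures \<rho>. (\<integral>\<^sup>+x. ennreal (f x) \<partial>\<mu>) \<in> U} | f U. f \<in> Ccom_plus \<and> open U}"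

definition vague_borel :: "real \<Rightarrow> (real^3) measure measure" where
  "vague_borel \<rho> = sigma (tempered_measures \<rho>) {U. openin (vague_topology \<rho>) U}"

text \<open>The limit is allowed to lie outside the space of tempered measures, so this is stated
  through the integrals in \<open>[0, \<infinity>]\<close> rather than through \<^const>\<open>vague_topology\<close>.\<close>

definition vague_tendsto ::
    "('i \<Rightarrow> (real^3) measure) \<Rightarrow> (real^3) measure \<Rightarrow> 'i filter \<Rightarrow> bool" where
  "vague_tendsto N \<nu> F \<longleftrightarrow> (\<forall>f\<in>Ccom_plus.
     ((\<lambda>k. \<integral>\<^sup>+y. ennreal (f y) \<partial>N k) \<longlongrightarrow> (\<integral>\<^sup>+y. ennreal (f y) \<partial>\<nu>)) F)"

text \<open>\<open>dilate c \<nu>\<close> is \<open>\<nu>(c dy)\<close>: since \<open>x /\<^sub>R c \<in> A\<close> iff \<open>x \<in> c A\<close>, it gives \<open>A\<close> the mass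
  \<open>\<nu>(c A)\<close>.\<close>

definition dilate :: "real \<Rightarrow> (real^3) measure \<Rightarrow> (real^3) measure" where
  "dilate c \<nu> = distr \<nu> punctured_borel (\<lambda>x. x /\<^sub>R c)"

definition mean_measure :: "'w measure \<Rightarrow> ('w \<Rightarrow> (real^3) measure) \<Rightarrow> (real^3) measure" where
  "mean_measure Q Y =
     measure_of punctured (sets punctured_borel) (\<lambda>A. \<integral>\<^sup>+\<omega>. emeasure (Y \<omega>) A \<partial>Q)"

locale markov_process =
  fixes E :: "'s measure" and \<Omega> :: "'w measure"
    and P :: "'s \<Rightarrow> 'w measure" and X :: "real \<Rightarrow> 'w \<Rightarrow> 's"
  assumes laws: "x \<in> space E \<Longrightarrow> P x \<in> space (prob_algebra \<Omega>)"
    and random_variable: "0 \<le> t \<Longrightarrow> X t \<in> measurable \<Omega> E"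
    and start: "x \<in> space E \<Longrightarrow> AE \<omega> in P x. X 0 \<omega> = x"
    and transition_measurable: "0 \<le> t \<Longrightarrow> A \<in> sets E \<Longrightarrow>
      (\<lambda>x. measure (P x) (X t -` A \<inter> space \<Omega>)) \<in> borel_measurable E"
    and markov: "x \<in> space E \<Longrightarrow> 0 \<le> s \<Longrightarrow> 0 \<le> t \<Longrightarrow> A \<in> sets E \<Longrightarrow>
      AE \<omega> in P x.
        real_cond_exp (P x)
          (sigma (space \<Omega>) {X r -` B \<inter> space \<Omega> | r B. 0 \<le> r \<and> r \<le> s \<and> B \<in> sets E})
          (indicat_real (X (s + t) -` A \<inter> space \<Omega>)) \<omega>
        = measure (P (X s \<omega>)) (X t -` A \<inter> space \<Omega>)"

text \<open>The integrability clause makes the double integral meaningful; the Bochner integral of a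
  non-integrable function would silently be \<open>0\<close>. As the kernel is strictly positive, it also
  contains the joint measurability of \<open>v\<close>.\<close>

definition log_laplace_solution ::
    "real \<Rightarrow> real \<Rightarrow> real \<Rightarrow> real \<Rightarrow> (real^3 \<Rightarrow> real) \<Rightarrow> (real \<Rightarrow> real^3 \<Rightarrow> real) \<Rightarrow> bool" where
  "log_laplace_solution \<rho> \<eta> \<beta> \<alpha> \<phi> v \<longleftrightarrow>
     (\<forall>t>0. v t \<in> test_functions \<rho>) \<and>
     (\<forall>t>0. \<forall>x\<in>punctured.
        integrable (restrict_space lborel {0<..<t} \<Otimes>\<^sub>M punctured_lborel)
          (\<lambda>(s, y). point_kernel \<alpha> (t - s) x y * v s y powr (1 + \<beta>)) \<and>
        v t x = point_semigroup \<alpha> t \<phi> x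
          - \<eta> * (LBINT s:{0<..<t}. LINT y|punctured_lborel.
                    point_kernel \<alpha> (t - s) x y * v s y powr (1 + \<beta>)))"

locale point_source_super_brownian =
  markov_process "vague_borel \<rho>" \<Omega> P X
  for \<rho> \<eta> \<beta> \<alpha> :: real and \<Omega> :: "'w measure"
    and P :: "(real^3) measure \<Rightarrow> 'w measure" and X :: "real \<Rightarrow> 'w \<Rightarrow> (real^3) measure" +
  assumes log_laplace: "\<phi> \<in> test_functions \<rho> \<Longrightarrow>
    \<exists>v. log_laplace_solution \<rho> \<eta> \<beta> \<alpha> \<phi> v \<and>
        (\<forall>w. log_laplace_solution \<rho> \<eta> \<beta> \<alpha> \<phi> w \<longrightarrow> (\<forall>t>0. \<forall>x\<in>punctured. w t x = v t x)) \<and>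
        (\<forall>\<mu>\<in>tempered_measures \<rho>. \<forall>t>0.
           - ln (LINT \<omega>|P \<mu>. exp (- (LINT x|X t \<omega>. \<phi> x))) = (LINT x|\<mu>. v t x))"

end

theory Submission
  imports Defs
begin

text \<open>Integration by parts turns the correction terms of the point kernel into the single positive
  integral \<open>profile a t r = \<integral>\<^sub>0\<^sup>\<infinity> exp (- 4 \<pi> a u) (u + r) gauss t (u + r) du\<close>: the kernel equals the free heat
  kernel plus \<open>profile a t (|x| + |y|) / (|x| |y|)\<close>, and \<open>vartheta a t x y\<close> equals
  \<open>profile a t |y| / (|x| |y|)\<close>. The profile has Gaussian bounds that are uniform for \<open>a\<close> bounded below,
  is continuous in \<open>(a, r)\<close>, tends to \<open>0\<close> as \<open>a \<rightarrow> \<infinity>\<close> and to \<open>\<infinity>\<close> as \<open>a \<rightarrow> -\<infinity>\<close>.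

  The first moment formula follows from the log-Laplace equation for \<open>\<theta> f\<close> as \<open>\<theta> \<rightarrow> 0\<close>: since the
  semigroup maps \<open>O(|x|\<^sup>-\<^sup>1)\<close> to \<open>O(|x|\<^sup>-\<^sup>1)\<close> and
  \<open>\<integral> p\<^sub>s(x, y) |y|\<^sup>-\<^sup>1\<^sup>-\<^sup>\<beta> dy = O(s powr (- \<beta> / 2) |x|\<^sup>-\<^sup>1)\<close>, the nonlinear term is of order
  \<open>\<theta> powr (1 + \<beta>)\<close> after integration against \<open>\<mu>\<close>. By Brownian scaling the rescaled mean measure then has the density
  \<open>\<integral> k powr (- 1 / 2) p\<^sub>t(x / \<surd>k, y) \<mu>(dx)\<close> with interaction parameter \<open>\<surd>k \<lambda>\<^sub>k \<alpha>\<close>. Its free part vanishes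
  in the limit and its profile part converges, by dominated convergence if \<open>\<alpha>\<^sup>* > -\<infinity>\<close> and by Fatou's lemma
  if \<open>\<alpha>\<^sup>* = -\<infinity>\<close>.\<close>

section \<open>The interaction profile\<close>

text \<open>All estimates are made relative to \<open>weight\<close>, that is 1/|x|: this
  singularity is preserved by the semigroup and is the one that \<open>\<mu>\<close> is assumed to
  integrate. The profile term of the kernel adds a second factor 1/|y|, so the nonlinear term meets
  |y|^(-2-beta), which is integrable at the origin of three-space because beta < 1. The
  normalisation k^(-1/2) cancels exactly against the factor 1/|x/sqrt k| of the profile term; the
  free term has no such factor, hence dies. The Gaussian exponent z^2/(4s) is spent in halves: one
  half absorbs a linear factor z, which leaves 8s, and half of what remains in u absorbs the
  exponential growth at negative coupling, which leaves 16s. Two formal obstacles shape the rest. A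
  divergent Bochner integral is 0, so bounds are proved for integrals in [0, infinity] and
  transferred afterwards. And \<open>mean_measure\<close>, being built by \<open>measure_of\<close>,
  has the intended values only once evaluation at every Borel set is known to be measurable, whereas
  the vague topology gives direct access only to integrals of continuous functions.\<close>

lemma gauss_pos: "0 < t \<Longrightarrow> 0 < gauss t r"
  by (simp add: gauss_def)

lemma gauss_nonneg: "0 \<le> gauss t r"
  by (simp add: gauss_def)

lemma gauss_measurable [measurable]: "gauss t \<in> borel_measurable borel"
  unfolding gauss_def by measurable

lemma gauss_scale:
  assumes "0 < k" "0 < t"
  shows "gauss (k * t) (sqrt k * r) = k powr (- 3 / 2) * gauss t r"
proof -
  have "(sqrt k * r)\<^sup>2 / (4 * (k * t)) = r\<^sup>2 / (4 * t)"
    using assms by (simp add: power_mult_distrib)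
  moreover have "(4 * pi * (k * t)) powr (- 3 / 2) = k powr (- 3 / 2) * (4 * pi * t) powr (- 3 / 2)"
    using assms by (simp add: powr_mult)
  ultimately show ?thesis by (simp add: gauss_def)
qed

lemma powr_minus_3_2: "0 < (s::real) \<Longrightarrow> s powr (- 3 / 2) = 1 / (s * sqrt s)"
proof -
  assume s: "0 < s"
  have "s powr (- 3 / 2) = s powr (- 1 + - 1 / 2)" by simp
  also have "\<dots> = s powr (- 1) * s powr (- 1 / 2)" by (rule powr_add)
  also have "s powr (- 1 / 2) = inverse (s powr (1 / 2))" by (simp add: powr_minus[symmetric])
  finally show ?thesis using s by (simp add: powr_half_sqrt powr_minus field_simps)
qed

section \<open>Gaussian bounds for the profile, uniform in the coupling\<close>

definition profile :: "real \<Rightarrow> real \<Rightarrow> real \<Rightarrow> real" where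
  "profile a t r = (LBINT u:{0..}. exp (- 4 * pi * a * u) * ((u + r) * gauss t (u + r)))"

text \<open>With w = z / sqrt s the exponent w^2/8 is half of the Gaussian exponent, so a linear
  factor costs half of the decay. The estimate comes from (w/2 - 1)^2 being nonnegative.\<close>

lemma le_two_exp: "w \<le> 2 * exp (w\<^sup>2 / 8)" for w :: real
proof -
  have "w \<le> 2 * (1 + w\<^sup>2 / 8)"
    using zero_le_power2[of "w / 2 - 1"] by (simp add: power2_eq_square algebra_simps)
  also have "\<dots> \<le> 2 * exp (w\<^sup>2 / 8)"
    by (intro mult_left_mono exp_ge_add_one_self) simp
  finally show ?thesis .
qed

text \<open>The factor z / sqrt s is absorbed by half of the Gaussian. The generous bound 1 / (2 s
  sqrt s) for the normalising constant is chosen to cancel the prefactor 2 sqrt s and leave exactly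
  1/s.\<close>

lemma mult_gauss_le:
  assumes s: "0 < s" and z: "0 \<le> z"
  shows "z * gauss s z \<le> exp (- (z\<^sup>2 / (8 * s))) / s"
proof -
  have eq: "exp ((z / sqrt s)\<^sup>2 / 8) * exp (- (z\<^sup>2 / (4 * s))) = exp (- (z\<^sup>2 / (8 * s)))"
    using s by (simp add: exp_add[symmetric] power_divide field_simps)
  have "z = sqrt s * (z / sqrt s)" using s by simp
  also have "\<dots> \<le> sqrt s * (2 * exp ((z / sqrt s)\<^sup>2 / 8))"
    by (intro mult_left_mono le_two_exp) (use s in auto)
  finally have "z * exp (- (z\<^sup>2 / (4 * s)))
      \<le> sqrt s * (2 * exp ((z / sqrt s)\<^sup>2 / 8)) * exp (- (z\<^sup>2 / (4 * s)))"
    by (intro mult_right_mono) auto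
  also have "\<dots> = 2 * sqrt s * exp (- (z\<^sup>2 / (8 * s)))"
    by (simp only: mult.assoc eq)
  finally have 1: "z * exp (- (z\<^sup>2 / (4 * s))) \<le> 2 * sqrt s * exp (- (z\<^sup>2 / (8 * s)))" .
  have "4 * s \<le> 4 * pi * s" using s pi_ge_two by simp
  then have "(4 * pi * s) powr (- 3 / 2) \<le> (4 * s) powr (- 3 / 2)"
    using s by (intro powr_mono2') auto
  also have "\<dots> = 1 / (8 * (s * sqrt s))"
    using s by (subst powr_minus_3_2) (auto simp: real_sqrt_mult)
  also have "\<dots> \<le> 1 / (2 * (s * sqrt s))"
    using s by (intro divide_left_mono) auto
  finally have 2: "(4 * pi * s) powr (- 3 / 2) \<le> 1 / (2 * (s * sqrt s))" .
  have "z * gauss s z = (4 * pi * s) powr (- 3 / 2) * (z * exp (- (z\<^sup>2 / (4 * s))))"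
    by (simp add: gauss_def)
  also have "\<dots> \<le> 1 / (2 * (s * sqrt s)) * (2 * sqrt s * exp (- (z\<^sup>2 / (8 * s))))"
    by (intro mult_mono 1 2) (use s z in auto)
  also have "\<dots> = exp (- (z\<^sup>2 / (8 * s))) / s" using s by simp
  finally show ?thesis .
qed

text \<open>The cross term of (u + r)^2 is nonnegative and is dropped. Of the resulting u^2/(8s),
  one half pays for the growth of the exponential by completing a square, the other half is kept for
  integrability in u.\<close>

lemma exp_add_square_le:
  fixes u r s a A :: real
  assumes s: "0 < s" and "0 \<le> u" "0 \<le> r" "0 \<le> A" "- A \<le> a"
  shows "exp (- 4 * pi * a * u) * exp (- ((u + r)\<^sup>2 / (8 * s)))
    \<le> exp (64 * pi\<^sup>2 * A\<^sup>2 * s) * exp (- (r\<^sup>2 / (8 * s))) * exp (- (u\<^sup>2 / (16 * s)))"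
proof -
  have "- 4 * pi * a * u \<le> 4 * pi * A * u"
    using mult_right_mono[of "- a" A "4 * pi * u"] assms by (simp add: ac_simps)
  also have "\<dots> \<le> 64 * pi\<^sup>2 * A\<^sup>2 * s + u\<^sup>2 / (16 * s)"
  proof -
    \<comment> \<open>The square is arranged so that its mixed term is 4 pi A u and its u-part is
      u^2/(16s), half of the available decay.\<close>
    have "0 \<le> (8 * pi * A * s - u / 4)\<^sup>2 / s" using s by simp
    also have "\<dots> = 64 * pi\<^sup>2 * A\<^sup>2 * s + u\<^sup>2 / (16 * s) - 4 * pi * A * u"
      using s by (simp add: power2_eq_square field_simps)
    finally show ?thesis by simp
  qed
  finally have 1: "- 4 * pi * a * u \<le> 64 * pi\<^sup>2 * A\<^sup>2 * s + u\<^sup>2 / (16 * s)" .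
  have "u\<^sup>2 + r\<^sup>2 \<le> (u + r)\<^sup>2" using assms by (simp add: power2_sum)
  then have "(u\<^sup>2 + r\<^sup>2) / (8 * s) \<le> (u + r)\<^sup>2 / (8 * s)"
    using s by (intro divide_right_mono) auto
  moreover have "u\<^sup>2 / (8 * s) = u\<^sup>2 / (16 * s) + u\<^sup>2 / (16 * s)" by simp
  ultimately have "- 4 * pi * a * u - (u + r)\<^sup>2 / (8 * s)
      \<le> 64 * pi\<^sup>2 * A\<^sup>2 * s - r\<^sup>2 / (8 * s) - u\<^sup>2 / (16 * s)"
    using 1 unfolding add_divide_distrib by linarith
  then show ?thesis unfolding exp_add[symmetric] by simp
qed

text \<open>A majorant that is Gaussian in u and depends on the coupling only through its lower
  bound -A; it serves every later dominated convergence in u.\<close>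

lemma profile_integrand_le:
  assumes s: "0 < s" and "0 \<le> u" "0 \<le> r" "0 \<le> A" "- A \<le> a"
  shows "exp (- 4 * pi * a * u) * ((u + r) * gauss s (u + r))
    \<le> exp (64 * pi\<^sup>2 * A\<^sup>2 * s) * exp (- (r\<^sup>2 / (8 * s))) / s * exp (- (u\<^sup>2 / (16 * s)))"
proof -
  have "exp (- 4 * pi * a * u) * ((u + r) * gauss s (u + r))
      \<le> exp (- 4 * pi * a * u) * (exp (- ((u + r)\<^sup>2 / (8 * s))) / s)"
    using assms by (intro mult_left_mono mult_gauss_le) auto
  also have "\<dots> \<le> exp (64 * pi\<^sup>2 * A\<^sup>2 * s) * exp (- (r\<^sup>2 / (8 * s))) * exp (- (u\<^sup>2 / (16 * s))) / s"
    using divide_right_mono[OF exp_add_square_le[OF assms], of s] s by simp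
  finally show ?thesis by simp
qed

text \<open>The normal density of variance 8s has total mass 1, which yields both integrability and
  the value of the integral.\<close>

lemma exp_square_eq_normal_density:
  fixes s :: real
  assumes s: "0 < s"
  shows "exp (- (u\<^sup>2 / (16 * s))) = 4 * sqrt (pi * s) * normal_density 0 (sqrt (8 * s)) u"
proof -
  have "sqrt (2 * pi * (8 * s)) = 4 * sqrt (pi * s)"
    using real_sqrt_mult[of 16 "pi * s"] by (simp add: ac_simps)
  then show ?thesis using s by (simp add: normal_density_def)
qed

lemma integrable_exp_square:
  "0 < (s::real) \<Longrightarrow> integrable lborel (\<lambda>u. exp (- (u\<^sup>2 / (16 * s))))"
  by (subst exp_square_eq_normal_density) auto

lemma integral_exp_square:
  fixes s :: real
  assumes "0 < s"
  shows "(LBINT u. exp (- (u\<^sup>2 / (16 * s)))) = 4 * sqrt (pi * s)"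
  using assms by (subst exp_square_eq_normal_density) auto

lemma set_integrable_halfline_exp_square:
  fixes f :: "real \<Rightarrow> real" and s :: real
  assumes s: "0 < s" and [measurable]: "f \<in> borel_measurable borel"
    and f: "\<And>u. 0 \<le> u \<Longrightarrow> 0 \<le> f u" "\<And>u. 0 \<le> u \<Longrightarrow> f u \<le> C * exp (- (u\<^sup>2 / (16 * s)))"
  shows "set_integrable lborel {0..} f"
    and "(LBINT u:{0..}. f u) \<le> C * (4 * sqrt (pi * s))"
proof -
  let ?g = "\<lambda>u. C * exp (- (u\<^sup>2 / (16 * s)))"
  have C: "0 \<le> C" using f[of 0] by simp
  have g: "integrable lborel ?g" by (intro integrable_mult_right integrable_exp_square s)
  have le: "indicat_real {0..} u *\<^sub>R f u \<le> ?g u" "0 \<le> indicat_real {0..} u *\<^sub>R f u" for u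
    using f[of u] C by (cases "0 \<le> u"; simp)+
  have i: "integrable lborel (\<lambda>u. indicat_real {0..} u *\<^sub>R f u)"
  proof (rule Bochner_Integration.integrable_bound[OF g])
    show "(\<lambda>u. indicat_real {0..} u *\<^sub>R f u) \<in> borel_measurable lborel" by measurable
    show "AE u in lborel. norm (indicat_real {0..} u *\<^sub>R f u) \<le> norm (?g u)"
    proof (rule AE_I2)
      fix u show "norm (indicat_real {0..} u *\<^sub>R f u) \<le> norm (?g u)"
        unfolding real_norm_def abs_of_nonneg[OF le(2)] using le(1)[of u] by (rule order_trans) (rule abs_ge_self)
    qed
  qed
  then show "set_integrable lborel {0..} f" by (simp add: set_integrable_def)
  have "(LBINT u:{0..}. f u) \<le> (LBINT u. ?g u)"
    unfolding set_lebesgue_integral_def by (intro integral_mono i g le)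
  also have "\<dots> = C * (4 * sqrt (pi * s))"
    using s by (simp add: integral_exp_square)
  finally show "(LBINT u:{0..}. f u) \<le> C * (4 * sqrt (pi * s))" .
qed

lemma profile_measurable [measurable]: "profile a t \<in> borel_measurable borel"
  unfolding profile_def set_lebesgue_integral_def by measurable

lemma set_integrable_profile:
  assumes s: "0 < s" and r: "0 \<le> r"
  shows "set_integrable lborel {0..} (\<lambda>u. exp (- 4 * pi * a * u) * ((u + r) * gauss s (u + r)))"
proof (rule set_integrable_halfline_exp_square[OF s])
  show "exp (- 4 * pi * a * u) * ((u + r) * gauss s (u + r))
    \<le> exp (64 * pi\<^sup>2 * \<bar>a\<bar>\<^sup>2 * s) * exp (- (r\<^sup>2 / (8 * s))) / s * exp (- (u\<^sup>2 / (16 * s)))"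
    if "0 \<le> u" for u
    by (rule profile_integrand_le[OF s that r]) auto
  show "0 \<le> exp (- 4 * pi * a * u) * ((u + r) * gauss s (u + r))" if "0 \<le> u" for u
    by (intro mult_nonneg_nonneg gauss_nonneg exp_ge_zero add_nonneg_nonneg that r)
qed measurable

lemma profile_nonneg: "0 \<le> r \<Longrightarrow> 0 \<le> profile a t r"
  unfolding profile_def set_lebesgue_integral_def
  by (intro integral_nonneg_AE AE_I2) (auto simp: indicator_def gauss_nonneg)

lemma profile_le:
  assumes s: "0 < s" and r: "0 \<le> r" and "0 \<le> A" "- A \<le> a"
  shows "profile a s r
    \<le> 4 * sqrt pi * exp (64 * pi\<^sup>2 * A\<^sup>2 * s) / sqrt s * exp (- (r\<^sup>2 / (8 * s)))"
proof -
  let ?C = "exp (64 * pi\<^sup>2 * A\<^sup>2 * s) * exp (- (r\<^sup>2 / (8 * s))) / s"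
  have "profile a s r \<le> ?C * (4 * sqrt (pi * s))"
    unfolding profile_def
  proof (rule set_integrable_halfline_exp_square[OF s])
    show "exp (- 4 * pi * a * u) * ((u + r) * gauss s (u + r)) \<le> ?C * exp (- (u\<^sup>2 / (16 * s)))"
      if "0 \<le> u" for u
      by (rule profile_integrand_le[OF s that r]) (use assms in auto)
    show "0 \<le> exp (- 4 * pi * a * u) * ((u + r) * gauss s (u + r))" if "0 \<le> u" for u
      by (intro mult_nonneg_nonneg gauss_nonneg exp_ge_zero add_nonneg_nonneg that r)
  qed measurable
  also have "\<dots> = exp (64 * pi\<^sup>2 * A\<^sup>2 * s) * exp (- (r\<^sup>2 / (8 * s))) * 4 * (sqrt (pi * s) / s)"
    by simp
  also have "sqrt (pi * s) / s = sqrt pi / sqrt s"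
    using s real_sqrt_mult_self[of s] by (simp only: real_sqrt_mult) (simp add: divide_eq_eq eq_divide_eq)
  finally show ?thesis by (simp add: ac_simps)
qed

lemma gauss_le_exp_square:
  assumes s: "0 < s"
  shows "gauss s z \<le> (4 * pi * s) powr (- 3 / 2) * exp (- (z\<^sup>2 / (8 * s)))"
proof -
  have "z\<^sup>2 / (8 * s) \<le> z\<^sup>2 / (4 * s)" using s by (intro divide_left_mono) auto
  then show ?thesis unfolding gauss_def by (intro mult_left_mono) auto
qed

lemma set_integrable_exp_gauss:
  assumes s: "0 < s" and r: "0 \<le> r"
  shows "set_integrable lborel {0..} (\<lambda>u. exp (- 4 * pi * a * u) * gauss s (u + r))"
proof (rule set_integrable_halfline_exp_square[OF s])
  let ?c = "(4 * pi * s) powr (- 3 / 2)"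
  let ?C = "?c * (exp (64 * pi\<^sup>2 * \<bar>a\<bar>\<^sup>2 * s) * exp (- (r\<^sup>2 / (8 * s))))"
  show "exp (- 4 * pi * a * u) * gauss s (u + r) \<le> ?C * exp (- (u\<^sup>2 / (16 * s)))" if "0 \<le> u" for u
  proof -
    have "exp (- 4 * pi * a * u) * gauss s (u + r)
        \<le> exp (- 4 * pi * a * u) * (?c * exp (- ((u + r)\<^sup>2 / (8 * s))))"
      by (intro mult_left_mono gauss_le_exp_square s) auto
    also have "\<dots> = ?c * (exp (- 4 * pi * a * u) * exp (- ((u + r)\<^sup>2 / (8 * s))))"
      by (rule mult.left_commute)
    also have "\<dots> \<le> ?c * (exp (64 * pi\<^sup>2 * \<bar>a\<bar>\<^sup>2 * s) * exp (- (r\<^sup>2 / (8 * s))) * exp (- (u\<^sup>2 / (16 * s))))"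
      by (intro mult_left_mono exp_add_square_le[OF s that r]) auto
    finally show ?thesis by (simp only: mult.assoc)
  qed
  show "0 \<le> exp (- 4 * pi * a * u) * gauss s (u + r)" for u
    by (intro mult_nonneg_nonneg gauss_nonneg exp_ge_zero)
qed measurable

section \<open>Integration by parts and positivity of the kernel\<close>

lemma gauss_has_real_derivative:
  assumes "0 < t"
  shows "(gauss t has_real_derivative - (z / (2 * t)) * gauss t z) (at z within S)"
  unfolding gauss_def using assms
  by (auto intro!: derivative_eq_intros simp: power2_eq_square field_simps)

lemma tendsto_exp_gauss_at_top:
  assumes t: "0 < t"
  shows "((\<lambda>u. exp (b * u) * gauss t (u + r)) \<longlongrightarrow> 0) at_top"
proof -
  have lin: "filterlim (\<lambda>u. u + r) at_top at_top"
    by (rule filterlim_tendsto_add_at_top[OF tendsto_const filterlim_ident, of r, simplified add.commute])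
  \<comment> \<open>With c = 1/(4t) the exponent factors: b u - c (u + r)^2 = -(b r + (c (u + r) -
    b) (u + r)), and both factors of the product tend to infinity.\<close>
  have "filterlim (\<lambda>u. - b + 1 / (4 * t) * (u + r)) at_top at_top"
    by (intro filterlim_tendsto_add_at_top[OF tendsto_const] filterlim_tendsto_pos_mult_at_top[OF tendsto_const _ lin])
       (use t in simp)
  from filterlim_at_top_mult_at_top[OF this lin]
  have "filterlim (\<lambda>u. b * r + (- b + 1 / (4 * t) * (u + r)) * (u + r)) at_top at_top"
    by (rule filterlim_tendsto_add_at_top[OF tendsto_const])
  then have "filterlim (\<lambda>u. - (b * r + (- b + 1 / (4 * t) * (u + r)) * (u + r))) at_bot at_top"
    unfolding filterlim_uminus_at_bot minus_minus .
  from tendsto_mult_right_zero[OF filterlim_compose[OF exp_at_bot this], of "(4 * pi * t) powr (- 3 / 2)"]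
  show ?thesis
  proof (rule Lim_transform_eventually[OF _ always_eventually], intro allI)
    fix u
    have "- (b * r + (- b + c * (u + r)) * (u + r)) = b * u + - (c * (u + r)\<^sup>2)" for c :: real
      by (simp add: power2_eq_square algebra_simps)
    from this[of "1 / (4 * t)"]
    show "(4 * pi * t) powr (- 3 / 2) * exp (- (b * r + (- b + 1 / (4 * t) * (u + r)) * (u + r)))
      = exp (b * u) * gauss t (u + r)"
      by (simp only: gauss_def exp_add) simp
  qed
qed

text \<open>The fundamental theorem of calculus on [0, b] for
  \<open>exp (- 4 * pi * a * u) * gauss t (u + r)\<close>, with b tending to infinity: the boundary
  term at 0 is the Gaussian at r, the one at b vanishes, and differentiating the Gaussian produces
  the factor (u + r) / (2t).\<close>

lemma profile_by_parts:
  assumes t: "0 < t" and r: "0 \<le> r"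
  shows "2 * t * gauss t r - 8 * pi * a * t * (LBINT u:{0..}. exp (- 4 * pi * a * u) * gauss t (u + r))
    = profile a t r"
proof -
  let ?e = "\<lambda>u. exp (- 4 * pi * a * u)"
  \<comment> \<open>The derivative of \<open>?e u * gauss t (u + r)\<close> by the product
    rule.\<close>
  let ?f = "\<lambda>u. - 4 * pi * a * (?e u * gauss t (u + r)) - 1 / (2 * t) * (?e u * ((u + r) * gauss t (u + r)))"
  have i1: "set_integrable lborel {0..} (\<lambda>u. - 4 * pi * a * (?e u * gauss t (u + r)))"
    using set_integrable_exp_gauss[OF t r, of a] by (rule set_integrable_mult_right)
  have i2: "set_integrable lborel {0..} (\<lambda>u. 1 / (2 * t) * (?e u * ((u + r) * gauss t (u + r))))"
    using set_integrable_profile[OF t r, of a] by (rule set_integrable_mult_right)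
  have int: "set_integrable lborel {0..} ?f"
    by (rule set_integral_diff(1)[OF i1 i2])
  have "((\<lambda>b. LBINT u:{0..b}. ?f u) \<longlongrightarrow> (LBINT u:{0..}. ?f u)) at_top"
    by (rule tendsto_set_lebesgue_integral_at_top) (use int in auto)
  moreover have "((\<lambda>b. LBINT u:{0..b}. ?f u) \<longlongrightarrow> 0 - gauss t r) at_top"
  proof (rule Lim_transform_eventually)
    show "((\<lambda>b. ?e b * gauss t (b + r) - gauss t r) \<longlongrightarrow> 0 - gauss t r) at_top"
      by (intro tendsto_diff tendsto_const tendsto_exp_gauss_at_top t)
    show "\<forall>\<^sub>F b in at_top. ?e b * gauss t (b + r) - gauss t r = (LBINT u:{0..b}. ?f u)"
      using eventually_ge_at_top[of 0]
    proof eventually_elim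
      fix b :: real assume b: "0 \<le> b"
      have "(LBINT u:{0..b}. ?f u) = ?e b * gauss t (b + r) - ?e 0 * gauss t (0 + r)"
        unfolding set_lebesgue_integral_def
      proof (rule integral_FTC_Icc[OF b])
        fix x
        have "((\<lambda>u. gauss t (u + r)) has_real_derivative - ((x + r) / (2 * t)) * gauss t (x + r)) (at x within {0..b})"
          using gauss_has_real_derivative[OF t, of "x + r" UNIV]
          unfolding DERIV_shift by (rule has_field_derivative_at_within)
        note d = this
        have e: "(?e has_real_derivative - 4 * pi * a * ?e x) (at x within {0..b})"
          by (auto intro!: derivative_eq_intros)
        have "- 4 * pi * a * E * G + - (z / (2 * t)) * G * E = - 4 * pi * a * (E * G) - 1 / (2 * t) * (E * (z * G))"
          for E G z :: real by simp
        then show "((\<lambda>u. ?e u * gauss t (u + r)) has_vector_derivative ?f x) (at x within {0..b})"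
          using DERIV_mult[OF e d]
          unfolding has_real_derivative_iff_has_vector_derivative[symmetric]
          by (simp only:)
        show "continuous_on {0..b} ?f"
          unfolding gauss_def by (intro continuous_intros) (use t in auto)
      qed
      then show "?e b * gauss t (b + r) - gauss t r = (LBINT u:{0..b}. ?f u)" by simp
    qed
  qed
  ultimately have "(LBINT u:{0..}. ?f u) = 0 - gauss t r"
    by (rule tendsto_unique[rotated]) simp
  moreover have "(LBINT u:{0..}. ?f u)
      = - 4 * pi * a * (LBINT u:{0..}. ?e u * gauss t (u + r)) - 1 / (2 * t) * profile a t r"
    unfolding set_integral_diff(2)[OF i1 i2] set_integral_mult_right profile_def ..
  ultimately have eq: "1 / (2 * t) * profile a t r
      = gauss t r - 4 * pi * a * (LBINT u:{0..}. ?e u * gauss t (u + r))"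
    by linarith
  have expand: "2 * t * (c - 4 * pi * a * d) = 2 * t * c - 8 * pi * a * t * d" for c d
    by (simp add: right_diff_distrib)
  have "profile a t r = 2 * t * (1 / (2 * t) * profile a t r)"
    using t by simp
  then show ?thesis unfolding eq expand by (rule sym)
qed

text \<open>The identity also covers x = 0 and y = 0: division by zero gives 0 in the correction
  terms on both sides.\<close>

lemma point_kernel_eq:
  assumes "0 < t"
  shows "point_kernel a t x y
    = heat_kernel t x y + profile a t (norm x + norm y) / (norm x * norm y)"
proof -
  have "profile a t (norm x + norm y) / (norm x * norm y)
    = 2 * t / (norm x * norm y) * gauss t (norm x + norm y) - 8 * pi * a * t / (norm x * norm y)
         * (LBINT u:{0..}. exp (- 4 * pi * a * u) * gauss t (u + norm x + norm y))"
    unfolding profile_by_parts[OF assms add_nonneg_nonneg[OF norm_ge_zero norm_ge_zero], symmetric]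
    by (simp add: diff_divide_distrib add.assoc)
  then show ?thesis by (simp add: point_kernel_def)
qed

lemma vartheta_eq:
  assumes "0 < t"
  shows "vartheta a t x y = profile a t (norm y) / (norm x * norm y)"
  unfolding vartheta_def profile_by_parts[OF assms norm_ge_zero, symmetric]
  by (simp add: diff_divide_distrib)

text \<open>In the profile form both summands are visibly nonnegative for either sign of
  \<open>a\<close>; in the definition they are not when \<open>a\<close> is positive.\<close>

lemma point_kernel_nonneg: "0 < t \<Longrightarrow> 0 \<le> point_kernel a t x y"
  by (auto simp: point_kernel_eq heat_kernel_def gauss_nonneg intro!: add_nonneg_nonneg divide_nonneg_nonneg profile_nonneg)

section \<open>Brownian scaling\<close>

lemma profile_scale:
  assumes k: "0 < k" and t: "0 < t" and r: "0 \<le> r"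
  shows "profile a (k * t) (sqrt k * r) = k powr (- 1 / 2) * profile (sqrt k * a) t r"
proof -
  let ?F = "\<lambda>u. exp (- 4 * pi * a * u) * ((u + sqrt k * r) * gauss (k * t) (u + sqrt k * r))"
  have "profile a (k * t) (sqrt k * r) = (LBINT u. indicat_real {0..} u *\<^sub>R ?F u)"
    by (simp add: profile_def set_lebesgue_integral_def)
  \<comment> \<open>The substitution u -> sqrt k u gives one factor sqrt k, the linear factor u + r
    a second one and the Gaussian k^(-3/2), in total k^(-1/2).\<close>
  also have "\<dots> = sqrt k * (LBINT u. indicat_real {0..} (sqrt k * u) *\<^sub>R ?F (sqrt k * u))"
    using lborel_integral_real_affine[of "sqrt k" "\<lambda>u. indicat_real {0..} u *\<^sub>R ?F u" 0] k by simp
  also have "(\<lambda>u. indicat_real {0..} (sqrt k * u) *\<^sub>R ?F (sqrt k * u))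
    = (\<lambda>u. (sqrt k * k powr (- 3 / 2)) * (indicat_real {0..} u *\<^sub>R (exp (- 4 * pi * (sqrt k * a) * u) * ((u + r) * gauss t (u + r)))))"
  proof
    fix u
    have "sqrt k * u + sqrt k * r = sqrt k * (u + r)" by (simp add: algebra_simps)
    moreover have "indicat_real {0..} (sqrt k * u) = indicat_real {0..} u"
      using k by (simp add: indicator_def zero_le_mult_iff)
    ultimately show "indicat_real {0..} (sqrt k * u) *\<^sub>R ?F (sqrt k * u) = (sqrt k * k powr (- 3 / 2)) *
      (indicat_real {0..} u *\<^sub>R (exp (- 4 * pi * (sqrt k * a) * u) * ((u + r) * gauss t (u + r))))"
      by (simp add: gauss_scale[OF k t] ac_simps)
  qed
  also have "sqrt k * (LBINT u. (sqrt k * k powr (- 3 / 2)) * (indicat_real {0..} u *\<^sub>R (exp (- 4 * pi * (sqrt k * a) * u) * ((u + r) * gauss t (u + r)))))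
    = (sqrt k * sqrt k) * k powr (- 3 / 2) * profile (sqrt k * a) t r"
    by (simp add: profile_def set_lebesgue_integral_def del: real_sqrt_mult_self)
  also have "(sqrt k * sqrt k) * k powr (- 3 / 2) = k powr (- 1 / 2)"
    using k powr_add[of k 1 "- 3 / 2"] by simp
  finally show ?thesis .
qed

text \<open>The denominator |x||y| contributes 1/k to the profile term, which brings its k^(-1/2) to
  the k^(-3/2) of the free Gaussian. The coupling turns into sqrt k times \<open>a\<close>, which is
  the quantity whose limit is prescribed in the theorem.\<close>

lemma point_kernel_scale:
  assumes k: "0 < k" and t: "0 < t"
  shows "point_kernel a (k * t) x (sqrt k *\<^sub>R y)
    = k powr (- 3 / 2) * point_kernel (sqrt k * a) t (x /\<^sub>R sqrt k) y"
proof -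
  define z where "z = x /\<^sub>R sqrt k"
  have x: "x = sqrt k *\<^sub>R z" using k by (simp add: z_def)
  have "norm (sqrt k *\<^sub>R y - sqrt k *\<^sub>R z) = sqrt k * norm (y - z)"
    using k by (simp add: scaleR_diff_right[symmetric])
  moreover have "norm (sqrt k *\<^sub>R z) + norm (sqrt k *\<^sub>R y) = sqrt k * (norm z + norm y)"
    "norm (sqrt k *\<^sub>R z) * norm (sqrt k *\<^sub>R y) = k * (norm z * norm y)"
    using k by (simp_all add: algebra_simps)
  moreover have "k powr (- 1 / 2) / k = k powr (- 3 / 2)"
    using k powr_diff[of k "- 1 / 2" 1] by simp
  then have "k powr (- 1 / 2) * c / (k * d) = k powr (- 3 / 2) * (c / d)" for c d
    by (metis times_divide_times_eq)
  moreover have "profile a (k * t) (sqrt k * norm z + sqrt k * norm y)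
      = k powr (- 1 / 2) * profile (sqrt k * a) t (norm z + norm y)"
    using profile_scale[OF k t, of "norm z + norm y" a] by (simp add: distrib_left)
  ultimately show ?thesis
    unfolding z_def[symmetric] x using k t
    by (simp add: point_kernel_eq heat_kernel_def gauss_scale profile_scale distrib_left del: norm_scaleR)
qed

section \<open>Limits of the profile as the coupling varies\<close>

lemma profile_tendsto:
  assumes t: "0 < t" and a: "a \<longlonglongrightarrow> a'" and r: "r \<longlonglongrightarrow> r'" "\<And>n. 0 \<le> r n"
  shows "(\<lambda>n. profile (a n) t (r n)) \<longlonglongrightarrow> profile a' t r'"
proof -
  \<comment> \<open>A convergent sequence is bounded, and the bound makes the Gaussian majorant
    independent of n.\<close>
  obtain A where A: "0 < A" "\<And>n. norm (a n) \<le> A"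
    using Bseq_eq_bounded convergent_imp_Bseq[OF convergentI[OF a]] by (auto elim: BseqE)
  let ?f = "\<lambda>a r u. indicat_real {0..} u *\<^sub>R (exp (- 4 * pi * a * u) * ((u + r) * gauss t (u + r)))"
  let ?C = "exp (64 * pi\<^sup>2 * A\<^sup>2 * t) / t"
  have "(\<lambda>n. LBINT u. ?f (a n) (r n) u) \<longlonglongrightarrow> (LBINT u. ?f a' r' u)"
  proof (rule integral_dominated_convergence)
    show "integrable lborel (\<lambda>u. ?C * exp (- (u\<^sup>2 / (16 * t))))"
      by (intro integrable_mult_right integrable_exp_square t)
    show "AE u in lborel. (\<lambda>n. ?f (a n) (r n) u) \<longlonglongrightarrow> ?f a' r' u"
      unfolding gauss_def by (intro AE_I2 tendsto_intros a r) (use t in auto)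
    show "AE u in lborel. norm (?f (a n) (r n) u) \<le> ?C * exp (- (u\<^sup>2 / (16 * t)))" for n
    proof (rule AE_I2)
      fix u
      show "norm (?f (a n) (r n) u) \<le> ?C * exp (- (u\<^sup>2 / (16 * t)))"
      proof (cases "0 \<le> u")
        case True
        have "- A \<le> a n" using A(2)[of n] by auto
        have "norm (?f (a n) (r n) u) = exp (- 4 * pi * a n * u) * ((u + r n) * gauss t (u + r n))"
          using True r(2)[of n] by (simp add: abs_mult gauss_nonneg)
        also have "\<dots> \<le> exp (64 * pi\<^sup>2 * A\<^sup>2 * t) * exp (- ((r n)\<^sup>2 / (8 * t))) / t * exp (- (u\<^sup>2 / (16 * t)))"
          by (rule profile_integrand_le[OF t True r(2)]) (use A(1) \<open>- A \<le> a n\<close> in auto)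
        also have "\<dots> \<le> exp (64 * pi\<^sup>2 * A\<^sup>2 * t) * 1 / t * exp (- (u\<^sup>2 / (16 * t)))"
          by (intro mult_right_mono divide_right_mono mult_left_mono) (use t in auto)
        finally show ?thesis by simp
      next
        case False
        then show ?thesis using t by simp
      qed
    qed
  qed measurable
  then show ?thesis by (simp add: profile_def set_lebesgue_integral_def)
qed

lemma profile_tendsto_0:
  assumes t: "0 < t" and a: "filterlim a at_top sequentially" "\<And>n. 0 \<le> a n" and r: "\<And>n. 0 \<le> r n"
  shows "(\<lambda>n. profile (a n) t (r n)) \<longlonglongrightarrow> 0"
proof -
  let ?f = "\<lambda>n u. indicat_real {0..} u *\<^sub>R (exp (- 4 * pi * a n * u) * ((u + r n) * gauss t (u + r n)))"
  \<comment> \<open>This bound decays in n and identifies the pointwise limit, but it is no fixed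
    majorant; \<open>bd'\<close> provides that one.\<close>
  have bd: "norm (?f n u) \<le> indicator {0..} u * (exp (- 4 * pi * a n * u) / t)" for n u
  proof (cases "0 \<le> u")
    case True
    have "norm (?f n u) = exp (- 4 * pi * a n * u) * ((u + r n) * gauss t (u + r n))"
      using True r[of n] by (simp add: abs_mult gauss_nonneg)
    also have "\<dots> \<le> exp (- 4 * pi * a n * u) * (exp (- ((u + r n)\<^sup>2 / (8 * t))) / t)"
      by (intro mult_left_mono mult_gauss_le t) (use True r[of n] in auto)
    also have "\<dots> \<le> exp (- 4 * pi * a n * u) * (1 / t)"
      by (intro mult_left_mono divide_right_mono) (use t in auto)
    finally show ?thesis using True by simp
  qed simp
  \<comment> \<open>The uniform bound in the case A = 0, since all couplings are nonnegative
    here.\<close>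
  have bd': "norm (?f n u) \<le> exp (64 * pi\<^sup>2 * 0\<^sup>2 * t) / t * exp (- (u\<^sup>2 / (16 * t)))" for n u
  proof (cases "0 \<le> u")
    case True
    have "norm (?f n u) = exp (- 4 * pi * a n * u) * ((u + r n) * gauss t (u + r n))"
      using True r[of n] by (simp add: abs_mult gauss_nonneg)
    also have "\<dots> \<le> exp (64 * pi\<^sup>2 * 0\<^sup>2 * t) * exp (- ((r n)\<^sup>2 / (8 * t))) / t * exp (- (u\<^sup>2 / (16 * t)))"
      by (rule profile_integrand_le[OF t True r]) (use a(2)[of n] in auto)
    also have "\<dots> \<le> exp (64 * pi\<^sup>2 * 0\<^sup>2 * t) * 1 / t * exp (- (u\<^sup>2 / (16 * t)))"
      by (intro mult_right_mono divide_right_mono mult_left_mono) (use t in auto)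
    finally show ?thesis by simp
  qed (use t in simp)
  have "(\<lambda>n. LBINT u. ?f n u) \<longlonglongrightarrow> (LBINT u::real. 0)"
  proof (rule integral_dominated_convergence)
    show "integrable lborel (\<lambda>u. exp (64 * pi\<^sup>2 * 0\<^sup>2 * t) / t * exp (- (u\<^sup>2 / (16 * t))))"
      by (intro integrable_mult_right integrable_exp_square t)
    \<comment> \<open>At u = 0 the exponential factor is 1 for every n and the integrand need not
      tend to 0; this single point is a null set.\<close>
    have "(\<lambda>n. ?f n u) \<longlonglongrightarrow> 0" if "u \<noteq> 0" for u
    proof (rule Lim_null_comparison[OF always_eventually])
      show "\<forall>n. norm (?f n u) \<le> indicator {0..} u * (exp (- 4 * pi * a n * u) / t)" using bd by blast
      show "(\<lambda>n. indicator {0..} u * (exp (- 4 * pi * a n * u) / t)) \<longlonglongrightarrow> 0"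
      proof (cases "0 < u")
        case True
        have "filterlim (\<lambda>n. (- 4 * pi * u) * a n) at_bot sequentially"
          using True by (intro filterlim_tendsto_neg_mult_at_bot[OF tendsto_const _ a(1)]) simp
        then have "(\<lambda>n. exp ((- 4 * pi * u) * a n)) \<longlonglongrightarrow> 0"
          by (rule filterlim_compose[OF exp_at_bot])
        then have "(\<lambda>n. exp ((- 4 * pi * u) * a n) / t) \<longlonglongrightarrow> 0 / t"
          by (rule tendsto_divide[OF _ tendsto_const]) (use t in simp)
        then show ?thesis using True by (simp add: ac_simps)
      qed (use that in simp)
    qed
    then show "AE u in lborel. (\<lambda>n. ?f n u) \<longlonglongrightarrow> 0"
      using AE_lborel_singleton[of "0::real"] by (auto elim: eventually_mono)
    show "AE u in lborel. norm (?f n u) \<le> exp (64 * pi\<^sup>2 * 0\<^sup>2 * t) / t * exp (- (u\<^sup>2 / (16 * t)))" for n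
      by (rule AE_I2) (rule bd')
  qed measurable
  then show ?thesis by (simp add: profile_def set_lebesgue_integral_def)
qed

text \<open>Only u in [1, 2] is kept: there u + r is at least 1, the Gaussian is at least its value
  at 2 + R, and the exponential is at least its value at u = 1 because \<open>a\<close> is not
  positive. The bound therefore blows up as \<open>a\<close> tends to -infinity, uniformly for r up
  to R.\<close>

lemma profile_ge:
  assumes t: "0 < t" and r: "0 \<le> r" "r \<le> R" and a: "a \<le> 0"
  shows "exp (- 4 * pi * a) * gauss t (2 + R) \<le> profile a t r"
proof -
  have "exp (- 4 * pi * a) * gauss t (2 + R)
      = (LBINT u::real. indicat_real {1..2} u *\<^sub>R (exp (- 4 * pi * a) * gauss t (2 + R)))"
    by simp
  also have "\<dots> \<le> (LBINT u. indicat_real {0..} u *\<^sub>R (exp (- 4 * pi * a * u) * ((u + r) * gauss t (u + r))))"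
  proof (rule integral_mono)
    show "integrable lborel (\<lambda>u. indicat_real {0..} u *\<^sub>R (exp (- 4 * pi * a * u) * ((u + r) * gauss t (u + r))))"
      using set_integrable_profile[OF t r(1)] by (simp add: set_integrable_def)
    fix u :: real
    show "indicat_real {1..2} u *\<^sub>R (exp (- 4 * pi * a) * gauss t (2 + R))
      \<le> indicat_real {0..} u *\<^sub>R (exp (- 4 * pi * a * u) * ((u + r) * gauss t (u + r)))"
    proof (cases "u \<in> {1..2}")
      case True
      have "(u + r)\<^sup>2 / (4 * t) \<le> (2 + R)\<^sup>2 / (4 * t)"
        using True r t by (intro divide_right_mono power_mono) auto
      then have g: "gauss t (2 + R) \<le> gauss t (u + r)"
        unfolding gauss_def by (intro mult_left_mono) auto
      have "a * u \<le> a * 1" using True a by (intro mult_left_mono_neg) auto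
      then have "exp (- 4 * pi * a) \<le> exp (- 4 * pi * a * u)" by simp
      moreover have "gauss t (2 + R) \<le> (u + r) * gauss t (u + r)"
        using mult_mono[of 1 "u + r", OF _ g] True r by (simp add: gauss_nonneg)
      ultimately show ?thesis using True by (simp add: mult_mono gauss_nonneg)
    next
      case False
      then have "indicat_real {1..2} u = 0" by (rule indicator_simps(2))
      moreover have "0 \<le> indicat_real {0..} u *\<^sub>R (exp (- 4 * pi * a * u) * ((u + r) * gauss t (u + r)))"
        using r by (cases "0 \<le> u") (simp_all add: gauss_nonneg)
      ultimately show ?thesis by simp
    qed
  qed simp
  finally show ?thesis by (simp add: profile_def set_lebesgue_integral_def)
qed

section \<open>Integral bounds for the point kernel\<close>

lemma nn_integral_lborel_scaleR:
  fixes f :: "real^3 \<Rightarrow> ennreal"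
  assumes [measurable]: "f \<in> borel_measurable borel" and c: "0 < c"
  shows "(\<integral>\<^sup>+y. f y \<partial>lborel) = ennreal (c ^ 3) * (\<integral>\<^sup>+y. f (c *\<^sub>R y) \<partial>lborel)"
  by (subst lborel_affine[of c 0])
     (use c in \<open>simp_all add: nn_integral_density nn_integral_distr nn_integral_cmult\<close>)

lemma nn_integral_lborel_diff:
  fixes f :: "real^3 \<Rightarrow> ennreal"
  assumes [measurable]: "f \<in> borel_measurable borel"
  shows "(\<integral>\<^sup>+y. f (y - x) \<partial>lborel) = (\<integral>\<^sup>+y. f y \<partial>lborel)"
  by (subst (2) lborel_affine[of 1 "- x"])
     (simp_all add: nn_integral_density nn_integral_distr nn_integral_cmult)

lemma ennreal_le_suminf: "f m \<le> (\<Sum>n. f n)" for f :: "nat \<Rightarrow> ennreal"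
  using sum_le_suminf[OF summableI, of "{m}" f] by simp

text \<open>Dyadic shells: on the shell between radii 2^(-n-1) and 2^(-n) the integrand is at most
  2^(d(n+1)), and the shell lies in a ball of volume proportional to 2^(-3n). The sum is geometric
  with ratio 2^(d-3) < 1.\<close>

lemma nn_integral_ball_powr_finite:
  assumes "0 \<le> d" "d < 3"
  shows "(\<integral>\<^sup>+(y::real^3). ennreal (norm y powr (- d)) * indicator (ball 0 1) y \<partial>lborel) < \<infinity>"
proof -
  let ?r = "\<lambda>n::nat. 2 powr (- real n)"
  let ?g = "\<lambda>n (y::real^3). ennreal (2 powr (d * (real n + 1))) * indicator (ball 0 (?r n)) y"
  have [measurable]: "ball (0::real^3) r \<in> sets borel" for r by simp
  have "(\<integral>\<^sup>+(y::real^3). ennreal (norm y powr (- d)) * indicator (ball 0 1) y \<partial>lborel)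
     \<le> (\<integral>\<^sup>+y. (\<Sum>n. ?g n y) \<partial>lborel)"
  proof (rule nn_integral_mono)
    fix y :: "real^3"
    show "ennreal (norm y powr (- d)) * indicator (ball 0 1) y \<le> (\<Sum>n. ?g n y)"
    proof (cases "y = 0 \<or> 1 \<le> norm y")
      case False
      have y: "0 < norm y" "norm y < 1" using False by auto
      then have l: "0 < - log 2 (norm y)" by (simp add: log_less_zero_cancel_iff)
      \<comment> \<open>Rounding up and subtracting 1 gives \<open>m < - log 2 (norm y)\<close>
        strictly, as needed for the open ball, and still
        \<open>- log 2 (norm y) \<le> m + 1\<close>.\<close>
      define m where "m = nat (\<lceil>- log 2 (norm y)\<rceil> - 1)"
      have "1 \<le> \<lceil>- log 2 (norm y)\<rceil>" using l by linarith
      then have "real m = real_of_int \<lceil>- log 2 (norm y)\<rceil> - 1" by (simp add: m_def)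
      then have m: "real m < - log 2 (norm y)" "- log 2 (norm y) \<le> real m + 1"
        by linarith+
      have "norm y = 2 powr (log 2 (norm y))" using y by simp
      also have "\<dots> < 2 powr (- real m)" using m(1) by (intro powr_less_mono) auto
      finally have 1: "y \<in> ball 0 (?r m)" by simp
      have "norm y powr (- d) = (2 powr (log 2 (norm y))) powr (- d)" using y by simp
      also have "\<dots> = 2 powr (d * (- log 2 (norm y)))" by (simp add: powr_powr ac_simps)
      also have "\<dots> \<le> 2 powr (d * (real m + 1))"
        using m(2) assms by (intro powr_mono mult_left_mono) auto
      finally have "ennreal (norm y powr (- d)) * indicator (ball 0 1) y \<le> ?g m y"
        using 1 y by (simp add: ennreal_leI)
      also have "\<dots> \<le> (\<Sum>n. ?g n y)" by (rule ennreal_le_suminf)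
      finally show ?thesis .
    next
      \<comment> \<open>At the origin \<open>0 powr _\<close> is 0; outside the unit ball the
        indicator is 0.\<close>
      case True
      then have "ennreal (norm y powr (- d)) * indicator (ball 0 1) y = 0" by auto
      then show ?thesis by (simp only: zero_le)
    qed
  qed
  also have "\<dots> = (\<Sum>n. \<integral>\<^sup>+y. ?g n y \<partial>lborel)"
    by (rule nn_integral_suminf) measurable
  also have "\<dots> = (\<Sum>n. ennreal (2 powr d * unit_ball_vol 3 * (2 powr (d - 3)) ^ n))"
  proof (rule suminf_cong)
    fix n
    have "(\<integral>\<^sup>+y. ?g n y \<partial>lborel) = ennreal (2 powr (d * (real n + 1))) * ennreal (unit_ball_vol 3 * ?r n ^ 3)"
      by (subst nn_integral_cmult_indicator) (simp_all add: emeasure_ball)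
    also have "\<dots> = ennreal (2 powr (d * (real n + 1)) * (unit_ball_vol 3 * ?r n ^ 3))"
      by (simp add: ennreal_mult)
    also have "2 powr (d * (real n + 1)) * (unit_ball_vol 3 * ?r n ^ 3)
        = unit_ball_vol 3 * (2 powr (d * (real n + 1)) * 2 powr (- 3 * real n))"
      by (simp add: powr_realpow[symmetric] powr_powr mult.commute[of "real n"])
    also have "2 powr (d * (real n + 1)) * 2 powr (- 3 * real n) = 2 powr d * (2 powr (d - 3)) ^ n"
      by (simp add: powr_realpow[symmetric] powr_powr powr_add[symmetric] algebra_simps)
    finally show "(\<integral>\<^sup>+y. ?g n y \<partial>lborel) = ennreal (2 powr d * unit_ball_vol 3 * (2 powr (d - 3)) ^ n)"
      by (simp add: ac_simps)
  qed
  also have "\<dots> < \<infinity>"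
  proof -
    have "(2::real) powr (d - 3) < 2 powr 0" using assms by (intro powr_less_mono) auto
    then have "summable (\<lambda>n. 2 powr d * unit_ball_vol 3 * (2 powr (d - 3)) ^ n)"
      by (intro summable_mult summable_geometric) auto
    then show ?thesis by (subst suminf_ennreal2) auto
  qed
  finally show ?thesis .
qed

text \<open>The Gaussian factors over the three coordinates, which reduces the claim to the
  line.\<close>

lemma nn_integral_exp_square_norm_finite:
  assumes "0 < s"
  shows "(\<integral>\<^sup>+(y::real^3). ennreal (exp (- ((norm y)\<^sup>2 / (16 * s)))) \<partial>lborel) < \<infinity>"
proof -
  let ?f = "\<lambda>u::real. ennreal (exp (- (u\<^sup>2 / (16 * s))))"
  have "ennreal (exp (- ((norm y)\<^sup>2 / (16 * s)))) = (\<Prod>b\<in>Basis. ?f (y \<bullet> b))" for y :: "real^3"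
    by (simp add: prod_ennreal exp_sum[symmetric] norm_eq_sqrt_inner euclidean_inner[of y y]
        sum_nonneg power2_eq_square sum_negf sum_divide_distrib)
  then have "(\<integral>\<^sup>+(y::real^3). ennreal (exp (- ((norm y)\<^sup>2 / (16 * s)))) \<partial>lborel)
      = (\<integral>\<^sup>+(y::real^3). (\<Prod>b\<in>Basis. ?f (y \<bullet> b)) \<partial>lborel)"
    by simp
  also have "\<dots> = (\<Prod>b\<in>(Basis :: (real^3) set). \<integral>\<^sup>+u. ?f u \<partial>lborel)"
    by (rule nn_integral_lborel_prod) auto
  also have "\<dots> = (\<integral>\<^sup>+u. ?f u \<partial>lborel) ^ 3" by simp
  also have "(\<integral>\<^sup>+u. ?f u \<partial>lborel) < \<infinity>"
    using integrable_exp_square[OF assms] by (simp add: integrable_iff_bounded)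
  then have "(\<integral>\<^sup>+u. ?f u \<partial>lborel) ^ 3 < \<infinity>"
    by (simp add: power_less_top_ennreal)
  finally show ?thesis .
qed

lemma nn_integral_gauss_finite:
  assumes "0 < s"
  shows "(\<integral>\<^sup>+(y::real^3). ennreal (gauss s (norm y)) \<partial>lborel) < \<infinity>"
proof -
  have "(\<integral>\<^sup>+(y::real^3). ennreal (gauss s (norm y)) \<partial>lborel)
     = (\<integral>\<^sup>+(y::real^3). ennreal ((4 * pi * s) powr (- 3 / 2)) * ennreal (exp (- ((norm y)\<^sup>2 / (16 * (s / 4))))) \<partial>lborel)"
    by (simp add: gauss_def ennreal_mult')
  also have "\<dots> = ennreal ((4 * pi * s) powr (- 3 / 2)) * (\<integral>\<^sup>+(y::real^3). ennreal (exp (- ((norm y)\<^sup>2 / (16 * (s / 4))))) \<partial>lborel)"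
    by (rule nn_integral_cmult) measurable
  also have "\<dots> < \<infinity>"
    using nn_integral_exp_square_norm_finite[of "s / 4"] assms by (simp add: ennreal_mult_less_top)
  finally show ?thesis .
qed

lemma gauss_le:
  assumes s: "0 < s"
  shows "gauss s r \<le> s powr (- 3 / 2)"
proof -
  have "s \<le> 4 * pi * s" using s pi_ge_two by simp
  then have "(4 * pi * s) powr (- 3 / 2) \<le> s powr (- 3 / 2)"
    using s by (intro powr_mono2') auto
  then have "(4 * pi * s) powr (- 3 / 2) * exp (- (r\<^sup>2 / (4 * s))) \<le> s powr (- 3 / 2) * 1"
    using s by (intro mult_mono) auto
  then show ?thesis by (simp add: gauss_def)
qed

lemma nn_integral_cmult_add:
  assumes [measurable]: "f \<in> borel_measurable M" "g \<in> borel_measurable M"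
  shows "(\<integral>\<^sup>+x. c * f x + d * g x \<partial>M) = c * (\<integral>\<^sup>+x. f x \<partial>M) + d * (\<integral>\<^sup>+x. g x \<partial>M)"
  by (simp add: nn_integral_add nn_integral_cmult)

lemma sqrt_cube: "0 < s \<Longrightarrow> sqrt s ^ 3 = s powr (3 / 2)"
  by (simp add: powr_half_sqrt[symmetric] powr_power)

text \<open>Split at |y| = sqrt s. Outside, |y|^(-d) is at most s^(-d/2) and the Gaussian has a
  total mass c1 that does not depend on s. Inside, the Gaussian is at most s^(-3/2), while by
  scaling |y|^(-d) integrates to c2 s^(3/2 - d/2). No step depends on the centre x.\<close>

lemma nn_integral_gauss_powr_le:
  assumes d: "0 \<le> d" "d < 3"
  obtains C where "0 \<le> C" "\<And>s (x::real^3). 0 < s \<Longrightarrow>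
    (\<integral>\<^sup>+y. ennreal (gauss s (norm (y - x)) * norm y powr (- d)) \<partial>lborel) \<le> ennreal (C * s powr (- d / 2))"
proof -
  obtain c1 where c1: "0 \<le> c1" "(\<integral>\<^sup>+(y::real^3). ennreal (gauss 1 (norm y)) \<partial>lborel) = ennreal c1"
    using nn_integral_gauss_finite[of 1] by (auto simp: less_top_ennreal)
  obtain c2 where c2: "0 \<le> c2"
    "(\<integral>\<^sup>+(y::real^3). ennreal (norm y powr (- d)) * indicator (ball 0 1) y \<partial>lborel) = ennreal c2"
    using nn_integral_ball_powr_finite[OF d] by (auto simp: less_top_ennreal)
  have "(\<integral>\<^sup>+y. ennreal (gauss s (norm (y - x)) * norm y powr (- d)) \<partial>lborel)
    \<le> ennreal ((c1 + c2) * s powr (- d / 2))" if s: "0 < s" for s and x :: "real^3"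
  proof -
    have [measurable]: "ball (0::real^3) r \<in> sets borel" for r by simp
    have 1: "(\<integral>\<^sup>+y. ennreal (gauss s (norm (y - x))) \<partial>lborel) = ennreal c1"
    proof -
      have "(\<integral>\<^sup>+y. ennreal (gauss s (norm (y - x))) \<partial>lborel) = (\<integral>\<^sup>+(y::real^3). ennreal (gauss s (norm y)) \<partial>lborel)"
        by (rule nn_integral_lborel_diff[of "\<lambda>y. ennreal (gauss s (norm y))"]) measurable
      also have "\<dots> = ennreal (sqrt s ^ 3) * (\<integral>\<^sup>+(y::real^3). ennreal (gauss s (norm (sqrt s *\<^sub>R y))) \<partial>lborel)"
        by (rule nn_integral_lborel_scaleR) (use s in auto)
      also have "(\<integral>\<^sup>+(y::real^3). ennreal (gauss s (norm (sqrt s *\<^sub>R y))) \<partial>lborel)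
          = (\<integral>\<^sup>+(y::real^3). ennreal (s powr (- 3 / 2)) * ennreal (gauss 1 (norm y)) \<partial>lborel)"
        using gauss_scale[OF s, of 1] s by (simp add: ennreal_mult' gauss_nonneg)
      also have "\<dots> = ennreal (s powr (- 3 / 2)) * ennreal c1"
        by (subst nn_integral_cmult) (auto simp: c1)
      also have "ennreal (sqrt s ^ 3) * (ennreal (s powr (- 3 / 2)) * ennreal c1)
          = ennreal (s powr (3 / 2) * s powr (- 3 / 2)) * ennreal c1"
        using s by (simp add: sqrt_cube ennreal_mult mult.assoc)
      also have "s powr (3 / 2) * s powr (- 3 / 2) = 1"
        using s by (simp add: powr_add[symmetric])
      finally show ?thesis by simp
    qed
    have 2: "(\<integral>\<^sup>+(y::real^3). ennreal (norm y powr (- d)) * indicator (ball 0 (sqrt s)) y \<partial>lborel)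
      = ennreal (s powr (3 / 2) * s powr (- d / 2) * c2)"
    proof -
      have [measurable]: "ball (0::real^3) r \<in> sets borel" for r by simp
      have "(\<integral>\<^sup>+(y::real^3). ennreal (norm y powr (- d)) * indicator (ball 0 (sqrt s)) y \<partial>lborel)
        = ennreal (sqrt s ^ 3) * (\<integral>\<^sup>+(y::real^3). ennreal (norm (sqrt s *\<^sub>R y) powr (- d)) * indicator (ball 0 (sqrt s)) (sqrt s *\<^sub>R y) \<partial>lborel)"
        by (rule nn_integral_lborel_scaleR[OF _ real_sqrt_gt_zero[OF s]]) measurable
      also have "(\<lambda>(y::real^3). ennreal (norm (sqrt s *\<^sub>R y) powr (- d)) * indicator (ball 0 (sqrt s)) (sqrt s *\<^sub>R y))
        = (\<lambda>y. ennreal (s powr (- d / 2)) * (ennreal (norm y powr (- d)) * indicator (ball 0 1) y))"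
      proof
        fix y :: "real^3"
        have "indicator (ball 0 (sqrt s)) (sqrt s *\<^sub>R y) = (indicator (ball 0 1) y :: ennreal)"
          using s by (auto simp: indicator_def)
        moreover have "norm (sqrt s *\<^sub>R y) powr (- d) = s powr (- d / 2) * norm y powr (- d)"
          using s by (simp add: powr_mult powr_half_sqrt[symmetric] powr_powr)
        ultimately show "ennreal (norm (sqrt s *\<^sub>R y) powr (- d)) * indicator (ball 0 (sqrt s)) (sqrt s *\<^sub>R y)
          = ennreal (s powr (- d / 2)) * (ennreal (norm y powr (- d)) * indicator (ball 0 1) y)"
          by (simp add: ennreal_mult' mult.assoc)
      qed
      also have "(\<integral>\<^sup>+(y::real^3). ennreal (s powr (- d / 2)) * (ennreal (norm y powr (- d)) * indicator (ball 0 1) y) \<partial>lborel)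
          = ennreal (s powr (- d / 2)) * ennreal c2"
        by (subst nn_integral_cmult) (auto simp: c2)
      finally show ?thesis using s c2 by (simp add: sqrt_cube ennreal_mult mult.assoc)
    qed
    have "(\<integral>\<^sup>+y. ennreal (gauss s (norm (y - x)) * norm y powr (- d)) \<partial>lborel)
      \<le> (\<integral>\<^sup>+y. ennreal (s powr (- d / 2)) * ennreal (gauss s (norm (y - x)))
          + ennreal (s powr (- 3 / 2)) * (ennreal (norm y powr (- d)) * indicator (ball 0 (sqrt s)) y) \<partial>lborel)"
    proof (rule nn_integral_mono)
      fix y :: "real^3"
      show "ennreal (gauss s (norm (y - x)) * norm y powr (- d))
        \<le> ennreal (s powr (- d / 2)) * ennreal (gauss s (norm (y - x)))
          + ennreal (s powr (- 3 / 2)) * (ennreal (norm y powr (- d)) * indicator (ball 0 (sqrt s)) y)"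
      proof (cases "norm y < sqrt s")
        case True
        have "ennreal (gauss s (norm (y - x)) * norm y powr (- d))
            \<le> ennreal (s powr (- 3 / 2)) * (ennreal (norm y powr (- d)) * indicator (ball 0 (sqrt s)) y)"
          using True gauss_le[OF s] by (auto simp: ennreal_mult[symmetric] intro!: ennreal_leI mult_right_mono)
        also have "\<dots> \<le> ennreal (s powr (- d / 2)) * ennreal (gauss s (norm (y - x))) + \<dots>" by simp
        finally show ?thesis .
      next
        case False
        then have "norm y powr (- d) \<le> sqrt s powr (- d)"
          using s d by (intro powr_mono2') auto
        also have "\<dots> = s powr (- d / 2)"
          using s by (simp add: powr_half_sqrt[symmetric] powr_powr)
        finally have "norm y powr (- d) * gauss s (norm (y - x)) \<le> s powr (- d / 2) * gauss s (norm (y - x))"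
          by (rule mult_right_mono) (rule gauss_nonneg)
        from ennreal_leI[OF this] show ?thesis
          using False by (simp add: ennreal_mult' gauss_nonneg mult.commute[of "gauss s (norm (y - x))"])
      qed
    qed
    also have "\<dots> = ennreal (s powr (- d / 2)) * ennreal c1
        + ennreal (s powr (- 3 / 2)) * ennreal (s powr (3 / 2) * s powr (- d / 2) * c2)"
      unfolding 1[symmetric] 2[symmetric]
      by (rule nn_integral_cmult_add) measurable
    also have "\<dots> = ennreal (s powr (- d / 2) * c1 + s powr (- 3 / 2) * (s powr (3 / 2) * s powr (- d / 2) * c2))"
      using c1(1) c2(1) by (simp only: ennreal_mult[symmetric] ennreal_plus[symmetric] powr_ge_zero mult_nonneg_nonneg)
    also have "s powr (- 3 / 2) * (s powr (3 / 2) * s powr (- d / 2) * c2)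
        = (s powr (- 3 / 2) * s powr (3 / 2)) * (s powr (- d / 2) * c2)"
      by (simp only: mult.assoc)
    also have "s powr (- 3 / 2) * s powr (3 / 2) = 1"
      using s by (simp add: powr_add[symmetric])
    also have "s powr (- d / 2) * c1 + 1 * (s powr (- d / 2) * c2) = (c1 + c2) * s powr (- d / 2)"
      by (simp only: mult_1_left distrib_right mult.commute)
    finally show ?thesis .
  qed
  with c1 c2 show ?thesis by (intro that[of "c1 + c2"]) auto
qed

lemma exp_square_eq_gauss:
  assumes s: "0 < s"
  shows "exp (- (z\<^sup>2 / (8 * s))) = (8 * pi * s) powr (3 / 2) * gauss (2 * s) z"
proof -
  have "(8 * pi * s) powr (3 / 2) * (8 * pi * s) powr (- 3 / 2) = 1"
    using s by (simp add: powr_add[symmetric])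
  then show ?thesis by (simp add: gauss_def mult.assoc[symmetric])
qed

text \<open>For the free part, the factor \<open>1 / |x|\<close> comes from \<open>|x| \<le> |y| + |y - x|\<close>, the factor \<open>|y - x|\<close> being absorbed
  into a Gaussian of twice the variance.\<close>

lemma nn_integral_point_kernel_powr_le:
  assumes g: "0 \<le> g" "g < 1" and T: "0 < T"
  obtains C where "0 \<le> C" "\<And>s x. 0 < s \<Longrightarrow> s \<le> T \<Longrightarrow> x \<noteq> 0 \<Longrightarrow>
    (\<integral>\<^sup>+y. ennreal (point_kernel a s x y * norm y powr (- 1 - g)) \<partial>lborel)
      \<le> ennreal (C * s powr (- g / 2) / norm x)"
proof -
  obtain C0 where C0: "0 \<le> C0" "\<And>s (x::real^3). 0 < s \<Longrightarrow>
    (\<integral>\<^sup>+y. ennreal (gauss s (norm (y - x)) * norm y powr (- g)) \<partial>lborel) \<le> ennreal (C0 * s powr (- g / 2))"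
    using nn_integral_gauss_powr_le[of g] g by auto
  obtain C1 where C1: "0 \<le> C1" "\<And>s (x::real^3). 0 < s \<Longrightarrow>
    (\<integral>\<^sup>+y. ennreal (gauss s (norm (y - x)) * norm y powr (- (1 + g))) \<partial>lborel) \<le> ennreal (C1 * s powr (- (1 + g) / 2))"
    using nn_integral_gauss_powr_le[of "1 + g"] g by auto
  \<comment> \<open>The exponent 2 + g is |y|^(-1-g) times the 1/|y| of the profile term; it stays
    below the dimension 3 because g < 1.\<close>
  obtain C2 where C2: "0 \<le> C2" "\<And>s (x::real^3). 0 < s \<Longrightarrow>
    (\<integral>\<^sup>+y. ennreal (gauss s (norm (y - x)) * norm y powr (- (2 + g))) \<partial>lborel) \<le> ennreal (C2 * s powr (- (2 + g) / 2))"
    using nn_integral_gauss_powr_le[of "2 + g"] g by auto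
  \<comment> \<open>The constant of \<open>profile_le\<close> with A = |a|, made uniform in s by
    replacing s by T in the exponential.\<close>
  define K where "K = 4 * sqrt pi * exp (64 * pi\<^sup>2 * \<bar>a\<bar>\<^sup>2 * T)"
  have K: "0 \<le> K" by (simp add: K_def)
  define p where "p = (8 * pi) powr (3 / 2)"
  have p: "0 \<le> p" by (simp add: p_def)
  define C where "C = C0 + p * C1 + K * p * C2"
  have "(\<integral>\<^sup>+y. ennreal (point_kernel a s x y * norm y powr (- 1 - g)) \<partial>lborel)
      \<le> ennreal (C * s powr (- g / 2) / norm x)" if s: "0 < s" "s \<le> T" and x: "x \<noteq> 0" for s x
  proof -
    have s2: "(8 * pi * s) powr (3 / 2) = p * s powr (3 / 2)"
      using s by (simp add: p_def powr_mult)
    have s3: "s powr (3 / 2) / s = sqrt s" "s powr (3 / 2) / sqrt s = s"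
      using s powr_diff[of s "3 / 2" 1] powr_diff[of s "3 / 2" "1 / 2"] by (simp_all add: powr_half_sqrt)
    have pw: "(2 * s) powr (- e / 2) \<le> s powr (- e / 2)" if "0 \<le> e" for e :: real
      using s that by (intro powr_mono2') auto
    \<comment> \<open>The three summands come from |y| and from |y - x| in the triangle inequality
      for the free part, and from the profile. Both reduced Gaussians are rewritten as
      \<open>gauss (2 * s)\<close>, which accounts for the factors sqrt s and s.\<close>
    have pt: "point_kernel a s x y * norm y powr (- 1 - g)
      \<le> (gauss s (norm (y - x)) * norm y powr (- g)
        + p * sqrt s * (gauss (2 * s) (norm (y - x)) * norm y powr (- (1 + g)))
        + K * p * s * (gauss (2 * s) (norm (y - 0)) * norm y powr (- (2 + g)))) / norm x" for y
    proof (cases "y = 0")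
      \<comment> \<open>The left side vanishes at the origin because \<open>0 powr _\<close> is
        0.\<close>
      case True
      then show ?thesis using K p s by (simp add: gauss_nonneg)
    next
      case False
      then have ny: "0 < norm y" by simp
      have e: "norm y powr (- 1 - g) = norm y powr (- (1 + g))" "norm y powr (- g) = norm y * norm y powr (- (1 + g))"
          "norm y powr (- (2 + g)) = norm y powr (- (1 + g)) / norm y"
        using ny powr_diff[of "norm y" "- (1 + g)" 1] powr_add[of "norm y" 1 "- (1 + g)"] by simp_all
      have "norm x * gauss s (norm (y - x)) \<le> (norm y + norm (y - x)) * gauss s (norm (y - x))"
        by (intro mult_right_mono gauss_nonneg) (metis norm_triangle_sub norm_minus_commute)
      also have "\<dots> \<le> norm y * gauss s (norm (y - x)) + exp (- ((norm (y - x))\<^sup>2 / (8 * s))) / s"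
        using mult_gauss_le[OF s(1), of "norm (y - x)"] by (simp add: distrib_right)
      also have "exp (- ((norm (y - x))\<^sup>2 / (8 * s))) / s = p * sqrt s * gauss (2 * s) (norm (y - x))"
        unfolding exp_square_eq_gauss[OF s(1)] s2 s3(1)[symmetric] by simp
      finally have h1: "gauss s (norm (y - x))
          \<le> (norm y * gauss s (norm (y - x)) + p * sqrt s * gauss (2 * s) (norm (y - x))) / norm x"
        using x by (simp add: le_divide_eq mult.commute)
      have "profile a s (norm x + norm y)
          \<le> 4 * sqrt pi * exp (64 * pi\<^sup>2 * \<bar>a\<bar>\<^sup>2 * s) / sqrt s * exp (- ((norm x + norm y)\<^sup>2 / (8 * s)))"
        by (rule profile_le) (use s in auto)
      also have "\<dots> \<le> K / sqrt s * exp (- ((norm y)\<^sup>2 / (8 * s)))"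
        unfolding K_def
        by (intro mult_mono divide_right_mono mult_left_mono divide_nonneg_nonneg mult_nonneg_nonneg)
           (use s in \<open>auto intro!: divide_right_mono power_mono mult_left_mono\<close>)
      also have "\<dots> = K * p * s * gauss (2 * s) (norm y)"
        unfolding exp_square_eq_gauss[OF s(1)] s2 using s3(2) by (simp add: divide_simps ac_simps)
      finally have h2: "profile a s (norm x + norm y) / (norm x * norm y)
          \<le> K * p * s * gauss (2 * s) (norm y) / (norm x * norm y)"
        by (rule divide_right_mono) simp
      have "point_kernel a s x y \<le> (norm y * gauss s (norm (y - x)) + p * sqrt s * gauss (2 * s) (norm (y - x))) / norm x
          + K * p * s * gauss (2 * s) (norm y) / (norm x * norm y)"
        using h1 h2 s by (simp add: point_kernel_eq heat_kernel_def)
      then have "point_kernel a s x y * norm y powr (- (1 + g))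
        \<le> ((norm y * gauss s (norm (y - x)) + p * sqrt s * gauss (2 * s) (norm (y - x))) / norm x
          + K * p * s * gauss (2 * s) (norm y) / (norm x * norm y)) * norm y powr (- (1 + g))"
        by (rule mult_right_mono) simp
      also have "\<dots> = (gauss s (norm (y - x)) * (norm y * norm y powr (- (1 + g)))
        + p * sqrt s * (gauss (2 * s) (norm (y - x)) * norm y powr (- (1 + g)))
        + K * p * s * (gauss (2 * s) (norm (y - 0)) * (norm y powr (- (1 + g)) / norm y))) / norm x"
        by (simp add: distrib_right distrib_left add_divide_distrib ac_simps)
      finally show ?thesis unfolding e .
    qed
    define A where "A = (\<lambda>(y::real^3). gauss s (norm (y - x)) * norm y powr (- g))"
    define B where "B = (\<lambda>(y::real^3). gauss (2 * s) (norm (y - x)) * norm y powr (- (1 + g)))"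
    define D where "D = (\<lambda>(y::real^3). gauss (2 * s) (norm (y - 0)) * norm y powr (- (2 + g)))"
    have [measurable]: "A \<in> borel_measurable borel" "B \<in> borel_measurable borel" "D \<in> borel_measurable borel"
      unfolding A_def B_def D_def by measurable
    have nn: "0 \<le> A y" "0 \<le> B y" "0 \<le> D y" for y
      by (simp_all add: A_def B_def D_def gauss_nonneg)
    have IA: "(\<integral>\<^sup>+y. ennreal (A y) \<partial>lborel) \<le> ennreal (C0 * s powr (- g / 2))"
      unfolding A_def by (rule C0(2)[OF s(1)])
    have IB: "(\<integral>\<^sup>+y. ennreal (B y) \<partial>lborel) \<le> ennreal (C1 * s powr (- (1 + g) / 2))"
      unfolding B_def
      by (rule order_trans[OF C1(2)]) (use s C1(1) g pw[of "1 + g"] in \<open>auto intro!: ennreal_leI mult_left_mono\<close>)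
    have ID: "(\<integral>\<^sup>+y. ennreal (D y) \<partial>lborel) \<le> ennreal (C2 * s powr (- (2 + g) / 2))"
      unfolding D_def
      by (rule order_trans[OF C2(2)]) (use s C2(1) g pw[of "2 + g"] in \<open>auto intro!: ennreal_leI mult_left_mono\<close>)
    have "(\<integral>\<^sup>+y. ennreal (point_kernel a s x y * norm y powr (- 1 - g)) \<partial>lborel)
      \<le> (\<integral>\<^sup>+y. ennreal (1 / norm x) * (ennreal (A y) + ennreal (p * sqrt s) * ennreal (B y) + ennreal (K * p * s) * ennreal (D y)) \<partial>lborel)"
    proof (rule nn_integral_mono)
      fix y
      have "ennreal (point_kernel a s x y * norm y powr (- 1 - g))
        \<le> ennreal ((A y + p * sqrt s * B y + K * p * s * D y) / norm x)"
        unfolding A_def B_def D_def by (rule ennreal_leI) (rule pt)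
      also have "\<dots> = ennreal (1 / norm x) * (ennreal (A y) + ennreal (p * sqrt s) * ennreal (B y) + ennreal (K * p * s) * ennreal (D y))"
        using nn[of y] K p s by (simp add: ennreal_mult[symmetric] ennreal_plus[symmetric] del: ennreal_plus)
      finally show "ennreal (point_kernel a s x y * norm y powr (- 1 - g)) \<le> \<dots>" .
    qed
    also have "\<dots> = ennreal (1 / norm x) * ((\<integral>\<^sup>+y. ennreal (A y) \<partial>lborel)
        + ennreal (p * sqrt s) * (\<integral>\<^sup>+y. ennreal (B y) \<partial>lborel) + ennreal (K * p * s) * (\<integral>\<^sup>+y. ennreal (D y) \<partial>lborel))"
      by (simp add: nn_integral_cmult nn_integral_add)
    also have "\<dots> \<le> ennreal (1 / norm x) * (ennreal (C0 * s powr (- g / 2))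
        + ennreal (p * sqrt s) * ennreal (C1 * s powr (- (1 + g) / 2)) + ennreal (K * p * s) * ennreal (C2 * s powr (- (2 + g) / 2)))"
      by (intro mult_left_mono add_mono IA IB ID) auto
    also have "\<dots> = ennreal ((C0 * s powr (- g / 2) + p * sqrt s * (C1 * s powr (- (1 + g) / 2)) + K * p * s * (C2 * s powr (- (2 + g) / 2))) / norm x)"
      using C0(1) C1(1) C2(1) K p s by (simp add: ennreal_mult[symmetric] ennreal_plus[symmetric] del: ennreal_plus)
    also have "C0 * s powr (- g / 2) + p * sqrt s * (C1 * s powr (- (1 + g) / 2)) + K * p * s * (C2 * s powr (- (2 + g) / 2))
        = C * s powr (- g / 2)"
    proof -
      \<comment> \<open>The factors sqrt s and s restore the powers lost through the stronger
        singularities 1 + g and 2 + g, so all three terms have order s^(-g/2).\<close>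
      have "1 / 2 + - (1 + g) / 2 = - g / 2" "1 + - (2 + g) / 2 = - g / 2"
        by (simp_all add: field_simps)
      then have "sqrt s * s powr (- (1 + g) / 2) = s powr (- g / 2)" "s * s powr (- (2 + g) / 2) = s powr (- g / 2)"
        using s powr_add[of s "1 / 2" "- (1 + g) / 2"] powr_add[of s 1 "- (2 + g) / 2"]
        by (simp_all only: powr_half_sqrt powr_one)
      moreover have "C0 * s powr (- g / 2) + p * sqrt s * (C1 * s powr (- (1 + g) / 2)) + K * p * s * (C2 * s powr (- (2 + g) / 2))
        = C0 * s powr (- g / 2) + p * C1 * (sqrt s * s powr (- (1 + g) / 2)) + K * p * C2 * (s * s powr (- (2 + g) / 2))"
        by (simp only: ac_simps)
      ultimately show ?thesis by (simp only: C_def distrib_right)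
    qed
    finally show ?thesis .
  qed
  moreover have "0 \<le> C" using C0 C1 C2 K p by (simp add: C_def)
  ultimately show ?thesis using that by blast
qed

section \<open>Random measures and their means\<close>

text \<open>A continuous exhaustion of the punctured space: the first factor rises from 0 to 1
  between radii 1/n and 2/n, the second falls back to 0 between n - 1 and n. It increases in n, so
  monotone convergence applies.\<close>

definition cutoff :: "nat \<Rightarrow> real^3 \<Rightarrow> real" where
  "cutoff n x = max 0 (min 1 (real n * norm x - 1)) * max 0 (min 1 (real n - norm x))"

lemma cutoff_bounds: "0 \<le> cutoff n x" "cutoff n x \<le> 1"
  by (auto simp: cutoff_def intro: mult_le_one)

lemma cutoff_0 [simp]: "cutoff n 0 = 0"
  by (simp add: cutoff_def)

lemma continuous_cutoff: "continuous_on A (cutoff n)"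
  unfolding cutoff_def by (intro continuous_intros)

lemma cutoff_mono: "cutoff n x \<le> cutoff (Suc n) x"
  unfolding cutoff_def
proof (rule mult_mono)
  have "real n * norm x \<le> real (Suc n) * norm x" by (intro mult_right_mono) auto
  then show "max 0 (min 1 (real n * norm x - 1)) \<le> max 0 (min 1 (real (Suc n) * norm x - 1))"
    by (intro max.mono min.mono) auto
qed auto

lemma cutoff_eventually_1:
  assumes "x \<noteq> 0"
  shows "\<forall>\<^sub>F n in sequentially. cutoff n x = 1"
proof -
  have "\<forall>\<^sub>F n in sequentially. 2 / norm x \<le> real n"
    using filterlim_real_sequentially by (auto simp: filterlim_at_top)
  moreover have "\<forall>\<^sub>F n in sequentially. norm x + 1 \<le> real n"
    using filterlim_real_sequentially by (auto simp: filterlim_at_top)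
  ultimately show ?thesis
  proof eventually_elim
    case (elim n)
    then have "2 \<le> real n * norm x" using assms by (simp add: divide_le_eq)
    then show ?case using elim by (simp add: cutoff_def)
  qed
qed

lemma cutoff_times_Ccom_plus:
  assumes "continuous_on punctured g" "\<And>x. x \<noteq> 0 \<Longrightarrow> 0 \<le> g x"
  shows "(\<lambda>x. cutoff n x * g x) \<in> Ccom_plus"
proof -
  \<comment> \<open>The inner radius uses \<open>Suc n\<close> because for n = 0 the value 1/0 = 0
    would leave the origin in the set.\<close>
  let ?K = "cball 0 (real n) - ball 0 (1 / real (Suc n)) :: (real^3) set"
  have "compact ?K" by (intro compact_diff) auto
  moreover have "?K \<subseteq> punctured" by auto
  moreover have "cutoff n x * g x = 0" if "x \<in> punctured - ?K" for x
  proof -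
    have "norm x < 1 / real (Suc n) \<or> real n < norm x" using that by auto
    then have "real n * norm x - 1 \<le> 0 \<or> real n - norm x \<le> 0"
    proof
      assume "norm x < 1 / real (Suc n)"
      then have "real (Suc n) * norm x < 1" by (simp add: less_divide_eq mult.commute)
      moreover have "real n * norm x \<le> real (Suc n) * norm x" by (intro mult_right_mono) auto
      ultimately show ?thesis by linarith
    qed auto
    then show ?thesis by (auto simp: cutoff_def)
  qed
  ultimately have "\<exists>K. compact K \<and> K \<subseteq> punctured \<and> (\<forall>x\<in>punctured - K. cutoff n x * g x = 0)"
    by blast
  then show ?thesis
    using assms unfolding Ccom_plus_def
    by (auto intro!: continuous_on_mult continuous_cutoff mult_nonneg_nonneg cutoff_bounds)
qed

section \<open>Measurability of evaluations for the vague Borel structure\<close>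

lemma space_punctured_borel [simp]: "space punctured_borel = punctured"
  by (simp add: space_restrict_space)

lemma open_in_sets_punctured_borel: "open A \<Longrightarrow> A \<subseteq> punctured \<Longrightarrow> A \<in> sets punctured_borel"
  by (auto simp: sets_restrict_space_iff)

lemma continuous_on_punctured_measurable:
  assumes "continuous_on punctured (f :: real^3 \<Rightarrow> 'b::topological_space)"
  shows "f \<in> borel_measurable punctured_borel"
  using borel_measurable_continuous_on_restrict[OF assms] .

lemma Ccom_plus_measurable: "f \<in> Ccom_plus \<Longrightarrow> f \<in> borel_measurable punctured_borel"
  by (rule continuous_on_punctured_measurable) (simp add: Ccom_plus_def)

lemma tempered_measures_sets: "\<mu> \<in> tempered_measures \<rho> \<Longrightarrow> sets \<mu> = sets punctured_borel"
  by (simp add: tempered_measures_def)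

lemma tempered_measures_space: "\<mu> \<in> tempered_measures \<rho> \<Longrightarrow> space \<mu> = punctured"
  using sets_eq_imp_space_eq[of \<mu> punctured_borel] by (simp add: tempered_measures_sets)

lemma topspace_vague: "openin (vague_topology \<rho>) U \<Longrightarrow> U \<subseteq> tempered_measures \<rho>"
proof -
  assume "openin (vague_topology \<rho>) U"
  then have "U \<subseteq> topspace (vague_topology \<rho>)" by (rule openin_subset)
  then show ?thesis by (auto simp: vague_topology_def)
qed

lemma space_vague_borel [simp]: "space (vague_borel \<rho>) = tempered_measures \<rho>"
  unfolding vague_borel_def by (rule space_measure_of) (use topspace_vague in blast)

text \<open>Preimages of open sets under integration of f are members of the generating family of
  the vague topology.\<close>

lemma nn_integral_vague_measurable:
  assumes f: "f \<in> Ccom_plus"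
  shows "(\<lambda>\<mu>. \<integral>\<^sup>+x. ennreal (f x) \<partial>\<mu>) \<in> borel_measurable (vague_borel \<rho>)"
proof (rule borel_measurableI)
  fix S :: "ennreal set" assume S: "open S"
  have "{\<mu> \<in> tempered_measures \<rho>. (\<integral>\<^sup>+x. ennreal (f x) \<partial>\<mu>) \<in> S} \<in> sets (vague_borel \<rho>)"
    unfolding vague_borel_def
  proof (rule in_measure_of)
    show "{U. openin (vague_topology \<rho>) U} \<subseteq> Pow (tempered_measures \<rho>)"
      using topspace_vague by blast
    show "{\<mu> \<in> tempered_measures \<rho>. (\<integral>\<^sup>+x. ennreal (f x) \<partial>\<mu>) \<in> S} \<in> {U. openin (vague_topology \<rho>) U}"
      unfolding vague_topology_def using f S by (auto intro!: topology_generated_by_Basis)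
  qed
  also have "{\<mu> \<in> tempered_measures \<rho>. (\<integral>\<^sup>+x. ennreal (f x) \<partial>\<mu>) \<in> S}
      = (\<lambda>\<mu>. \<integral>\<^sup>+x. ennreal (f x) \<partial>\<mu>) -` S \<inter> space (vague_borel \<rho>)" by auto
  finally show "(\<lambda>\<mu>. \<integral>\<^sup>+x. ennreal (f x) \<partial>\<mu>) -` S \<inter> space (vague_borel \<rho>) \<in> sets (vague_borel \<rho>)" .
qed

text \<open>The indicator of an open set is the increasing limit of functions in
  \<open>Ccom_plus\<close>, built from the truncated distance to the complement and the cutoff;
  monotone convergence passes measurability to the limit.\<close>

lemma emeasure_open_vague_measurable:
  assumes A: "open A" "A \<subseteq> punctured"
  shows "(\<lambda>\<mu>. emeasure \<mu> A) \<in> borel_measurable (vague_borel \<rho>)"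
proof -
  let ?g = "\<lambda>n x. min 1 (real n * infdist x (- A))"
  let ?f = "\<lambda>n x. cutoff n x * ?g n x"
  have f: "?f n \<in> Ccom_plus" for n
    by (rule cutoff_times_Ccom_plus) (auto intro!: continuous_intros mult_nonneg_nonneg infdist_nonneg)
  have inc: "incseq (\<lambda>n x. ennreal (?f n x))"
  proof (rule incseq_SucI, rule le_funI, rule ennreal_leI, rule mult_mono)
    fix n x
    have "real n * infdist x (- A) \<le> real (Suc n) * infdist x (- A)"
      by (intro mult_right_mono infdist_nonneg) auto
    then show "?g n x \<le> ?g (Suc n) x" by (intro min.mono) auto
  qed (auto intro!: cutoff_mono cutoff_bounds mult_nonneg_nonneg infdist_nonneg)
  have lim: "(\<lambda>n. ennreal (?f n x)) \<longlonglongrightarrow> indicator A x" for x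
  proof (cases "x \<in> A")
    case True
    then have x0: "x \<noteq> 0" using A by auto
    \<comment> \<open>The complement is nonempty since it contains the origin; the distance to an
      empty set would be 0 by default.\<close>
    have "0 < infdist x (- A)"
      using A True by (intro infdist_pos_not_in_closed) auto
    then have "\<forall>\<^sub>F n in sequentially. 1 / infdist x (- A) \<le> real n"
      using filterlim_real_sequentially by (auto simp: filterlim_at_top)
    with cutoff_eventually_1[OF x0] have "\<forall>\<^sub>F n in sequentially. ennreal (?f n x) = indicator A x"
    proof eventually_elim
      case (elim n)
      then have "1 \<le> real n * infdist x (- A)" using \<open>0 < infdist x (- A)\<close> by (simp add: divide_le_eq)
      then show ?case using elim True by simp
    qed
    then show ?thesis by (rule tendsto_eventually)
  next
    case False
    then show ?thesis by simp
  qed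
  have lim': "(\<lambda>n. \<integral>\<^sup>+x. ennreal (?f n x) \<partial>\<mu>) \<longlonglongrightarrow> emeasure \<mu> A" if "\<mu> \<in> space (vague_borel \<rho>)" for \<mu>
  proof -
    have s: "sets \<mu> = sets punctured_borel" using that by (simp add: tempered_measures_sets)
    have "(\<lambda>n. \<integral>\<^sup>+x. ennreal (?f n x) \<partial>\<mu>) \<longlonglongrightarrow> (\<integral>\<^sup>+x. indicator A x \<partial>\<mu>)"
    proof (rule nn_integral_LIMSEQ[OF inc _ lim])
      fix n show "(\<lambda>x. ennreal (?f n x)) \<in> borel_measurable \<mu>"
        unfolding measurable_cong_sets[OF s refl]
        using Ccom_plus_measurable[OF f[of n]] by (rule measurable_compose) simp
    qed
    also have "(\<integral>\<^sup>+x. indicator A x \<partial>\<mu>) = emeasure \<mu> A"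
      using open_in_sets_punctured_borel[OF A] s by (intro nn_integral_indicator) auto
    finally show ?thesis .
  qed
  show ?thesis
    by (rule borel_measurable_LIMSEQ_order[OF lim' nn_integral_vague_measurable[OF f]])
qed

text \<open>Open sets exhausting the punctured space, each inside a compact subset of it. Tempered
  measures are finite on them, so that masses of complements may be subtracted there.\<close>

definition annulus :: "nat \<Rightarrow> (real^3) set" where
  "annulus n = {x. 1 / real (Suc n) < norm x \<and> norm x < real (Suc n)}"

lemma open_annulus: "open (annulus n)"
  unfolding annulus_def by (intro open_Collect_conj open_Collect_less continuous_intros)

lemma annulus_subset: "annulus n \<subseteq> punctured"
  by (auto simp: annulus_def)

lemma incseq_annulus: "incseq annulus"
proof (rule incseq_SucI)
  fix n
  have "1 / real (Suc (Suc n)) \<le> 1 / real (Suc n)" by (intro divide_left_mono) auto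
  then show "annulus n \<subseteq> annulus (Suc n)" by (auto simp: annulus_def)
qed

lemma UN_annulus: "(\<Union>n. annulus n) = punctured"
proof -
  have "\<exists>n. x \<in> annulus n" if "x \<noteq> 0" for x
  proof -
    obtain n where n: "max (1 / norm x) (norm x) < real n" using reals_Archimedean2 by blast
    then have "1 / norm x < real (Suc n)" "norm x < real (Suc n)" by auto
    then show ?thesis using that by (auto simp: annulus_def divide_simps mult.commute)
  qed
  then show ?thesis using annulus_subset by auto
qed

lemma emeasure_annulus_finite:
  assumes "\<mu> \<in> tempered_measures \<rho>"
  shows "emeasure \<mu> (annulus n) < \<infinity>"
proof -
  let ?K = "cball 0 (real (Suc n)) - ball 0 (1 / real (Suc n)) :: (real^3) set"
  have "compact ?K" "?K \<subseteq> punctured" by (auto intro!: compact_diff)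
  then have "emeasure \<mu> ?K < \<infinity>" using assms by (auto simp: tempered_measures_def)
  moreover have "emeasure \<mu> (annulus n) \<le> emeasure \<mu> ?K"
  proof (rule emeasure_mono)
    show "?K \<in> sets \<mu>"
      using \<open>compact ?K\<close> \<open>?K \<subseteq> punctured\<close> assms
      by (auto simp: tempered_measures_sets sets_restrict_space_iff compact_imp_closed)
  qed (auto simp: annulus_def)
  ultimately show ?thesis by simp
qed

lemma sigma_finite_tempered:
  assumes "\<mu> \<in> tempered_measures \<rho>"
  shows "sigma_finite_measure \<mu>"
proof
  show "\<exists>A. countable A \<and> A \<subseteq> sets \<mu> \<and> \<Union> A = space \<mu> \<and> (\<forall>a\<in>A. emeasure \<mu> a \<noteq> \<infinity>)"
    using assms emeasure_annulus_finite[OF assms] open_in_sets_punctured_borel[OF open_annulus annulus_subset]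
    by (intro exI[of _ "range annulus"]) (auto simp: tempered_measures_sets tempered_measures_space UN_annulus less_top)
qed

text \<open>A pi-lambda argument starting from open sets, carried out inside one annulus at a time
  because the complement step needs finite mass; afterwards the annuli exhaust the space.\<close>

lemma emeasure_vague_measurable:
  assumes A: "A \<in> sets punctured_borel"
  shows "(\<lambda>\<mu>. emeasure \<mu> A) \<in> borel_measurable (vague_borel \<rho>)"
proof -
  have ann: "(\<lambda>\<mu>. emeasure \<mu> (B \<inter> annulus n)) \<in> borel_measurable (vague_borel \<rho>)" if "B \<in> sets borel" for B n
  proof -
    have "Int_stable {S :: (real^3) set. open S}" by (auto simp: Int_stable_def)
    moreover have "{S :: (real^3) set. open S} \<subseteq> Pow UNIV" by simp
    moreover have "B \<in> sigma_sets UNIV {S. open S}" using that by (simp add: borel_def)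
    ultimately show ?thesis
    proof (induction rule: sigma_sets_induct_disjoint)
      case (basic A)
      then show ?case
        by (intro emeasure_open_vague_measurable) (use annulus_subset open_annulus in auto)
    next
      case empty
      then show ?case by simp
    next
      case (compl A)
      have A: "A \<in> sets borel" using compl by (simp add: borel_def)
      have "(\<lambda>\<mu>. emeasure \<mu> (annulus n) - emeasure \<mu> (A \<inter> annulus n)) \<in> borel_measurable (vague_borel \<rho>)"
        using compl(2) emeasure_open_vague_measurable[OF open_annulus annulus_subset]
        by (rule borel_measurable_minus_ennreal[rotated])
      moreover have "emeasure \<mu> ((UNIV - A) \<inter> annulus n) = emeasure \<mu> (annulus n) - emeasure \<mu> (A \<inter> annulus n)"
        if "\<mu> \<in> space (vague_borel \<rho>)" for \<mu>
      proof -
        have \<mu>: "\<mu> \<in> tempered_measures \<rho>" using that by simp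
        have "(UNIV - A) \<inter> annulus n = annulus n - A \<inter> annulus n" by auto
        moreover have "A \<inter> annulus n \<in> sets \<mu>" "annulus n \<in> sets \<mu>"
          using A annulus_subset open_annulus \<mu> by (auto simp: tempered_measures_sets sets_restrict_space_iff)
        moreover have "emeasure \<mu> (A \<inter> annulus n) \<le> emeasure \<mu> (annulus n)"
          using calculation by (intro emeasure_mono) auto
        then have "emeasure \<mu> (A \<inter> annulus n) \<noteq> \<infinity>"
          using emeasure_annulus_finite[OF \<mu>, of n] by (auto simp: top_unique)
        ultimately show ?thesis by (simp add: emeasure_Diff)
      qed
      ultimately show ?case by (subst measurable_cong) auto
    next
      case (union A)
      have A: "A i \<in> sets borel" for i using union by (auto simp: borel_def)
      have "emeasure \<mu> ((\<Union>i. A i) \<inter> annulus n) = (\<Sum>i. emeasure \<mu> (A i \<inter> annulus n))"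
        if "\<mu> \<in> space (vague_borel \<rho>)" for \<mu>
      proof -
        have \<mu>: "\<mu> \<in> tempered_measures \<rho>" using that by simp
        have "(\<Sum>i. emeasure \<mu> (A i \<inter> annulus n)) = emeasure \<mu> (\<Union>i. A i \<inter> annulus n)"
        proof (rule suminf_emeasure)
          show "range (\<lambda>i. A i \<inter> annulus n) \<subseteq> sets \<mu>"
            using A annulus_subset open_annulus \<mu> by (auto simp: tempered_measures_sets sets_restrict_space_iff)
          show "disjoint_family (\<lambda>i. A i \<inter> annulus n)"
            using union(1) by (auto simp: disjoint_family_on_def)
        qed
        then show ?thesis by (simp add: Int_UN_distrib2)
      qed
      then have "(\<lambda>\<mu>. emeasure \<mu> ((\<Union>i. A i) \<inter> annulus n)) \<in> borel_measurable (vague_borel \<rho>)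
          \<longleftrightarrow> (\<lambda>\<mu>. \<Sum>i. emeasure \<mu> (A i \<inter> annulus n)) \<in> borel_measurable (vague_borel \<rho>)"
        by (rule measurable_cong)
      then show ?case using union(3) by (simp add: borel_measurable_suminf_order)
    qed
  qed
  have A': "A \<in> sets borel" "A \<subseteq> punctured" using A by (auto simp: sets_restrict_space_iff)
  have lim: "(\<lambda>n. emeasure \<mu> (A \<inter> annulus n)) \<longlonglongrightarrow> emeasure \<mu> A" if "\<mu> \<in> space (vague_borel \<rho>)" for \<mu>
  proof -
    have \<mu>: "\<mu> \<in> tempered_measures \<rho>" using that by simp
    have "(\<lambda>n. emeasure \<mu> (A \<inter> annulus n)) \<longlonglongrightarrow> emeasure \<mu> (\<Union>n. A \<inter> annulus n)"
    proof (rule Lim_emeasure_incseq)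
      show "range (\<lambda>n. A \<inter> annulus n) \<subseteq> sets \<mu>"
        using A' annulus_subset open_annulus \<mu> by (auto simp: tempered_measures_sets sets_restrict_space_iff)
      show "incseq (\<lambda>n. A \<inter> annulus n)" using incseq_annulus by (auto simp: incseq_def)
    qed
    also have "(\<Union>n. A \<inter> annulus n) = A" using A' UN_annulus by auto
    finally show ?thesis .
  qed
  show ?thesis
    by (rule borel_measurable_LIMSEQ_order[OF lim ann[OF A'(1)]])
qed

section \<open>Mean measures and integration against them\<close>

context
  fixes \<rho> :: real and Q :: "'w measure" and Y :: "'w \<Rightarrow> (real^3) measure"
  assumes Y: "Y \<in> measurable Q (vague_borel \<rho>)"
begin

lemma random_measure_tempered: "\<omega> \<in> space Q \<Longrightarrow> Y \<omega> \<in> tempered_measures \<rho>"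
  using measurable_space[OF Y] by simp

lemma random_measure_sets: "\<omega> \<in> space Q \<Longrightarrow> sets (Y \<omega>) = sets punctured_borel"
  by (rule tempered_measures_sets[OF random_measure_tempered])

lemma emeasure_random_measurable:
  "A \<in> sets punctured_borel \<Longrightarrow> (\<lambda>\<omega>. emeasure (Y \<omega>) A) \<in> borel_measurable Q"
  by (rule measurable_compose[OF Y emeasure_vague_measurable])

lemma sets_mean_measure: "sets (mean_measure Q Y) = sets punctured_borel"
proof -
  have "sets punctured_borel \<subseteq> Pow punctured"
    using sets.space_closed[of punctured_borel] by simp
  then have "sets (mean_measure Q Y) = sigma_sets punctured (sets punctured_borel)"
    unfolding mean_measure_def by (rule sets_measure_of)
  also have "\<dots> = sets punctured_borel"
    using sets.sigma_sets_eq[of punctured_borel] by simp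
  finally show ?thesis .
qed

lemma space_mean_measure: "space (mean_measure Q Y) = punctured"
  using sets_eq_imp_space_eq[OF sets_mean_measure] by simp

text \<open>\<open>measure_of\<close> takes the prescribed values only for a countably additive set
  function. Exchanging sum and expectation requires the evaluations to be measurable, which is what
  the preceding results supply.\<close>

lemma emeasure_mean_measure:
  assumes A: "A \<in> sets punctured_borel"
  shows "emeasure (mean_measure Q Y) A = (\<integral>\<^sup>+\<omega>. emeasure (Y \<omega>) A \<partial>Q)"
proof (rule emeasure_measure_of[OF mean_measure_def])
  show "sets punctured_borel \<subseteq> Pow punctured"
    using sets.space_closed[of punctured_borel] by simp
  show "A \<in> sets (mean_measure Q Y)" using A by (simp add: sets_mean_measure)
  show "positive (sets (mean_measure Q Y)) (\<lambda>A. \<integral>\<^sup>+\<omega>. emeasure (Y \<omega>) A \<partial>Q)"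
    by (simp add: positive_def)
  show "countably_additive (sets (mean_measure Q Y)) (\<lambda>A. \<integral>\<^sup>+\<omega>. emeasure (Y \<omega>) A \<partial>Q)"
    unfolding sets_mean_measure
  proof (rule countably_additiveI)
    fix A :: "nat \<Rightarrow> (real^3) set"
    assume A: "range A \<subseteq> sets punctured_borel" "disjoint_family A"
    have "(\<Sum>i. \<integral>\<^sup>+\<omega>. emeasure (Y \<omega>) (A i) \<partial>Q) = (\<integral>\<^sup>+\<omega>. (\<Sum>i. emeasure (Y \<omega>) (A i)) \<partial>Q)"
      using A by (intro nn_integral_suminf[symmetric] emeasure_random_measurable) auto
    also have "\<dots> = (\<integral>\<^sup>+\<omega>. emeasure (Y \<omega>) (\<Union>i. A i) \<partial>Q)"
      using A by (intro nn_integral_cong suminf_emeasure) (auto simp: random_measure_sets)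
    finally show "(\<Sum>i. \<integral>\<^sup>+\<omega>. emeasure (Y \<omega>) (A i) \<partial>Q) = (\<integral>\<^sup>+\<omega>. emeasure (Y \<omega>) (\<Union>i. A i) \<partial>Q)" .
  qed
qed

text \<open>Measurability and the integral formula are proved together, since the sum and limit
  steps of the induction use measurability of the inner integrals to move sums and suprema through
  the expectation.\<close>

lemma nn_integral_mean_measure_aux:
  fixes g :: "real^3 \<Rightarrow> ennreal"
  assumes "g \<in> borel_measurable punctured_borel"
  shows "(\<lambda>\<omega>. \<integral>\<^sup>+x. g x \<partial>Y \<omega>) \<in> borel_measurable Q
    \<and> (\<integral>\<^sup>+x. g x \<partial>mean_measure Q Y) = (\<integral>\<^sup>+\<omega>. \<integral>\<^sup>+x. g x \<partial>Y \<omega> \<partial>Q)"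
  using assms
proof (induction rule: borel_measurable_induct)
  case (cong f g)
  have sp: "space (Y \<omega>) = punctured" if "\<omega> \<in> space Q" for \<omega>
    using random_measure_tempered[OF that] by (rule tempered_measures_space)
  have "(\<integral>\<^sup>+x. f x \<partial>Y \<omega>) = (\<integral>\<^sup>+x. g x \<partial>Y \<omega>)" if "\<omega> \<in> space Q" for \<omega>
    using cong(3) by (intro nn_integral_cong) (simp add: sp[OF that])
  moreover have "(\<integral>\<^sup>+x. f x \<partial>mean_measure Q Y) = (\<integral>\<^sup>+x. g x \<partial>mean_measure Q Y)"
    using cong(3) by (intro nn_integral_cong) (simp add: space_mean_measure)
  ultimately show ?case using cong(4) by (simp cong: measurable_cong nn_integral_cong)
next
  case (set A)
  have "(\<integral>\<^sup>+x. indicator A x \<partial>Y \<omega>) = emeasure (Y \<omega>) A" if "\<omega> \<in> space Q" for \<omega>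
    using set by (intro nn_integral_indicator) (simp add: random_measure_sets[OF that])
  moreover have "(\<integral>\<^sup>+x. indicator A x \<partial>mean_measure Q Y) = (\<integral>\<^sup>+\<omega>. emeasure (Y \<omega>) A \<partial>Q)"
    using set by (subst nn_integral_indicator) (simp_all add: sets_mean_measure emeasure_mean_measure)
  ultimately show ?case
    using emeasure_random_measurable[OF set] by (simp cong: measurable_cong nn_integral_cong)
next
  case (mult u c)
  then have [measurable]: "(\<lambda>\<omega>. \<integral>\<^sup>+x. u x \<partial>Y \<omega>) \<in> borel_measurable Q" by simp
  have "(\<integral>\<^sup>+x. c * u x \<partial>Y \<omega>) = c * (\<integral>\<^sup>+x. u x \<partial>Y \<omega>)" if "\<omega> \<in> space Q" for \<omega>
    using mult(2) by (intro nn_integral_cmult) (simp cong: measurable_cong_sets add: random_measure_sets[OF that])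
  moreover have "(\<integral>\<^sup>+x. c * u x \<partial>mean_measure Q Y) = c * (\<integral>\<^sup>+x. u x \<partial>mean_measure Q Y)"
    using mult(2) by (intro nn_integral_cmult) (simp cong: measurable_cong_sets add: sets_mean_measure)
  ultimately show ?case using mult(4) by (simp add: nn_integral_cmult cong: measurable_cong nn_integral_cong)
next
  case (add u v)
  then have [measurable]: "(\<lambda>\<omega>. \<integral>\<^sup>+x. u x \<partial>Y \<omega>) \<in> borel_measurable Q"
    "(\<lambda>\<omega>. \<integral>\<^sup>+x. v x \<partial>Y \<omega>) \<in> borel_measurable Q" by simp_all
  have "(\<integral>\<^sup>+x. v x + u x \<partial>Y \<omega>) = (\<integral>\<^sup>+x. v x \<partial>Y \<omega>) + (\<integral>\<^sup>+x. u x \<partial>Y \<omega>)" if "\<omega> \<in> space Q" for \<omega>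
    using add.hyps by (intro nn_integral_add) (simp_all cong: measurable_cong_sets add: random_measure_sets[OF that])
  moreover have "(\<integral>\<^sup>+x. v x + u x \<partial>mean_measure Q Y) = (\<integral>\<^sup>+x. v x \<partial>mean_measure Q Y) + (\<integral>\<^sup>+x. u x \<partial>mean_measure Q Y)"
    using add.hyps by (intro nn_integral_add) (simp_all cong: measurable_cong_sets add: sets_mean_measure)
  ultimately show ?case using add.hyps by (simp add: add.IH nn_integral_add cong: measurable_cong nn_integral_cong)
next
  case (seq U)
  have "(\<integral>\<^sup>+x. (SUP i. U i) x \<partial>Y \<omega>) = (SUP i. \<integral>\<^sup>+x. U i x \<partial>Y \<omega>)" if "\<omega> \<in> space Q" for \<omega>
    unfolding SUP_apply
    using seq.hyps by (intro nn_integral_monotone_convergence_SUP) (simp_all cong: measurable_cong_sets add: random_measure_sets[OF that])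
  moreover have "(\<integral>\<^sup>+x. (SUP i. U i) x \<partial>mean_measure Q Y) = (SUP i. \<integral>\<^sup>+x. U i x \<partial>mean_measure Q Y)"
    unfolding SUP_apply
    using seq.hyps by (intro nn_integral_monotone_convergence_SUP) (simp_all cong: measurable_cong_sets add: sets_mean_measure)
  moreover have "(\<integral>\<^sup>+\<omega>. (SUP i. \<integral>\<^sup>+x. U i x \<partial>Y \<omega>) \<partial>Q) = (SUP i. \<integral>\<^sup>+\<omega>. \<integral>\<^sup>+x. U i x \<partial>Y \<omega> \<partial>Q)"
  proof (rule nn_integral_monotone_convergence_SUP)
    show "incseq (\<lambda>i \<omega>. \<integral>\<^sup>+x. U i x \<partial>Y \<omega>)"
      using \<open>incseq U\<close> by (auto simp: incseq_def le_fun_def intro!: nn_integral_mono)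
  qed (use seq.IH in auto)
  moreover have "(\<lambda>\<omega>. SUP i. \<integral>\<^sup>+x. U i x \<partial>Y \<omega>) \<in> borel_measurable Q"
    using seq.IH by (intro borel_measurable_SUP) auto
  ultimately show ?case using seq.IH by (simp cong: measurable_cong nn_integral_cong)
qed

lemmas nn_integral_mean_measure = nn_integral_mean_measure_aux[THEN conjunct2]

end

section \<open>The first moment formula\<close>

lemma nn_integral_punctured_lborel:
  "(\<integral>\<^sup>+y. f y \<partial>punctured_lborel) = (\<integral>\<^sup>+y. f y * indicator punctured y \<partial>lborel)"
  by (rule nn_integral_restrict_space) simp

lemma nn_integral_punctured_lborel_le:
  assumes "\<And>y. y \<noteq> 0 \<Longrightarrow> f y \<le> g y"
  shows "(\<integral>\<^sup>+y. f y \<partial>punctured_lborel) \<le> (\<integral>\<^sup>+y. g y \<partial>lborel)"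
  unfolding nn_integral_punctured_lborel
  by (rule nn_integral_mono) (use assms in \<open>auto simp: indicator_def\<close>)

lemma sets_punctured_lborel: "sets punctured_lborel = sets punctured_borel"
  by (simp add: sets_restrict_space)

lemma space_punctured_lborel [simp]: "space punctured_lborel = punctured"
  by (simp add: space_restrict_space)

lemma sigma_finite_punctured_lborel: "sigma_finite_measure punctured_lborel"
  by (rule sigma_finite_measure_restrict_space) (auto intro: sigma_finite_lborel)

text \<open>The inclusion of the punctured pair space into the full one. Joint measurability of
  kernels is shown on the full Borel product and pulled back along this map, for any measures with
  the right measurable sets.\<close>

lemma measurable_fst_snd_borel:
  assumes "sets M = sets punctured_borel" "sets N = sets punctured_borel"
  shows "(\<lambda>p. (fst p, snd p)) \<in> measurable (M \<Otimes>\<^sub>M N) (borel \<Otimes>\<^sub>M borel)"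
proof (rule measurable_Pair)
  have "(\<lambda>x. x) \<in> measurable K borel" if "sets K = sets punctured_borel" for K :: "(real^3) measure"
    unfolding measurable_cong_sets[OF that refl] by (rule measurable_restrict_space1) simp
  then show "(\<lambda>p. fst p) \<in> measurable (M \<Otimes>\<^sub>M N) borel" "(\<lambda>p. snd p) \<in> measurable (M \<Otimes>\<^sub>M N) borel"
    using assms by (auto intro: measurable_compose[OF measurable_fst] measurable_compose[OF measurable_snd])
qed

lemma point_kernel_measurable:
  assumes "0 < t" "sets M = sets punctured_borel" "sets N = sets punctured_borel"
  shows "(\<lambda>(x, y). point_kernel a t x y) \<in> borel_measurable (M \<Otimes>\<^sub>M N)"
proof -
  have "(\<lambda>(x, y). point_kernel a t x y) \<in> borel_measurable (borel \<Otimes>\<^sub>M borel)"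
    unfolding point_kernel_eq[OF assms(1)] heat_kernel_def by measurable
  from measurable_compose[OF measurable_fst_snd_borel[OF assms(2,3)] this]
  show ?thesis by (simp add: case_prod_beta)
qed

lemma vartheta_measurable:
  assumes "0 < t" "sets M = sets punctured_borel" "sets N = sets punctured_borel"
  shows "(\<lambda>(x, y). vartheta a t x y) \<in> borel_measurable (M \<Otimes>\<^sub>M N)"
proof -
  have "(\<lambda>(x, y). vartheta a t x y) \<in> borel_measurable (borel \<Otimes>\<^sub>M borel)"
    unfolding vartheta_eq[OF assms(1)] by measurable
  from measurable_compose[OF measurable_fst_snd_borel[OF assms(2,3)] this]
  show ?thesis by (simp add: case_prod_beta)
qed

lemma point_kernel_measurable_snd:
  assumes "0 < t"
  shows "point_kernel a t x \<in> borel_measurable punctured_borel"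
  unfolding point_kernel_eq[OF assms] heat_kernel_def
  by (rule measurable_restrict_space1) measurable

text \<open>The semigroup with values in [0, infinity]: Tonelli and monotone comparison apply
  without integrability, and divergence is not hidden by a default value.\<close>

definition kernel_integral :: "real \<Rightarrow> real \<Rightarrow> (real^3 \<Rightarrow> real) \<Rightarrow> real^3 \<Rightarrow> ennreal" where
  "kernel_integral a t f x = (\<integral>\<^sup>+y. ennreal (f y * point_kernel a t x y) \<partial>punctured_lborel)"

lemma Ccom_plus_bounds:
  assumes f: "f \<in> Ccom_plus"
  obtains d R M where "0 < d" "0 < R" "0 < M" "\<And>x. x \<noteq> 0 \<Longrightarrow> f x \<le> M"
    "\<And>x. x \<noteq> 0 \<Longrightarrow> f x \<noteq> 0 \<Longrightarrow> d \<le> norm x \<and> norm x \<le> R"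
proof -
  obtain K where K: "compact K" "K \<subseteq> punctured" "\<And>x. x \<in> punctured - K \<Longrightarrow> f x = 0"
    and c: "continuous_on punctured f" using f by (auto simp: Ccom_plus_def)
  have "bounded (f ` K)"
    by (intro compact_imp_bounded compact_continuous_image continuous_on_subset[OF c] K)
  then obtain M where M: "0 < M" "\<And>x. x \<in> K \<Longrightarrow> norm (f x) \<le> M"
    unfolding bounded_pos by auto
  obtain R where R: "0 < R" "\<And>x. x \<in> K \<Longrightarrow> norm x \<le> R"
    using compact_imp_bounded[OF K(1)] unfolding bounded_pos by auto
  \<comment> \<open>The complement of the compact set is open and contains the origin, so the
    support keeps a positive distance from it.\<close>
  obtain d where d: "0 < d" "ball 0 d \<subseteq> - K"
    using K(1,2) open_contains_ball[of "- K"] compact_imp_closed by (metis ComplD ComplI open_Compl singletonI subsetD)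
  show ?thesis
  proof (rule that[OF d(1) R(1) M(1)])
    fix x :: "real^3" assume x: "x \<noteq> 0"
    show "f x \<le> M" using K(3)[of x] M x by (cases "x \<in> K") force+
    assume "f x \<noteq> 0"
    then have "x \<in> K" using K(3)[of x] x by auto
    then show "d \<le> norm x \<and> norm x \<le> R" using R(2)[of x] d(2) by (auto simp: not_less[symmetric] subset_eq)
  qed
qed

lemma Ccom_plus_le_weight:
  assumes f: "f \<in> Ccom_plus"
  obtains C where "0 < C" "\<And>x. x \<noteq> 0 \<Longrightarrow> f x \<le> C * weight x"
proof -
  obtain d R M where *: "0 < d" "0 < R" "0 < M" "\<And>x. x \<noteq> 0 \<Longrightarrow> f x \<le> M"
    "\<And>x. x \<noteq> 0 \<Longrightarrow> f x \<noteq> 0 \<Longrightarrow> d \<le> norm x \<and> norm x \<le> R"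
    using Ccom_plus_bounds[OF f] by metis
  have "f x \<le> (M * R) * weight x" if x: "x \<noteq> 0" for x
  proof (cases "f x = 0")
    case True then show ?thesis using * by (simp add: weight_def)
  next
    case False
    then have "1 \<le> R / norm x" using *(5)[OF x] x by simp
    then have "M * 1 \<le> M * (R / norm x)" using * by (intro mult_left_mono) auto
    then show ?thesis using *(4)[OF x] by (simp add: weight_def)
  qed
  with * show ?thesis by (intro that[of "M * R"]) auto
qed

lemma Ccom_plus_nonneg: "f \<in> Ccom_plus \<Longrightarrow> x \<noteq> 0 \<Longrightarrow> 0 \<le> f x"
  by (simp add: Ccom_plus_def)

lemma Ccom_plus_mult: "f \<in> Ccom_plus \<Longrightarrow> 0 \<le> c \<Longrightarrow> (\<lambda>x. c * f x) \<in> Ccom_plus"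
  unfolding Ccom_plus_def by (auto intro!: continuous_on_mult continuous_on_const)

lemma Ccom_plus_scale:
  assumes f: "f \<in> Ccom_plus" and c: "0 < c"
  shows "(\<lambda>x. f (x /\<^sub>R c)) \<in> Ccom_plus"
proof -
  obtain K where K: "compact K" "K \<subseteq> punctured" "\<And>x. x \<in> punctured - K \<Longrightarrow> f x = 0"
    and cont: "continuous_on punctured f" and nn: "\<And>x. x \<in> punctured \<Longrightarrow> 0 \<le> f x"
    using f by (auto simp: Ccom_plus_def)
  have "compact ((*\<^sub>R) c ` K)" "(*\<^sub>R) c ` K \<subseteq> punctured"
    using K c by (auto intro!: compact_scaling)
  moreover have "f (x /\<^sub>R c) = 0" if "x \<in> punctured - (*\<^sub>R) c ` K" for x
  proof (rule K(3))
    have "x = c *\<^sub>R (x /\<^sub>R c)" using c by simp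
    then show "x /\<^sub>R c \<in> punctured - K" using that c by (auto simp del: scaleR_scaleR)
  qed
  moreover have "continuous_on punctured (\<lambda>x. f (x /\<^sub>R c))"
    by (rule continuous_on_compose2[OF cont]) (use c in \<open>auto intro!: continuous_intros\<close>)
  ultimately show ?thesis using nn c unfolding Ccom_plus_def by (auto intro!: exI[of _ "(*\<^sub>R) c ` K"])
qed

lemma Ccom_plus_test_functions:
  assumes f: "f \<in> Ccom_plus" and \<rho>: "0 < \<rho>"
  shows "f \<in> test_functions \<rho>"
proof -
  obtain d R M where *: "0 < d" "0 < R" "0 < M" "\<And>x. x \<noteq> 0 \<Longrightarrow> f x \<le> M"
    "\<And>x. x \<noteq> 0 \<Longrightarrow> f x \<noteq> 0 \<Longrightarrow> d \<le> norm x \<and> norm x \<le> R"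
    using Ccom_plus_bounds[OF f] by metis
  have "(\<integral>\<^sup>+x. ennreal (weight x * \<bar>f x\<bar> powr \<rho>) \<partial>punctured_lborel)
      \<le> (\<integral>\<^sup>+(x::real^3). ennreal (1 / d * M powr \<rho>) * indicator (cball 0 R) x \<partial>lborel)"
  proof (rule nn_integral_punctured_lborel_le)
    fix x :: "real^3" assume x: "x \<noteq> 0"
    show "ennreal (weight x * \<bar>f x\<bar> powr \<rho>) \<le> ennreal (1 / d * M powr \<rho>) * indicator (cball 0 R) x"
    proof (cases "f x = 0")
      case False
      then have n: "d \<le> norm x" "norm x \<le> R" using *(5)[OF x] by auto
      have "weight x \<le> 1 / d" unfolding weight_def using n * x by (intro divide_left_mono) auto
      moreover have "\<bar>f x\<bar> powr \<rho> \<le> M powr \<rho>"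
        using *(4)[OF x] Ccom_plus_nonneg[OF f x] \<rho> by (intro powr_mono2) auto
      ultimately have "weight x * \<bar>f x\<bar> powr \<rho> \<le> 1 / d * M powr \<rho>"
        using * by (intro mult_mono) auto
      then show ?thesis using n by (simp add: ennreal_leI)
    qed simp
  qed
  also have "\<dots> = ennreal (1 / d * M powr \<rho>) * emeasure lborel (cball 0 R :: (real^3) set)"
    by (rule nn_integral_cmult_indicator) simp
  also have "\<dots> < \<infinity>"
    using emeasure_lborel_cball_finite[of "0::real^3" R] by (simp add: ennreal_mult_less_top)
  finally have "f \<in> weighted_Lp \<rho>"
    using Ccom_plus_measurable[OF f] by (simp add: weighted_Lp_def)
  moreover obtain C where "0 < C" "\<And>x. x \<noteq> 0 \<Longrightarrow> f x \<le> C * weight x"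
    using Ccom_plus_le_weight[OF f] by metis
  ultimately show ?thesis using f by (auto simp: test_functions_def Ccom_plus_def)
qed

text \<open>The case g = 0 of the kernel bound, where no power of s remains: order 1/|x| is
  preserved uniformly on (0, T].\<close>

lemma kernel_integral_weight_le:
  assumes T: "0 < T"
  obtains C where "0 < C" "\<And>s x. 0 < s \<Longrightarrow> s \<le> T \<Longrightarrow> x \<noteq> 0 \<Longrightarrow>
    kernel_integral a s weight x \<le> ennreal (C * weight x)"
proof -
  obtain C where C: "0 \<le> C" "\<And>s x. 0 < s \<Longrightarrow> s \<le> T \<Longrightarrow> x \<noteq> 0 \<Longrightarrow>
    (\<integral>\<^sup>+y. ennreal (point_kernel a s x y * norm y powr (- 1 - 0)) \<partial>lborel)
      \<le> ennreal (C * s powr (- 0 / 2) / norm x)"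
    using nn_integral_point_kernel_powr_le[of 0 T a] T by auto
  \<comment> \<open>Adding 1 only serves to make the constant strictly positive.\<close>
  have "kernel_integral a s weight x \<le> ennreal ((C + 1) * weight x)" if "0 < s" "s \<le> T" "x \<noteq> 0" for s x
  proof -
    have "kernel_integral a s weight x \<le> (\<integral>\<^sup>+y. ennreal (point_kernel a s x y * norm y powr (- 1 - 0)) \<partial>lborel)"
      unfolding kernel_integral_def
      by (rule nn_integral_punctured_lborel_le) (simp add: weight_def powr_minus divide_inverse mult.commute)
    also have "\<dots> \<le> ennreal (C * s powr (- 0 / 2) / norm x)" by (rule C(2)[OF that])
    also have "\<dots> \<le> ennreal ((C + 1) * weight x)"
      using that by (intro ennreal_leI) (simp add: weight_def divide_right_mono)
    finally show ?thesis .
  qed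
  with C(1) show ?thesis by (intro that[of "C + 1"]) auto
qed

lemma kernel_integral_mono:
  assumes "0 < t" "\<And>y. y \<noteq> 0 \<Longrightarrow> f y \<le> C * g y" "0 \<le> C" and "g \<in> borel_measurable punctured_borel"
  shows "kernel_integral a t f x \<le> ennreal C * kernel_integral a t g x"
proof -
  have "kernel_integral a t f x \<le> (\<integral>\<^sup>+y. ennreal C * ennreal (g y * point_kernel a t x y) \<partial>punctured_lborel)"
    unfolding kernel_integral_def
  proof (rule nn_integral_mono)
    fix y assume "y \<in> space punctured_lborel"
    then have "f y * point_kernel a t x y \<le> C * g y * point_kernel a t x y"
      using assms(2)[of y] by (intro mult_right_mono point_kernel_nonneg assms) auto
    then show "ennreal (f y * point_kernel a t x y) \<le> ennreal C * ennreal (g y * point_kernel a t x y)"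
      using assms by (simp add: ennreal_mult'[symmetric] ennreal_leI mult.assoc)
  qed
  also have "\<dots> = ennreal C * kernel_integral a t g x"
    unfolding kernel_integral_def
  proof (rule nn_integral_cmult)
    have [measurable]: "point_kernel a t x \<in> borel_measurable punctured_borel" "g \<in> borel_measurable punctured_borel"
      by (fact point_kernel_measurable_snd[OF assms(1)] assms)+
    have "(\<lambda>y. ennreal (g y * point_kernel a t x y)) \<in> borel_measurable punctured_borel" by measurable
    then show "(\<lambda>y. ennreal (g y * point_kernel a t x y)) \<in> borel_measurable punctured_lborel"
      unfolding measurable_cong_sets[OF sets_punctured_lborel refl] .
  qed
  finally show ?thesis .
qed

lemma weight_measurable [measurable]: "weight \<in> borel_measurable borel"
  unfolding weight_def by measurable

lemma weight_measurable': "weight \<in> borel_measurable punctured_borel"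
  by (rule measurable_restrict_space1) measurable

text \<open>Finiteness excludes the case in which the Bochner integral would be 0 while the true
  integral is infinite.\<close>

lemma point_semigroup_eq:
  assumes "0 < t" and f: "f \<in> Ccom_plus" and fin: "kernel_integral a t f x < \<infinity>"
  shows "ennreal (point_semigroup a t f x) = kernel_integral a t f x" "0 \<le> point_semigroup a t f x"
proof -
  have [measurable]: "point_kernel a t x \<in> borel_measurable punctured_borel" "f \<in> borel_measurable punctured_borel"
    using point_kernel_measurable_snd[OF assms(1)] Ccom_plus_measurable[OF f] by auto
  have "(\<lambda>y. f y * point_kernel a t x y) \<in> borel_measurable punctured_borel" by measurable
  then have "(\<lambda>y. f y * point_kernel a t x y) \<in> borel_measurable punctured_lborel"
    unfolding measurable_cong_sets[OF sets_punctured_lborel refl] .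
  then have "point_semigroup a t f x = enn2real (kernel_integral a t f x)"
    unfolding point_semigroup_def kernel_integral_def
    by (rule integral_eq_nn_integral)
       (use Ccom_plus_nonneg[OF f] point_kernel_nonneg[OF assms(1)] in \<open>auto intro!: AE_I2\<close>)
  then show "ennreal (point_semigroup a t f x) = kernel_integral a t f x" "0 \<le> point_semigroup a t f x"
    using fin by auto
qed

lemma point_semigroup_mult: "point_semigroup a t (\<lambda>y. c * f y) x = c * point_semigroup a t f x"
  unfolding point_semigroup_def by (simp add: mult.assoc)

section \<open>Two-sided bounds for log-Laplace solutions\<close>

lemma nn_integral_powr_reflect_finite:
  assumes b: "0 \<le> b" "b < 1" and t: "0 < t"
  shows "(\<integral>\<^sup>+s. ennreal ((t - s) powr (- b)) \<partial>restrict_space lborel {0<..<t}) < \<infinity>"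
proof -
  have "(\<integral>\<^sup>+s. ennreal ((t - s) powr (- b)) \<partial>restrict_space lborel {0<..<t})
    = (\<integral>\<^sup>+s. ennreal ((t - s) powr (- b)) * indicator {0<..<t} s \<partial>lborel)"
    by (rule nn_integral_restrict_space) simp
  also have "\<dots> = (\<integral>\<^sup>+s. ennreal (s powr (- b)) * indicator {0<..<t} (t - s) \<partial>lborel)"
    by (subst nn_integral_real_affine[of _ "- 1" t]) auto
  also have "\<dots> \<le> (\<integral>\<^sup>+s. ennreal (s powr (- b)) * indicator {0..t} s \<partial>lborel)"
    by (rule nn_integral_mono) (auto simp: indicator_def)
  also have "\<dots> = ennreal (t powr (- b + 1) / (- b + 1))"
    by (rule nn_integral_has_integral_lebesgue'[OF _ has_integral_powr_from_0]) (use assms in auto)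
  finally show ?thesis by (simp add: less_top[symmetric] top_unique) (metis ennreal_less_top order_le_less_trans less_top)
qed

text \<open>The nonlinear term is subtracted, and it is nonnegative because the kernel is.\<close>

lemma log_laplace_solution_le:
  assumes v: "log_laplace_solution \<rho> \<eta> \<beta> a \<phi> v" and "0 \<le> \<eta>" "0 < t" "x \<noteq> 0"
  shows "v t x \<le> point_semigroup a t \<phi> x" "0 \<le> v t x"
proof -
  have "0 \<le> (LBINT s:{0<..<t}. LINT y|punctured_lborel. point_kernel a (t - s) x y * v s y powr (1 + \<beta>))"
    unfolding set_lebesgue_integral_def
  proof (rule integral_nonneg_AE, rule AE_I2)
    fix s
    show "0 \<le> indicat_real {0<..<t} s *\<^sub>R (LINT y|punctured_lborel. point_kernel a (t - s) x y * v s y powr (1 + \<beta>))"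
      by (cases "s \<in> {0<..<t}") (auto intro!: integral_nonneg_AE AE_I2 mult_nonneg_nonneg point_kernel_nonneg)
  qed
  moreover have "v t x = point_semigroup a t \<phi> x
          - \<eta> * (LBINT s:{0<..<t}. LINT y|punctured_lborel.
                    point_kernel a (t - s) x y * v s y powr (1 + \<beta>))"
    using v assms by (simp add: log_laplace_solution_def)
  ultimately show "v t x \<le> point_semigroup a t \<phi> x" using \<open>0 \<le> \<eta>\<close> by simp
  show "0 \<le> v t x" using v assms by (auto simp: log_laplace_solution_def test_functions_def)
qed

text \<open>Bootstrap: the linear upper bound v <= theta C / |y| is inserted into the nonlinear
  term. This extracts theta^(1+beta), leaves the kernel integral of |y|^(-1-beta), of order (t -
  s)^(-beta/2) / |x|, and that is integrable in s. The constant is the same for all theta, v and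
  x.\<close>

lemma log_laplace_solution_ge:
  assumes "0 \<le> \<eta>" and \<beta>: "0 < \<beta>" "\<beta> < 1" and t: "0 < t" and f: "f \<in> Ccom_plus"
  obtains K where "0 \<le> K" "\<And>\<theta> v x. 0 < \<theta> \<Longrightarrow> x \<noteq> 0 \<Longrightarrow> log_laplace_solution \<rho> \<eta> \<beta> a (\<lambda>y. \<theta> * f y) v \<Longrightarrow>
    \<theta> * point_semigroup a t f x - \<theta> powr (1 + \<beta>) * K * weight x \<le> v t x"
proof -
  obtain C0 where C0: "0 < C0" "\<And>x. x \<noteq> 0 \<Longrightarrow> f x \<le> C0 * weight x"
    using Ccom_plus_le_weight[OF f] by metis
  obtain C1 where C1: "0 < C1" "\<And>s x. 0 < s \<Longrightarrow> s \<le> t \<Longrightarrow> x \<noteq> 0 \<Longrightarrow>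
    kernel_integral a s weight x \<le> ennreal (C1 * weight x)"
    using kernel_integral_weight_le[OF t] by metis
  obtain C2 where C2: "0 \<le> C2" "\<And>s x. 0 < s \<Longrightarrow> s \<le> t \<Longrightarrow> x \<noteq> 0 \<Longrightarrow>
    (\<integral>\<^sup>+y. ennreal (point_kernel a s x y * norm y powr (- 1 - \<beta>)) \<partial>lborel)
      \<le> ennreal (C2 * s powr (- \<beta> / 2) / norm x)"
    using nn_integral_point_kernel_powr_le[of \<beta> t a] \<beta> t by auto
  obtain J where J: "0 \<le> J" "(\<integral>\<^sup>+s. ennreal ((t - s) powr (- \<beta> / 2)) \<partial>restrict_space lborel {0<..<t}) = ennreal J"
    using nn_integral_powr_reflect_finite[of "\<beta> / 2" t] \<beta> t by (auto simp: less_top_ennreal)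
  define C where "C = C0 * C1"
  have C: "0 < C" using C0 C1 by (simp add: C_def)
  have S: "point_semigroup a s f y \<le> C * weight y" if "0 < s" "s \<le> t" "y \<noteq> 0" for s y
  proof -
    have "kernel_integral a s f y \<le> ennreal C0 * kernel_integral a s weight y"
      using that C0 by (intro kernel_integral_mono weight_measurable') auto
    also have "\<dots> \<le> ennreal C0 * ennreal (C1 * weight y)"
      by (intro mult_left_mono C1 that) auto
    also have "\<dots> = ennreal (C * weight y)"
      using C0 C1 by (simp add: C_def ennreal_mult'[symmetric] mult.assoc)
    finally have le: "kernel_integral a s f y \<le> ennreal (C * weight y)" .
    then have "kernel_integral a s f y < \<infinity>" by (rule order.strict_trans1) simp
    from point_semigroup_eq(1)[OF that(1) f this] le
    have "ennreal (point_semigroup a s f y) \<le> ennreal (C * weight y)" by simp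
    then show ?thesis using C by (simp add: weight_def)
  qed
  define K where "K = \<eta> * (C powr (1 + \<beta>) * C2 * J)"
  have "\<theta> * point_semigroup a t f x - \<theta> powr (1 + \<beta>) * K * weight x \<le> v t x"
    if \<theta>: "0 < \<theta>" and x: "x \<noteq> 0" and v: "log_laplace_solution \<rho> \<eta> \<beta> a (\<lambda>y. \<theta> * f y) v" for \<theta> v x
  proof -
    let ?L = "restrict_space lborel {0<..<t}"
    let ?h = "\<lambda>s y. point_kernel a (t - s) x y * v s y powr (1 + \<beta>)"
    interpret P: pair_sigma_finite ?L punctured_lborel
      by (intro pair_sigma_finite.intro sigma_finite_measure_restrict_space sigma_finite_punctured_lborel sigma_finite_lborel) simp
    have int: "integrable (?L \<Otimes>\<^sub>M punctured_lborel) (\<lambda>(s, y). ?h s y)"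
      and eq: "v t x = point_semigroup a t (\<lambda>y. \<theta> * f y) x
          - \<eta> * (LBINT s:{0<..<t}. LINT y|punctured_lborel. ?h s y)"
      using v t x by (auto simp: log_laplace_solution_def)
    have vle: "v s y \<le> \<theta> * C * weight y" "0 \<le> v s y" if "0 < s" "s < t" "y \<noteq> 0" for s y
    proof -
      have "v s y \<le> \<theta> * point_semigroup a s f y"
        using log_laplace_solution_le(1)[OF v \<open>0 \<le> \<eta>\<close> that(1,3)] by (simp only: point_semigroup_mult)
      also have "\<dots> \<le> \<theta> * (C * weight y)" using that \<theta> by (intro mult_left_mono S) auto
      finally show "v s y \<le> \<theta> * C * weight y" by simp
      show "0 \<le> v s y" by (rule log_laplace_solution_le(2)[OF v \<open>0 \<le> \<eta>\<close> that(1,3)])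
    qed
    \<comment> \<open>Integrability on the product, part of the notion of a solution, turns the
      iterated Bochner integrals into one product integral and then into a nonnegative integral that
      can be bounded from above.\<close>
    have "(LBINT s:{0<..<t}. LINT y|punctured_lborel. ?h s y) = (\<integral>s. \<integral>y. ?h s y \<partial>punctured_lborel \<partial>?L)"
      unfolding set_lebesgue_integral_def by (rule integral_restrict_space[symmetric]) simp
    also have "\<dots> = (\<integral>p. (case p of (s, y) \<Rightarrow> ?h s y) \<partial>(?L \<Otimes>\<^sub>M punctured_lborel))"
      by (rule P.integral_fst[OF int])
    finally have "(LBINT s:{0<..<t}. LINT y|punctured_lborel. ?h s y)
        = (\<integral>p. (case p of (s, y) \<Rightarrow> ?h s y) \<partial>(?L \<Otimes>\<^sub>M punctured_lborel))" .
    also have "ennreal \<dots> = (\<integral>\<^sup>+p. ennreal (case p of (s, y) \<Rightarrow> ?h s y) \<partial>(?L \<Otimes>\<^sub>M punctured_lborel))"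
    proof (rule nn_integral_eq_integral[symmetric, OF int], rule AE_I2)
      fix p assume "p \<in> space (?L \<Otimes>\<^sub>M punctured_lborel)"
      then show "0 \<le> (case p of (s, y) \<Rightarrow> ?h s y)"
        by (auto simp: space_pair_measure space_restrict_space intro!: mult_nonneg_nonneg point_kernel_nonneg)
    qed
    also have "\<dots> = (\<integral>\<^sup>+s. \<integral>\<^sup>+y. ennreal (?h s y) \<partial>punctured_lborel \<partial>?L)"
    proof -
      have m: "(\<lambda>p. ennreal (case p of (s, y) \<Rightarrow> ?h s y)) \<in> borel_measurable (?L \<Otimes>\<^sub>M punctured_lborel)"
        using borel_measurable_integrable[OF int] by (rule measurable_compose) simp
      show ?thesis
        by (subst P.M2.nn_integral_fst[OF m, symmetric]) simp
    qed
    also have "\<dots> \<le> (\<integral>\<^sup>+s. ennreal ((\<theta> * C) powr (1 + \<beta>) * C2 / norm x) * ennreal ((t - s) powr (- \<beta> / 2)) \<partial>?L)"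
    proof (rule nn_integral_mono)
      fix s assume "s \<in> space ?L"
      then have s: "0 < s" "s < t" by (auto simp: space_restrict_space)
      have "(\<integral>\<^sup>+y. ennreal (?h s y) \<partial>punctured_lborel)
        \<le> (\<integral>\<^sup>+y. ennreal ((\<theta> * C) powr (1 + \<beta>)) * ennreal (point_kernel a (t - s) x y * norm y powr (- 1 - \<beta>)) \<partial>lborel)"
      proof (rule nn_integral_punctured_lborel_le)
        fix y :: "real^3" assume y: "y \<noteq> 0"
        have "v s y powr (1 + \<beta>) \<le> (\<theta> * C * weight y) powr (1 + \<beta>)"
          using vle[OF s y] \<beta> by (intro powr_mono2) auto
        also have "\<dots> = (\<theta> * C) powr (1 + \<beta>) * weight y powr (1 + \<beta>)"
          by (rule powr_mult)
        also have "weight y powr (1 + \<beta>) = norm y powr (- 1 - \<beta>)"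
          using y powr_minus[of "norm y" "1 + \<beta>"] by (simp add: weight_def powr_divide inverse_eq_divide)
        finally have "point_kernel a (t - s) x y * v s y powr (1 + \<beta>)
            \<le> point_kernel a (t - s) x y * ((\<theta> * C) powr (1 + \<beta>) * norm y powr (- 1 - \<beta>))"
          using s by (intro mult_left_mono point_kernel_nonneg) auto
        then have "ennreal (?h s y) \<le> ennreal ((\<theta> * C) powr (1 + \<beta>) * (point_kernel a (t - s) x y * norm y powr (- 1 - \<beta>)))"
          by (intro ennreal_leI) (simp only: mult.left_commute)
        then show "ennreal (?h s y) \<le> ennreal ((\<theta> * C) powr (1 + \<beta>)) * ennreal (point_kernel a (t - s) x y * norm y powr (- 1 - \<beta>))"
          by (simp add: ennreal_mult')
      qed
      also have "\<dots> = ennreal ((\<theta> * C) powr (1 + \<beta>)) * (\<integral>\<^sup>+y. ennreal (point_kernel a (t - s) x y * norm y powr (- 1 - \<beta>)) \<partial>lborel)"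
      proof (rule nn_integral_cmult)
        show "(\<lambda>y. ennreal (point_kernel a (t - s) x y * norm y powr (- 1 - \<beta>))) \<in> borel_measurable lborel"
          using s by (simp add: point_kernel_eq heat_kernel_def)
      qed
      also have "\<dots> \<le> ennreal ((\<theta> * C) powr (1 + \<beta>)) * ennreal (C2 * (t - s) powr (- \<beta> / 2) / norm x)"
        using s x by (intro mult_left_mono C2) auto
      also have "\<dots> = ennreal ((\<theta> * C) powr (1 + \<beta>) * C2 / norm x) * ennreal ((t - s) powr (- \<beta> / 2))"
        using C2(1) by (simp add: ennreal_mult'[symmetric] mult.assoc)
      finally show "(\<integral>\<^sup>+y. ennreal (?h s y) \<partial>punctured_lborel)
          \<le> ennreal ((\<theta> * C) powr (1 + \<beta>) * C2 / norm x) * ennreal ((t - s) powr (- \<beta> / 2))" .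
    qed
    also have "\<dots> = ennreal ((\<theta> * C) powr (1 + \<beta>) * C2 / norm x) * ennreal J"
    proof -
      have "(\<lambda>s. ennreal ((t - s) powr (- \<beta> / 2))) \<in> borel_measurable ?L"
        by (rule measurable_restrict_space1) measurable
      from nn_integral_cmult[OF this] show ?thesis by (simp only: J(2))
    qed
    also have "\<dots> = ennreal (\<theta> powr (1 + \<beta>) * (C powr (1 + \<beta>) * C2 * J) * weight x)"
      using C2(1) J(1) \<theta> C by (simp add: ennreal_mult'[symmetric] powr_mult weight_def mult.assoc)
    finally have "(LBINT s:{0<..<t}. LINT y|punctured_lborel. ?h s y)
        \<le> \<theta> powr (1 + \<beta>) * (C powr (1 + \<beta>) * C2 * J) * weight x"
      using C2(1) J(1) by (subst (asm) ennreal_le_iff) (auto simp: weight_def)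
    then have "\<eta> * (LBINT s:{0<..<t}. LINT y|punctured_lborel. ?h s y)
        \<le> \<eta> * (\<theta> powr (1 + \<beta>) * (C powr (1 + \<beta>) * C2 * J) * weight x)"
      using \<open>0 \<le> \<eta>\<close> by (rule mult_left_mono)
    also have "\<dots> = \<theta> powr (1 + \<beta>) * K * weight x" unfolding K_def by (simp only: ac_simps)
    finally show ?thesis unfolding eq point_semigroup_mult by simp
  qed
  moreover have "0 \<le> K" using C2(1) J(1) \<open>0 \<le> \<eta>\<close> by (simp add: K_def)
  ultimately show ?thesis using that by blast
qed

section \<open>From Laplace transforms to the mean\<close>

lemma one_minus_exp_tendsto:
  fixes z :: real
  shows "(\<lambda>n. (1 - exp (- (1 / real (Suc n) * z))) / (1 / real (Suc n))) \<longlonglongrightarrow> z"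
\<comment> \<open>For z = 0 the argument of the difference quotient (exp w - 1) / w would be
  identically 0, so this case is separate.\<close>
proof (cases "z = 0")
  case False
  have "(\<lambda>n. 1 / real (Suc n)) \<longlonglongrightarrow> 0"
    by (rule LIMSEQ_Suc[OF lim_1_over_n])
  from tendsto_mult_right[OF this, of "- z"]
  have "(\<lambda>n. - (1 / real (Suc n) * z)) \<longlonglongrightarrow> 0" by simp
  then have "filterlim (\<lambda>n. - (1 / real (Suc n) * z)) (at 0) sequentially"
    using False by (intro filterlim_atI) auto
  from tendsto_mult_right[OF filterlim_compose[OF lim_exp_minus_1 this], of z]
  have "(\<lambda>n. (exp (- (1 / real (Suc n) * z)) - 1) / - (1 / real (Suc n) * z) * z) \<longlonglongrightarrow> z" by simp
  also have "(\<lambda>n. (exp (- (1 / real (Suc n) * z)) - 1) / - (1 / real (Suc n) * z) * z)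
     = (\<lambda>n. (1 - exp (- (1 / real (Suc n) * z))) / (1 / real (Suc n)))"
  proof
    fix n
    have eq: "(e - 1) / - (c * z) * z = (1 - e) / c" if "c \<noteq> 0" for e c :: real
      using that False by (simp add: divide_simps)
    show "(exp (- (1 / real (Suc n) * z)) - 1) / - (1 / real (Suc n) * z) * z
       = (1 - exp (- (1 / real (Suc n) * z))) / (1 / real (Suc n))"
      by (rule eq) simp
  qed
  finally show ?thesis .
qed simp

text \<open>The lower bound on \<open>- ln L\<close> is compared with the mean through Jensen's inequality, the upper bound
  through Fatou's lemma.\<close>

lemma (in prob_space) expectation_from_laplace:
  fixes Z :: "'a \<Rightarrow> real"
  assumes Z [measurable]: "Z \<in> borel_measurable M" and Z0: "\<And>\<omega>. \<omega> \<in> space M \<Longrightarrow> 0 \<le> Z \<omega>"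
    and m: "0 \<le> m" and b: "0 < b"
    and upper: "\<And>\<theta>. 0 < \<theta> \<Longrightarrow> - ln (\<integral>\<omega>. exp (- (\<theta> * Z \<omega>)) \<partial>M) \<le> \<theta> * m"
    and lower: "\<And>\<theta>. 0 < \<theta> \<Longrightarrow> \<theta> * m - \<theta> powr (1 + b) * K \<le> - ln (\<integral>\<omega>. exp (- (\<theta> * Z \<omega>)) \<partial>M)"
  shows "(\<integral>\<^sup>+\<omega>. ennreal (Z \<omega>) \<partial>M) = ennreal m"
proof -
  define L where "L \<theta> = (\<integral>\<omega>. exp (- (\<theta> * Z \<omega>)) \<partial>M)" for \<theta>
  have int: "integrable M (\<lambda>\<omega>. exp (- (\<theta> * Z \<omega>)))" if "0 < \<theta>" for \<theta>
    by (rule integrable_const_bound[where B = 1]) (use Z0 that in \<open>auto intro!: AE_I2\<close>)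
  have L0: "0 < L \<theta>" if "0 < \<theta>" for \<theta>
  proof -
    have "0 \<le> L \<theta>" unfolding L_def by (intro integral_nonneg_AE) simp
    moreover have "L \<theta> \<noteq> 0"
    proof
      assume "L \<theta> = 0"
      then have "AE \<omega> in M. exp (- (\<theta> * Z \<omega>)) = 0"
        unfolding L_def by (subst (asm) integral_nonneg_eq_0_iff_AE[OF int[OF that]]) auto
      then show False by simp
    qed
    ultimately show ?thesis by simp
  qed
  have le: "(\<integral>\<^sup>+\<omega>. ennreal ((1 - exp (- (\<theta> * Z \<omega>))) / \<theta>) \<partial>M) \<le> ennreal m" if \<theta>: "0 < \<theta>" for \<theta>
  proof -
    have i: "integrable M (\<lambda>\<omega>. (1 - exp (- (\<theta> * Z \<omega>))) / \<theta>)"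
      using int[OF \<theta>] by simp
    have "(\<integral>\<^sup>+\<omega>. ennreal ((1 - exp (- (\<theta> * Z \<omega>))) / \<theta>) \<partial>M) = ennreal (\<integral>\<omega>. (1 - exp (- (\<theta> * Z \<omega>))) / \<theta> \<partial>M)"
      by (rule nn_integral_eq_integral[OF i]) (use Z0 \<theta> in \<open>auto intro!: AE_I2\<close>)
    also have "(\<integral>\<omega>. (1 - exp (- (\<theta> * Z \<omega>))) / \<theta> \<partial>M) = (1 - L \<theta>) / \<theta>"
      using int[OF \<theta>] by (simp add: L_def prob_space)
    \<comment> \<open>From ln L <= L - 1 follows 1 - L <= - ln L, to which the assumed upper bound
      applies.\<close>
    also have "\<dots> \<le> \<theta> * m / \<theta>"
    proof (rule divide_right_mono)
      show "1 - L \<theta> \<le> \<theta> * m"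
        using ln_le_minus_one[OF L0[OF \<theta>]] upper[OF \<theta>] by (simp add: L_def)
    qed (use \<theta> in simp)
    also have "\<theta> * m / \<theta> = m" using \<theta> by simp
    finally show ?thesis by (simp add: ennreal_leI)
  qed
  let ?g = "\<lambda>n \<omega>. ennreal ((1 - exp (- (1 / real (Suc n) * Z \<omega>))) / (1 / real (Suc n)))"
  have "(\<integral>\<^sup>+\<omega>. ennreal (Z \<omega>) \<partial>M) = (\<integral>\<^sup>+\<omega>. liminf (\<lambda>n. ?g n \<omega>) \<partial>M)"
  proof (rule nn_integral_cong)
    fix \<omega>
    have "(\<lambda>n. ?g n \<omega>) \<longlonglongrightarrow> ennreal (Z \<omega>)"
      by (intro tendsto_ennrealI one_minus_exp_tendsto)
    then show "ennreal (Z \<omega>) = liminf (\<lambda>n. ?g n \<omega>)"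
      by (rule lim_imp_Liminf[OF sequentially_bot, symmetric])
  qed
  also have "\<dots> \<le> liminf (\<lambda>n. \<integral>\<^sup>+\<omega>. ?g n \<omega> \<partial>M)"
    by (rule nn_integral_liminf) measurable
  also have "\<dots> \<le> liminf (\<lambda>n::nat. ennreal m)"
    by (rule Liminf_mono, rule always_eventually, rule allI, rule le) simp
  also have "\<dots> = ennreal m" by (simp add: Liminf_const)
  finally have 1: "(\<integral>\<^sup>+\<omega>. ennreal (Z \<omega>) \<partial>M) \<le> ennreal m" .
  have iZ: "integrable M Z"
    using 1 Z0 by (intro integrableI_nonneg) (auto intro!: AE_I2 simp: less_top[symmetric] top_unique)
  define e where "e = (\<integral>\<omega>. Z \<omega> \<partial>M)"
  have e: "(\<integral>\<^sup>+\<omega>. ennreal (Z \<omega>) \<partial>M) = ennreal e"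
    unfolding e_def by (rule nn_integral_eq_integral[OF iZ]) (use Z0 in \<open>auto intro!: AE_I2\<close>)
  have "m \<le> e + \<theta> powr b * K" if \<theta>: "0 < \<theta>" for \<theta>
  proof -
    \<comment> \<open>The tangent of the exponential at -theta e, integrated: the linear part has
      mean 0, so exp (-theta e) <= L. Together with the lower bound on - ln L, division by theta
      leaves an error theta^b K that vanishes with theta.\<close>
    have "exp (- (\<theta> * e)) = (\<integral>\<omega>. exp (- (\<theta> * e)) * (1 - \<theta> * (Z \<omega> - e)) \<partial>M)"
      using iZ by (simp add: e_def[symmetric] prob_space)
    also have "\<dots> \<le> L \<theta>"
      unfolding L_def
    proof (rule integral_mono)
      show "integrable M (\<lambda>\<omega>. exp (- (\<theta> * e)) * (1 - \<theta> * (Z \<omega> - e)))" using iZ by simp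
      fix \<omega>
      have "exp (- (\<theta> * e)) * (1 + - (\<theta> * (Z \<omega> - e))) \<le> exp (- (\<theta> * e)) * exp (- (\<theta> * (Z \<omega> - e)))"
        by (intro mult_left_mono exp_ge_add_one_self) simp
      also have "\<dots> = exp (- (\<theta> * Z \<omega>))" by (simp add: exp_add[symmetric] algebra_simps)
      finally show "exp (- (\<theta> * e)) * (1 - \<theta> * (Z \<omega> - e)) \<le> exp (- (\<theta> * Z \<omega>))" by simp
    qed (rule int[OF \<theta>])
    finally have "- (\<theta> * e) \<le> ln (L \<theta>)" using L0[OF \<theta>] by (simp add: ln_ge_iff)
    then have "\<theta> * m - \<theta> powr (1 + b) * K \<le> \<theta> * e" using lower[OF \<theta>] by (simp add: L_def)
    also have "\<theta> powr (1 + b) = \<theta> * \<theta> powr b" using \<theta> by (simp add: powr_add)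
    finally have "\<theta> * m \<le> \<theta> * (e + \<theta> powr b * K)" by (simp add: algebra_simps)
    then show ?thesis using \<theta> by (simp only: mult_le_cancel_left_pos)
  qed
  then have ev: "m \<le> e + (1 / real (Suc n)) powr b * K" for n by simp
  have "(\<lambda>n. (1 / real (Suc n)) powr b) \<longlonglongrightarrow> 0"
    by (rule tendsto_zero_powrI[OF LIMSEQ_Suc[OF lim_1_over_n] tendsto_const]) (use b in auto)
  from tendsto_add[OF tendsto_const tendsto_mult_left[OF this, of K], of e]
  have "(\<lambda>n. e + (1 / real (Suc n)) powr b * K) \<longlonglongrightarrow> e" by (simp add: mult.commute)
  then have "m \<le> e"
    by (rule LIMSEQ_le_const) (use ev in blast)
  with 1 m show ?thesis unfolding e by (simp add: antisym)
qed

lemma kernel_integral_measurable: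
  assumes "0 < t" "f \<in> borel_measurable punctured_borel" "sets \<mu> = sets punctured_borel"
  shows "kernel_integral a t f \<in> borel_measurable \<mu>"
proof -
  interpret sigma_finite_measure punctured_lborel by (rule sigma_finite_punctured_lborel)
  have [measurable]: "(\<lambda>(x, y). point_kernel a t x y) \<in> borel_measurable (\<mu> \<Otimes>\<^sub>M punctured_lborel)"
    by (rule point_kernel_measurable[OF assms(1,3) sets_punctured_lborel])
  have [measurable]: "f \<in> borel_measurable punctured_lborel"
    unfolding measurable_cong_sets[OF sets_punctured_lborel refl] by fact
  show ?thesis unfolding kernel_integral_def
    by (rule borel_measurable_nn_integral) measurable
qed

text \<open>Integrating the two pointwise bounds on v against \<open>\<mu>\<close> encloses - ln of
  the Laplace transform between theta m and theta m minus a multiple of theta^(1+beta). That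
  multiple is finite because \<open>\<mu>\<close> integrates \<open>weight\<close>, and
  \<open>expectation_from_laplace\<close> then identifies the mean as m.\<close>

lemma first_moment:
  assumes psb: "point_source_super_brownian \<rho> \<eta> \<beta> a \<Omega> P X"
    and "0 < \<rho>" "0 \<le> \<eta>" "0 < \<beta>" "\<beta> < 1" and t: "0 < t"
    and \<mu>: "\<mu> \<in> tempered_measures \<rho>" "(\<integral>\<^sup>+x. ennreal (weight x) \<partial>\<mu>) < \<infinity>"
    and f: "f \<in> Ccom_plus"
  shows "(\<integral>\<^sup>+\<omega>. \<integral>\<^sup>+x. ennreal (f x) \<partial>X t \<omega> \<partial>P \<mu>) = (\<integral>\<^sup>+x. kernel_integral a t f x \<partial>\<mu>)"
proof -
  interpret point_source_super_brownian \<rho> \<eta> \<beta> a \<Omega> P X by (rule psb)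
  have "P \<mu> \<in> space (prob_algebra \<Omega>)" using laws[of \<mu>] \<mu> by simp
  then have P: "prob_space (P \<mu>)" "sets (P \<mu>) = sets \<Omega>" by (auto simp: space_prob_algebra)
  interpret Q: prob_space "P \<mu>" by (rule P)
  have X: "X t \<in> measurable (P \<mu>) (vague_borel \<rho>)"
    unfolding measurable_cong_sets[OF P(2) refl] using t by (intro random_variable) simp
  have s\<mu>: "sets \<mu> = sets punctured_borel" "space \<mu> = punctured"
    using \<mu> by (auto simp: tempered_measures_sets tempered_measures_space)
  have fm: "f \<in> borel_measurable punctured_borel" by (rule Ccom_plus_measurable[OF f])
  \<comment> \<open>Tempered measures integrate f to a finite value, so this Bochner integral agrees
    with the integral in [0, infinity].\<close>
  define Z where "Z = (\<lambda>\<omega>. LINT x|X t \<omega>. f x)"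
  have Z: "ennreal (Z \<omega>) = (\<integral>\<^sup>+x. ennreal (f x) \<partial>X t \<omega>)" "0 \<le> Z \<omega>" "Z \<omega> = enn2real (\<integral>\<^sup>+x. ennreal (f x) \<partial>X t \<omega>)"
    if "\<omega> \<in> space (P \<mu>)" for \<omega>
  proof -
    have T: "X t \<omega> \<in> tempered_measures \<rho>" using measurable_space[OF X that] by simp
    have "f \<in> borel_measurable (X t \<omega>)"
      unfolding measurable_cong_sets[OF tempered_measures_sets[OF T] refl] by (rule fm)
    then show eq: "Z \<omega> = enn2real (\<integral>\<^sup>+x. ennreal (f x) \<partial>X t \<omega>)"
      unfolding Z_def by (rule integral_eq_nn_integral)
        (use Ccom_plus_nonneg[OF f] tempered_measures_space[OF T] in \<open>auto intro!: AE_I2\<close>)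
    have "(\<integral>\<^sup>+x. ennreal (f x) \<partial>X t \<omega>) < \<infinity>"
      using T Ccom_plus_test_functions[OF f \<open>0 < \<rho>\<close>] by (auto simp: tempered_measures_def)
    then show "ennreal (Z \<omega>) = (\<integral>\<^sup>+x. ennreal (f x) \<partial>X t \<omega>)" "0 \<le> Z \<omega>"
      unfolding eq by auto
  qed
  have Zm: "Z \<in> borel_measurable (P \<mu>)"
  proof -
    have "(\<lambda>\<omega>. enn2real (\<integral>\<^sup>+x. ennreal (f x) \<partial>X t \<omega>)) \<in> borel_measurable (P \<mu>)"
      using measurable_compose[OF X nn_integral_vague_measurable[OF f]] by measurable
    then show ?thesis using Z(3) by (simp cong: measurable_cong)
  qed
  obtain C0 where C0: "0 < C0" "\<And>x. x \<noteq> 0 \<Longrightarrow> f x \<le> C0 * weight x"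
    using Ccom_plus_le_weight[OF f] by metis
  obtain C1 where C1: "0 < C1" "\<And>s x. 0 < s \<Longrightarrow> s \<le> t \<Longrightarrow> x \<noteq> 0 \<Longrightarrow>
    kernel_integral a s weight x \<le> ennreal (C1 * weight x)"
    using kernel_integral_weight_le[OF t] by metis
  have wm: "weight \<in> borel_measurable \<mu>"
    unfolding measurable_cong_sets[OF s\<mu>(1) refl] by (rule weight_measurable')
  have kle: "kernel_integral a t f x \<le> ennreal (C0 * C1) * ennreal (weight x)" if "x \<noteq> 0" for x
  proof -
    have "kernel_integral a t f x \<le> ennreal C0 * kernel_integral a t weight x"
      using C0 t by (intro kernel_integral_mono weight_measurable') auto
    also have "\<dots> \<le> ennreal C0 * ennreal (C1 * weight x)"
      using t that by (intro mult_left_mono C1) auto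
    finally show ?thesis using C0 C1 by (simp add: ennreal_mult'[symmetric] mult.assoc)
  qed
  have kfin: "kernel_integral a t f x < \<infinity>" if "x \<noteq> 0" for x
    using kle[OF that] by (rule order.strict_trans1) (simp add: ennreal_mult_less_top)
  have km: "kernel_integral a t f \<in> borel_measurable \<mu>"
    by (rule kernel_integral_measurable[OF t fm s\<mu>(1)])
  have "(\<integral>\<^sup>+x. kernel_integral a t f x \<partial>\<mu>) \<le> (\<integral>\<^sup>+x. ennreal (C0 * C1) * ennreal (weight x) \<partial>\<mu>)"
    by (rule nn_integral_mono) (use kle s\<mu> in auto)
  also have "\<dots> = ennreal (C0 * C1) * (\<integral>\<^sup>+x. ennreal (weight x) \<partial>\<mu>)"
    by (rule nn_integral_cmult) (use wm in simp)
  also have "\<dots> < \<infinity>" using \<mu>(2) by (simp add: ennreal_mult_less_top)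
  finally have kifin: "(\<integral>\<^sup>+x. kernel_integral a t f x \<partial>\<mu>) < \<infinity>" .
  define S where "S = point_semigroup a t f"
  have S: "ennreal (S x) = kernel_integral a t f x" "0 \<le> S x" "S x = enn2real (kernel_integral a t f x)" if "x \<noteq> 0" for x
  proof -
    show 1: "ennreal (S x) = kernel_integral a t f x" and 2: "0 \<le> S x"
      unfolding S_def by (rule point_semigroup_eq[OF t f kfin[OF that]])+
    show "S x = enn2real (kernel_integral a t f x)" using 2 unfolding 1[symmetric] by simp
  qed
  have Sm: "S \<in> borel_measurable \<mu>"
  proof -
    have "(\<lambda>x. enn2real (kernel_integral a t f x)) \<in> borel_measurable \<mu>" using km by measurable
    moreover have "S x = enn2real (kernel_integral a t f x)" if "x \<in> space \<mu>" for x
      using S(3)[of x] that s\<mu>(2) by simp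
    ultimately show ?thesis by (subst measurable_cong) auto
  qed
  have SI: "(\<integral>\<^sup>+x. ennreal (S x) \<partial>\<mu>) = (\<integral>\<^sup>+x. kernel_integral a t f x \<partial>\<mu>)"
    by (rule nn_integral_cong) (use S s\<mu> in auto)
  have Si: "integrable \<mu> S"
    using Sm kifin SI S s\<mu> by (intro integrableI_nonneg) (auto intro!: AE_I2)
  have wi: "integrable \<mu> weight"
    using wm \<mu>(2) by (intro integrableI_nonneg) (auto intro!: AE_I2 simp: weight_def)
  define m where "m = (LINT x|\<mu>. S x)"
  have m: "(\<integral>\<^sup>+x. kernel_integral a t f x \<partial>\<mu>) = ennreal m" "0 \<le> m"
    unfolding SI[symmetric] m_def
    using S s\<mu> by (auto intro!: nn_integral_eq_integral Si AE_I2 integral_nonneg_AE)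
  obtain K where K: "0 \<le> K" "\<And>\<theta> v x. 0 < \<theta> \<Longrightarrow> x \<noteq> 0 \<Longrightarrow> log_laplace_solution \<rho> \<eta> \<beta> a (\<lambda>y. \<theta> * f y) v \<Longrightarrow>
    \<theta> * point_semigroup a t f x - \<theta> powr (1 + \<beta>) * K * weight x \<le> v t x"
    using log_laplace_solution_ge[OF assms(3,4,5) t f] by metis
  \<comment> \<open>The integrated error constant of the lower bound on v.\<close>
  define W where "W = K * (LINT x|\<mu>. weight x)"
  have bounds: "- ln (LINT \<omega>|P \<mu>. exp (- (\<theta> * Z \<omega>))) \<le> \<theta> * m \<and>
    \<theta> * m - \<theta> powr (1 + \<beta>) * W \<le> - ln (LINT \<omega>|P \<mu>. exp (- (\<theta> * Z \<omega>)))" if \<theta>: "0 < \<theta>" for \<theta>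
  proof -
    have "(\<lambda>y. \<theta> * f y) \<in> test_functions \<rho>"
      using \<theta> f \<open>0 < \<rho>\<close> by (intro Ccom_plus_test_functions Ccom_plus_mult) auto
    then obtain v where v: "log_laplace_solution \<rho> \<eta> \<beta> a (\<lambda>y. \<theta> * f y) v"
      and eq: "- ln (LINT \<omega>|P \<mu>. exp (- (LINT x|X t \<omega>. \<theta> * f x))) = (LINT x|\<mu>. v t x)"
      using log_laplace[of "\<lambda>y. \<theta> * f y"] \<mu>(1) t by blast
    have vt: "v t \<in> test_functions \<rho>" using v t by (simp add: log_laplace_solution_def)
    have vi: "integrable \<mu> (v t)"
    proof (rule integrableI_nonneg)
      show "v t \<in> borel_measurable \<mu>"
        unfolding measurable_cong_sets[OF s\<mu>(1) refl]
        using vt by (simp add: test_functions_def weighted_Lp_def)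
      show "AE x in \<mu>. 0 \<le> v t x" using vt s\<mu> by (auto intro!: AE_I2 simp: test_functions_def)
      show "(\<integral>\<^sup>+x. ennreal (v t x) \<partial>\<mu>) < \<infinity>" using vt \<mu>(1) by (auto simp: tempered_measures_def)
    qed
    have "(LINT x|\<mu>. v t x) \<le> (LINT x|\<mu>. \<theta> * S x)"
    proof (rule integral_mono[OF vi])
      show "integrable \<mu> (\<lambda>x. \<theta> * S x)" using Si by simp
      show "v t x \<le> \<theta> * S x" if "x \<in> space \<mu>" for x
        using log_laplace_solution_le(1)[OF v assms(3) t, of x] that s\<mu>
        by (simp add: S_def point_semigroup_mult)
    qed
    moreover have "(LINT x|\<mu>. \<theta> * S x - \<theta> powr (1 + \<beta>) * K * weight x) \<le> (LINT x|\<mu>. v t x)"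
    proof (rule integral_mono[OF _ vi])
      show "integrable \<mu> (\<lambda>x. \<theta> * S x - \<theta> powr (1 + \<beta>) * K * weight x)" using Si wi by simp
      show "\<theta> * S x - \<theta> powr (1 + \<beta>) * K * weight x \<le> v t x" if "x \<in> space \<mu>" for x
        unfolding S_def using that s\<mu> by (intro K(2)[OF \<theta> _ v]) auto
    qed
    moreover have "(LINT x|\<mu>. \<theta> * S x - \<theta> powr (1 + \<beta>) * K * weight x) = \<theta> * m - \<theta> powr (1 + \<beta>) * W"
      using Si wi by (simp add: m_def W_def mult.assoc)
    moreover have "- ln (LINT \<omega>|P \<mu>. exp (- (\<theta> * Z \<omega>))) = (LINT x|\<mu>. v t x)"
      using eq by (simp add: Z_def)
    ultimately show ?thesis by (simp add: m_def)
  qed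
  have "(\<integral>\<^sup>+\<omega>. \<integral>\<^sup>+x. ennreal (f x) \<partial>X t \<omega> \<partial>P \<mu>) = (\<integral>\<^sup>+\<omega>. ennreal (Z \<omega>) \<partial>P \<mu>)"
    by (rule nn_integral_cong) (simp add: Z(1))
  also have "\<dots> = ennreal m"
    by (rule Q.expectation_from_laplace[OF Zm Z(2) m(2) \<open>0 < \<beta>\<close>]) (use bounds in auto)
  finally show ?thesis by (simp add: m)
qed

section \<open>The scaling limit\<close>

text \<open>A measure that integrates 1/|x| integrates everything dominated by it: test functions by
  their definition, and the indicator of a compact set of radius R because it is at most
  R/|x|.\<close>

lemma tempered_measuresI:
  assumes s: "sets \<nu> = sets punctured_borel" and w: "(\<integral>\<^sup>+x. ennreal (weight x) \<partial>\<nu>) < \<infinity>"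
  shows "\<nu> \<in> tempered_measures \<rho>"
proof -
  have sp: "space \<nu> = punctured" using sets_eq_imp_space_eq[OF s] by simp
  have wm: "weight \<in> borel_measurable \<nu>"
    unfolding measurable_cong_sets[OF s refl] by (rule weight_measurable')
  have fin: "(\<integral>\<^sup>+x. g x \<partial>\<nu>) < \<infinity>" if "0 < C" "\<And>x. x \<noteq> 0 \<Longrightarrow> g x \<le> ennreal (C * weight x)" for C and g :: "real^3 \<Rightarrow> ennreal"
  proof -
    have "(\<integral>\<^sup>+x. g x \<partial>\<nu>) \<le> (\<integral>\<^sup>+x. ennreal C * ennreal (weight x) \<partial>\<nu>)"
      using that sp by (intro nn_integral_mono) (auto simp: ennreal_mult')
    also have "\<dots> = ennreal C * (\<integral>\<^sup>+x. ennreal (weight x) \<partial>\<nu>)"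
      by (rule nn_integral_cmult) (use wm in simp)
    also have "\<dots> < \<infinity>" using w by (simp add: ennreal_mult_less_top)
    finally show ?thesis .
  qed
  have "emeasure \<nu> K < \<infinity>" if K: "compact K" "K \<subseteq> punctured" for K
  proof -
    obtain R where R: "0 < R" "\<And>x. x \<in> K \<Longrightarrow> norm x \<le> R"
      using compact_imp_bounded[OF K(1)] unfolding bounded_pos by auto
    have "K \<in> sets \<nu>" using K s by (auto simp: sets_restrict_space_iff compact_imp_closed)
    then have "emeasure \<nu> K = (\<integral>\<^sup>+x. indicator K x \<partial>\<nu>)" by simp
    also have "\<dots> < \<infinity>"
    proof (rule fin[OF R(1)])
      fix x :: "real^3" assume "x \<noteq> 0"
      then show "indicator K x \<le> ennreal (R * weight x)"
        using R(2)[of x] by (cases "x \<in> K") (auto simp: weight_def)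
    qed
    finally show ?thesis .
  qed
  moreover have "(\<integral>\<^sup>+x. ennreal (\<phi> x) \<partial>\<nu>) < \<infinity>" if "\<phi> \<in> test_functions \<rho>" for \<phi>
  proof -
    have "\<exists>C>0. \<forall>x\<in>punctured. 0 \<le> \<phi> x \<and> \<phi> x \<le> C * weight x"
      using that by (simp add: test_functions_def)
    then obtain C where C: "0 < C" "\<forall>x\<in>punctured. 0 \<le> \<phi> x \<and> \<phi> x \<le> C * weight x"
      by blast
    show ?thesis by (rule fin[OF C(1)]) (use C(2) in \<open>simp add: ennreal_leI\<close>)
  qed
  ultimately show ?thesis using s by (simp add: tempered_measures_def)
qed

text \<open>The weight is not compactly supported, so the first moment formula is applied to its
  cutoffs. The resulting bounds do not depend on n and pass to the monotone limit.\<close>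

lemma nn_integral_mean_weight_finite:
  assumes psb: "point_source_super_brownian \<rho> \<eta> \<beta> a \<Omega> P X"
    and "0 < \<rho>" "0 \<le> \<eta>" "0 < \<beta>" "\<beta> < 1" and t: "0 < t"
    and \<mu>: "\<mu> \<in> tempered_measures \<rho>" "(\<integral>\<^sup>+x. ennreal (weight x) \<partial>\<mu>) < \<infinity>"
    and X: "X t \<in> measurable (P \<mu>) (vague_borel \<rho>)"
  shows "(\<integral>\<^sup>+x. ennreal (weight x) \<partial>mean_measure (P \<mu>) (X t)) < \<infinity>"
proof -
  obtain C where C: "0 < C" "\<And>s x. 0 < s \<Longrightarrow> s \<le> t \<Longrightarrow> x \<noteq> 0 \<Longrightarrow>
    kernel_integral a s weight x \<le> ennreal (C * weight x)"
    using kernel_integral_weight_le[OF t] by metis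
  let ?B = "ennreal C * (\<integral>\<^sup>+x. ennreal (weight x) \<partial>\<mu>)"
  let ?f = "\<lambda>n x. cutoff n x * weight x"
  have f: "?f n \<in> Ccom_plus" for n
    by (rule cutoff_times_Ccom_plus) (auto simp: weight_def intro!: continuous_intros)
  have wm: "weight \<in> borel_measurable \<mu>"
    unfolding measurable_cong_sets[OF tempered_measures_sets[OF \<mu>(1)] refl] by (rule weight_measurable')
  have le: "(\<integral>\<^sup>+x. ennreal (?f n x) \<partial>mean_measure (P \<mu>) (X t)) \<le> ?B" for n
  proof -
    have "(\<integral>\<^sup>+x. ennreal (?f n x) \<partial>mean_measure (P \<mu>) (X t)) = (\<integral>\<^sup>+\<omega>. \<integral>\<^sup>+x. ennreal (?f n x) \<partial>X t \<omega> \<partial>P \<mu>)"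
      by (rule nn_integral_mean_measure[OF X]) (use Ccom_plus_measurable[OF f] in measurable)
    also have "\<dots> = (\<integral>\<^sup>+x. kernel_integral a t (?f n) x \<partial>\<mu>)"
      by (rule first_moment[OF psb assms(2-5) t \<mu> f])
    also have "\<dots> \<le> (\<integral>\<^sup>+x. ennreal C * ennreal (weight x) \<partial>\<mu>)"
    proof (rule nn_integral_mono)
      fix x assume "x \<in> space \<mu>"
      then have x: "x \<noteq> 0" using tempered_measures_space[OF \<mu>(1)] by auto
      have "kernel_integral a t (?f n) x \<le> ennreal 1 * kernel_integral a t weight x"
        using t cutoff_bounds(2)[of n]
        by (intro kernel_integral_mono weight_measurable') (auto simp: weight_def divide_right_mono)
      also have "\<dots> \<le> ennreal (C * weight x)" using C(2)[OF t order_refl x] by simp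
      finally show "kernel_integral a t (?f n) x \<le> ennreal C * ennreal (weight x)"
        using C(1) by (simp add: ennreal_mult')
    qed
    also have "\<dots> = ?B" by (rule nn_integral_cmult) (use wm in simp)
    finally show ?thesis .
  qed
  have "(\<lambda>n. \<integral>\<^sup>+x. ennreal (?f n x) \<partial>mean_measure (P \<mu>) (X t))
      \<longlonglongrightarrow> (\<integral>\<^sup>+x. ennreal (weight x) \<partial>mean_measure (P \<mu>) (X t))"
  proof (rule nn_integral_LIMSEQ)
    show "incseq (\<lambda>n x. ennreal (?f n x))"
      by (rule incseq_SucI, rule le_funI, rule ennreal_leI, rule mult_right_mono)
         (auto intro: cutoff_mono simp: weight_def)
    show "(\<lambda>x. ennreal (?f n x)) \<in> borel_measurable (mean_measure (P \<mu>) (X t))" for n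
      unfolding measurable_cong_sets[OF sets_mean_measure[OF X] refl]
      using Ccom_plus_measurable[OF f] by measurable
    fix x :: "real^3"
    show "(\<lambda>n. ennreal (?f n x)) \<longlonglongrightarrow> ennreal (weight x)"
    proof (cases "x = 0")
      case False
      from cutoff_eventually_1[OF this]
      have "\<forall>\<^sub>F n in sequentially. ennreal (?f n x) = ennreal (weight x)"
        by eventually_elim simp
      then show ?thesis by (rule tendsto_eventually)
    qed (simp add: weight_def)
  qed
  then have "(\<integral>\<^sup>+x. ennreal (weight x) \<partial>mean_measure (P \<mu>) (X t)) \<le> ?B"
    by (rule LIMSEQ_le_const2) (use le in blast)
  also have "\<dots> < \<infinity>" using \<mu>(2) by (simp add: ennreal_mult_less_top)
  finally show ?thesis .
qed

lemma nn_integral_scale_dilate: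
  assumes s: "sets \<nu> = sets punctured_borel" and c: "0 < c" and g: "g \<in> borel_measurable punctured_borel"
  shows "(\<integral>\<^sup>+x. ennreal (g x) \<partial>scale_measure r (dilate c \<nu>)) = r * (\<integral>\<^sup>+x. ennreal (g (x /\<^sub>R c)) \<partial>\<nu>)"
proof -
  have m: "(\<lambda>x. x /\<^sub>R c) \<in> measurable \<nu> punctured_borel"
    unfolding measurable_cong_sets[OF s refl]
    using c by (intro measurable_restrict_space2 measurable_restrict_space1) auto
  show ?thesis
    unfolding dilate_def using g m
    by (subst nn_integral_scale_measure) (simp_all add: nn_integral_distr)
qed

text \<open>Substituting y -> sqrt k y gives the Jacobian k^(3/2), which cancels the k^(-3/2) from
  the scaling of the kernel.\<close>

lemma kernel_integral_scale:
  assumes k: "0 < k" and t: "0 < t" and f: "f \<in> Ccom_plus"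
  shows "kernel_integral a (k * t) (\<lambda>y. f (y /\<^sub>R sqrt k)) x
    = (\<integral>\<^sup>+y. ennreal (f y * point_kernel (sqrt k * a) t (x /\<^sub>R sqrt k) y) \<partial>punctured_lborel)"
proof -
  let ?h = "\<lambda>y. ennreal (f (y /\<^sub>R sqrt k) * point_kernel a (k * t) x y)"
  have [measurable]: "point_kernel a (k * t) x \<in> borel_measurable punctured_borel"
    "(\<lambda>y. f (y /\<^sub>R sqrt k)) \<in> borel_measurable punctured_borel"
    using k t by (auto intro!: point_kernel_measurable_snd Ccom_plus_measurable[OF Ccom_plus_scale[OF f]])
  have "?h \<in> borel_measurable punctured_borel" by measurable
  then have m: "(\<lambda>y. ?h y * indicator punctured y) \<in> borel_measurable borel"
    by (subst (asm) borel_measurable_restrict_space_iff_ennreal) auto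
  have "kernel_integral a (k * t) (\<lambda>y. f (y /\<^sub>R sqrt k)) x = (\<integral>\<^sup>+y. ?h y * indicator punctured y \<partial>lborel)"
    unfolding kernel_integral_def by (rule nn_integral_punctured_lborel)
  also have "\<dots> = ennreal (sqrt k ^ 3) * (\<integral>\<^sup>+y. ?h (sqrt k *\<^sub>R y) * indicator punctured (sqrt k *\<^sub>R y) \<partial>lborel)"
    by (rule nn_integral_lborel_scaleR[OF m]) (use k in simp)
  also have "\<dots> = (\<integral>\<^sup>+y. ennreal (sqrt k ^ 3) * (?h (sqrt k *\<^sub>R y) * indicator punctured (sqrt k *\<^sub>R y)) \<partial>lborel)"
  proof (rule nn_integral_cmult[symmetric])
    have "(\<lambda>y. sqrt k *\<^sub>R y) \<in> measurable lborel borel" by measurable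
    from measurable_compose[OF this m]
    show "(\<lambda>y. ?h (sqrt k *\<^sub>R y) * indicator punctured (sqrt k *\<^sub>R y)) \<in> borel_measurable lborel" .
  qed
  also have "\<dots> = (\<integral>\<^sup>+y. ennreal (f y * point_kernel (sqrt k * a) t (x /\<^sub>R sqrt k) y) * indicator punctured y \<partial>lborel)"
  proof (rule nn_integral_cong)
    fix y :: "real^3"
    show "ennreal (sqrt k ^ 3) * (?h (sqrt k *\<^sub>R y) * indicator punctured (sqrt k *\<^sub>R y))
      = ennreal (f y * point_kernel (sqrt k * a) t (x /\<^sub>R sqrt k) y) * indicator punctured y"
    proof (cases "y = 0")
      case False
      have "sqrt k ^ 3 * (f y * (k powr (- 3 / 2) * p)) = f y * p" for p
      proof -
        have "sqrt k ^ 3 * (f y * (k powr (- 3 / 2) * p)) = (k powr (3 / 2) * k powr (- 3 / 2)) * (f y * p)"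
          unfolding sqrt_cube[OF k] by (simp only: ac_simps)
        also have "k powr (3 / 2) * k powr (- 3 / 2) = 1" using k by (simp add: powr_add[symmetric])
        finally show ?thesis by simp
      qed
      note cancel = this
      have y': "sqrt k *\<^sub>R y /\<^sub>R sqrt k = y" using k by simp
      have "ennreal (sqrt k ^ 3) * ?h (sqrt k *\<^sub>R y)
          = ennreal (sqrt k ^ 3 * (f y * (k powr (- 3 / 2) * point_kernel (sqrt k * a) t (x /\<^sub>R sqrt k) y)))"
        unfolding y' point_kernel_scale[OF k t] by (rule ennreal_mult'[symmetric]) (use k in simp)
      also have "\<dots> = ennreal (f y * point_kernel (sqrt k * a) t (x /\<^sub>R sqrt k) y)"
        unfolding cancel ..
      finally show ?thesis using False k by (simp add: mult.assoc[symmetric])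
    qed simp
  qed
  finally show ?thesis unfolding nn_integral_punctured_lborel[symmetric] .
qed

section \<open>The rescaled kernel: form, majorant and pointwise limit\<close>

lemma rescaled_kernel_eq:
  assumes "0 < k" "0 < t" "x \<noteq> 0"
  shows "1 / sqrt k * point_kernel b t (x /\<^sub>R sqrt k) y
    = 1 / sqrt k * gauss t (norm (y - x /\<^sub>R sqrt k)) + profile b t (norm x / sqrt k + norm y) / (norm x * norm y)"
proof -
  have "norm (x /\<^sub>R sqrt k) = norm x / sqrt k" using assms by (simp add: divide_inverse mult.commute)
  \<comment> \<open>The cancellation that explains the normalisation: the prefactor meets 1/|x/sqrt
    k| and leaves 1/|x|, while the free term keeps its 1/sqrt k.\<close>
  moreover have "1 / sqrt k * (p / (norm x / sqrt k * norm y)) = p / (norm x * norm y)" for p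
    using assms by simp
  ultimately show ?thesis using assms by (simp add: point_kernel_eq heat_kernel_def distrib_left)
qed

text \<open>The free term must also be bounded by a multiple of 1/|x| uniformly in k. With z =
  x/sqrt k one has 1/sqrt k = |z|/|x|; then |z| <= |y| + |y - z|, and the factor |y - z| is absorbed
  by the Gaussian.\<close>

lemma rescaled_kernel_le:
  assumes k: "0 < k" and t: "0 < t" and x: "x \<noteq> 0" and A: "0 \<le> A" "- A \<le> b"
  shows "1 / sqrt k * point_kernel b t (x /\<^sub>R sqrt k) y
    \<le> weight x * (norm y * t powr (- 3 / 2) + 1 / t
        + 4 * sqrt pi * exp (64 * pi\<^sup>2 * A\<^sup>2 * t) / sqrt t / norm y)"
proof -
  define z where "z = x /\<^sub>R sqrt k"
  let ?C = "4 * sqrt pi * exp (64 * pi\<^sup>2 * A\<^sup>2 * t) / sqrt t"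
  have C: "0 \<le> ?C" using t by simp
  have nz: "1 / sqrt k = weight x * norm z" using k x by (simp add: z_def weight_def divide_inverse)
  have "norm z * gauss t (norm (y - z)) \<le> (norm y + norm (y - z)) * gauss t (norm (y - z))"
    by (intro mult_right_mono gauss_nonneg) (metis norm_triangle_sub norm_minus_commute)
  also have "\<dots> = norm y * gauss t (norm (y - z)) + norm (y - z) * gauss t (norm (y - z))"
    by (rule distrib_right)
  also have "\<dots> \<le> norm y * t powr (- 3 / 2) + 1 / t"
  proof (intro add_mono mult_left_mono gauss_le t norm_ge_zero)
    have "norm (y - z) * gauss t (norm (y - z)) \<le> exp (- ((norm (y - z))\<^sup>2 / (8 * t))) / t"
      by (rule mult_gauss_le[OF t norm_ge_zero])
    also have "\<dots> \<le> 1 / t" using t by (intro divide_right_mono) auto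
    finally show "norm (y - z) * gauss t (norm (y - z)) \<le> 1 / t" .
  qed
  finally have "weight x * (norm z * gauss t (norm (y - z))) \<le> weight x * (norm y * t powr (- 3 / 2) + 1 / t)"
    by (rule mult_left_mono) (simp add: weight_def)
  then have 1: "1 / sqrt k * gauss t (norm (y - z)) \<le> weight x * (norm y * t powr (- 3 / 2) + 1 / t)"
    unfolding nz by (simp only: mult.assoc)
  have "profile b t (norm x / sqrt k + norm y) \<le> ?C * exp (- ((norm x / sqrt k + norm y)\<^sup>2 / (8 * t)))"
    by (rule profile_le[OF t _ A]) (use k in simp)
  also have "\<dots> \<le> ?C * 1" using C t by (intro mult_left_mono) auto
  finally have "profile b t (norm x / sqrt k + norm y) / (norm x * norm y) \<le> ?C / (norm x * norm y)"
    by (intro divide_right_mono) auto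
  also have "\<dots> = weight x * (?C / norm y)" by (simp add: weight_def)
  finally have 2: "profile b t (norm x / sqrt k + norm y) / (norm x * norm y) \<le> weight x * (?C / norm y)" .
  show ?thesis
    unfolding rescaled_kernel_eq[OF k t x] using add_mono[OF 1 2] unfolding z_def by (simp only: distrib_left)
qed

text \<open>The factor c stands for the value f y; it is carried along because for an infinite limit
  the product depends on whether c is 0.\<close>

lemma rescaled_kernel_tendsto:
  assumes t: "0 < t" and k: "filterlim k at_top sequentially" "\<And>n. 0 < k n"
    and b: "(\<lambda>n. ereal (b n)) \<longlonglongrightarrow> bs" and x: "x \<noteq> 0" and y: "y \<noteq> 0" and c: "0 \<le> c"
  shows "(\<lambda>n. ennreal (c * (1 / sqrt (k n) * point_kernel (b n) t (x /\<^sub>R sqrt (k n)) y)))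
    \<longlonglongrightarrow> ennreal c * ext_vartheta bs t x y"
proof -
  have "filterlim (\<lambda>n. sqrt (k n)) at_top sequentially"
    by (rule filterlim_compose[OF sqrt_at_top k(1)])
  then have "(\<lambda>n. inverse (sqrt (k n))) \<longlonglongrightarrow> 0"
    by (rule tendsto_inverse_0_at_top)
  then have i: "(\<lambda>n. 1 / sqrt (k n)) \<longlonglongrightarrow> 0" by (simp add: inverse_eq_divide)
  have heat: "(\<lambda>n. 1 / sqrt (k n) * gauss t (norm (y - x /\<^sub>R sqrt (k n)))) \<longlonglongrightarrow> 0"
  proof (rule tendsto_sandwich[of "\<lambda>_. 0" _ _ "\<lambda>n. 1 / sqrt (k n) * t powr (- 3 / 2)"])
    show "\<forall>\<^sub>F n in sequentially. 1 / sqrt (k n) * gauss t (norm (y - x /\<^sub>R sqrt (k n))) \<le> 1 / sqrt (k n) * t powr (- 3 / 2)"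
      by (intro always_eventually allI mult_left_mono gauss_le t) (use k(2) in \<open>simp add: less_imp_le\<close>)
    show "\<forall>\<^sub>F n in sequentially. 0 \<le> 1 / sqrt (k n) * gauss t (norm (y - x /\<^sub>R sqrt (k n)))"
      by (intro always_eventually allI mult_nonneg_nonneg gauss_nonneg) (use k(2) in \<open>simp add: less_imp_le\<close>)
    show "(\<lambda>n. 1 / sqrt (k n) * t powr (- 3 / 2)) \<longlonglongrightarrow> 0"
      by (rule tendsto_mult_left_zero[OF i])
  qed simp
  define r where "r n = norm x / sqrt (k n) + norm y" for n
  have r: "r \<longlonglongrightarrow> norm y" "\<And>n. 0 \<le> r n"
  proof -
    from tendsto_add[OF tendsto_mult_right[OF i, of "norm x"] tendsto_const[of "norm y"]]
    show "r \<longlonglongrightarrow> norm y" by (simp add: r_def[abs_def])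
    show "0 \<le> r n" for n using k(2)[of n] by (simp add: r_def)
  qed
  have eq: "c * (1 / sqrt (k n) * point_kernel (b n) t (x /\<^sub>R sqrt (k n)) y)
    = c * (1 / sqrt (k n) * gauss t (norm (y - x /\<^sub>R sqrt (k n))) + profile (b n) t (r n) / (norm x * norm y))" for n
    unfolding r_def rescaled_kernel_eq[OF k(2) t x] ..
  show ?thesis
  proof (cases bs)
    case (real a)
    then have "b \<longlonglongrightarrow> a" using b by simp
    from profile_tendsto[OF t this r]
    have "(\<lambda>n. c * (1 / sqrt (k n) * gauss t (norm (y - x /\<^sub>R sqrt (k n))) + profile (b n) t (r n) / (norm x * norm y)))
        \<longlonglongrightarrow> c * (0 + profile a t (norm y) / (norm x * norm y))"
      by (intro tendsto_mult tendsto_add heat tendsto_divide tendsto_const) (use x y in auto)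
    then show ?thesis
      unfolding eq using real c by (auto simp: ext_vartheta_def vartheta_eq[OF t] ennreal_mult'[symmetric] intro: tendsto_ennrealI)
  next
    case PInf
    then have bt: "filterlim b at_top sequentially" using b by (simp add: tendsto_PInfty_eq_at_top)
    \<comment> \<open>Truncation at 0 makes all couplings nonnegative, as
      \<open>profile_tendsto_0\<close> requires; it changes only finitely many terms.\<close>
    then have "filterlim (\<lambda>n. max 0 (b n)) at_top sequentially"
      by (rule filterlim_at_top_mono) simp
    from profile_tendsto_0[OF t this _ r(2)] have "(\<lambda>n. profile (max 0 (b n)) t (r n)) \<longlonglongrightarrow> 0" by simp
    moreover have "\<forall>\<^sub>F n in sequentially. 0 \<le> b n"
      using bt unfolding filterlim_at_top by blast
    then have "\<forall>\<^sub>F n in sequentially. profile (max 0 (b n)) t (r n) = profile (b n) t (r n)"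
      by eventually_elim (simp add: max_def)
    ultimately have "(\<lambda>n. profile (b n) t (r n)) \<longlonglongrightarrow> 0" by (rule Lim_transform_eventually)
    then have "(\<lambda>n. c * (1 / sqrt (k n) * gauss t (norm (y - x /\<^sub>R sqrt (k n))) + profile (b n) t (r n) / (norm x * norm y)))
        \<longlonglongrightarrow> c * (0 + 0 / (norm x * norm y))"
      by (intro tendsto_mult tendsto_add heat tendsto_divide tendsto_const) (use x y in auto)
    from tendsto_ennrealI[OF this] show ?thesis
      unfolding eq using PInf by (simp add: ext_vartheta_def)
  next
    case MInf
    have bt: "filterlim b at_bot sequentially"
      unfolding filterlim_at_bot
    proof
      fix Z
      have "\<forall>\<^sub>F n in sequentially. ereal (b n) < ereal Z"
        using b unfolding MInf tendsto_MInfty by blast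
      then show "\<forall>\<^sub>F n in sequentially. b n \<le> Z" by eventually_elim simp
    qed
    show ?thesis
    \<comment> \<open>For c = 0 both sides are 0, by the convention that 0 times infinity is
      0.\<close>
    proof (cases "c = 0")
      case False
      then have c: "0 < c" using c by simp
      \<comment> \<open>This supplies a fixed R for \<open>profile_ge\<close>, whose bound then
        grows like exp (-4 pi b n).\<close>
      have "\<forall>\<^sub>F n in sequentially. r n < norm y + 1"
        by (rule order_tendstoD(2)[OF r(1)]) simp
      moreover have "\<forall>\<^sub>F n in sequentially. b n \<le> 0"
        using bt unfolding filterlim_at_bot by blast
      ultimately have ge: "\<forall>\<^sub>F n in sequentially. c * gauss t (2 + (norm y + 1)) / (norm x * norm y) * exp (- 4 * pi * b n)
          \<le> c * (1 / sqrt (k n) * point_kernel (b n) t (x /\<^sub>R sqrt (k n)) y)"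
      proof eventually_elim
        case (elim n)
        have "exp (- 4 * pi * b n) * gauss t (2 + (norm y + 1)) \<le> profile (b n) t (r n)"
          by (rule profile_ge[OF t r(2)]) (use elim in auto)
        then have "c * (exp (- 4 * pi * b n) * gauss t (2 + (norm y + 1)) / (norm x * norm y))
            \<le> c * (profile (b n) t (r n) / (norm x * norm y))"
          using c by (intro mult_left_mono divide_right_mono) auto
        also have "\<dots> \<le> c * (1 / sqrt (k n) * gauss t (norm (y - x /\<^sub>R sqrt (k n))) + profile (b n) t (r n) / (norm x * norm y))"
          using c k(2)[of n] by (intro mult_left_mono) (auto simp: gauss_nonneg)
        finally show ?case unfolding eq by (simp add: ac_simps)
      qed
      have "filterlim (\<lambda>n. - b n) at_top sequentially"
        using bt by (simp add: filterlim_uminus_at_top)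
      then have "filterlim (\<lambda>n. (4 * pi) * - b n) at_top sequentially"
        by (rule filterlim_tendsto_pos_mult_at_top[OF tendsto_const, rotated]) simp
      from filterlim_compose[OF exp_at_top this]
      have "filterlim (\<lambda>n. exp (- 4 * pi * b n)) at_top sequentially" by simp
      then have "filterlim (\<lambda>n. c * gauss t (2 + (norm y + 1)) / (norm x * norm y) * exp (- 4 * pi * b n)) at_top sequentially"
        by (rule filterlim_tendsto_pos_mult_at_top[OF tendsto_const, rotated])
           (use c x y in \<open>auto intro!: divide_pos_pos mult_pos_pos gauss_pos t\<close>)
      from filterlim_at_top_mono[OF this ge]
      have "(\<lambda>n. ennreal (c * (1 / sqrt (k n) * point_kernel (b n) t (x /\<^sub>R sqrt (k n)) y))) \<longlonglongrightarrow> \<infinity>"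
        unfolding infinity_ennreal_def ennreal_tendsto_top_eq_at_top .
      then show ?thesis using c MInf by (simp add: ext_vartheta_def ennreal_mult_top)
    qed simp
  qed
qed

lemma ext_vartheta_measurable:
  assumes "0 < t" "sets M = sets punctured_borel" "sets N = sets punctured_borel"
  shows "(\<lambda>(x, y). ext_vartheta bs t x y) \<in> borel_measurable (M \<Otimes>\<^sub>M N)"
proof (cases bs)
  case (real a)
  then show ?thesis
    using measurable_compose[OF vartheta_measurable[OF assms, of a] measurable_ennreal]
    by (simp add: ext_vartheta_def case_prod_beta)
qed (simp_all add: ext_vartheta_def)

section \<open>Passing to the limit under both integrals\<close>

context
  fixes \<mu> :: "(real^3) measure" and \<rho> t :: real
  assumes t: "0 < t" and \<mu>: "\<mu> \<in> tempered_measures \<rho>" "(\<integral>\<^sup>+x. ennreal (weight x) \<partial>\<mu>) < \<infinity>"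
begin

interpretation pair_sigma_finite \<mu> punctured_lborel
  by (intro pair_sigma_finite.intro sigma_finite_tempered[OF \<mu>(1)] sigma_finite_punctured_lborel)

text \<open>On the product of \<open>\<mu>\<close> with Lebesgue measure a single limit argument
  covers both integrations. Tonelli is used in one order before the limit and in the other after it,
  where the x-integral must appear inside as the density.\<close>

lemma rescaled_integral_tendsto_aux:
  assumes f: "f \<in> Ccom_plus" and k: "filterlim k at_top sequentially" "\<And>n. 0 < k n"
    and b: "(\<lambda>n. ereal (b n)) \<longlonglongrightarrow> bs" and A: "0 \<le> A" "bs \<noteq> - \<infinity> \<Longrightarrow> (\<And>n. - A \<le> b n)"
  shows "(\<lambda>n. \<integral>\<^sup>+x. \<integral>\<^sup>+y. ennreal (f y * (1 / sqrt (k n) * point_kernel (b n) t (x /\<^sub>R sqrt (k n)) y))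
      \<partial>punctured_lborel \<partial>\<mu>)
    \<longlonglongrightarrow> (\<integral>\<^sup>+y. ennreal (f y) * (\<integral>\<^sup>+x. ext_vartheta bs t x y \<partial>\<mu>) \<partial>punctured_lborel)"
proof -
  let ?M = "\<mu> \<Otimes>\<^sub>M punctured_lborel"
  define u where "u n = (\<lambda>(x, y). ennreal (f y * (1 / sqrt (k n) * point_kernel (b n) t (x /\<^sub>R sqrt (k n)) y)))" for n
  define v where "v = (\<lambda>(x, y). ennreal (f y) * ext_vartheta bs t x y)"
  have s\<mu>: "sets \<mu> = sets punctured_borel" "space \<mu> = punctured"
    using \<mu> by (auto simp: tempered_measures_sets tempered_measures_space)
  have [measurable]: "f \<in> borel_measurable punctured_lborel"
    unfolding measurable_cong_sets[OF sets_punctured_lborel refl] by (rule Ccom_plus_measurable[OF f])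
  have um [measurable]: "u n \<in> borel_measurable ?M" for n
  proof -
    have "(\<lambda>(x, y). point_kernel (b n) t (x /\<^sub>R sqrt (k n)) y) \<in> borel_measurable (borel \<Otimes>\<^sub>M borel)"
      unfolding point_kernel_eq[OF t] heat_kernel_def by measurable
    from measurable_compose[OF measurable_fst_snd_borel[OF s\<mu>(1) sets_punctured_lborel] this]
    have [measurable]: "(\<lambda>p. point_kernel (b n) t (fst p /\<^sub>R sqrt (k n)) (snd p)) \<in> borel_measurable ?M"
      by (simp add: case_prod_beta)
    show ?thesis unfolding u_def case_prod_beta by measurable
  qed
  have [measurable]: "(\<lambda>(x, y). ext_vartheta bs t x y) \<in> borel_measurable ?M"
    by (rule ext_vartheta_measurable[OF t s\<mu>(1) sets_punctured_lborel])
  have vm [measurable]: "v \<in> borel_measurable ?M"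
    unfolding v_def by measurable
  have uv: "(\<lambda>n. u n p) \<longlonglongrightarrow> v p" if "p \<in> space ?M" for p
  proof -
    obtain x y where p: "p = (x, y)" by (cases p)
    have xy: "x \<noteq> 0" "y \<noteq> 0" using that s\<mu> by (auto simp: p space_pair_measure)
    show ?thesis unfolding p u_def v_def prod.case
      by (rule rescaled_kernel_tendsto[OF t k b xy Ccom_plus_nonneg[OF f xy(2)]])
  qed
  have lim: "(\<lambda>n. integral\<^sup>N ?M (u n)) \<longlonglongrightarrow> integral\<^sup>N ?M v"
  proof (cases "bs = - \<infinity>")
    case False
    obtain d R C where C: "0 < d" "0 < R" "0 < C" "\<And>x. x \<noteq> 0 \<Longrightarrow> f x \<le> C"
      "\<And>x. x \<noteq> 0 \<Longrightarrow> f x \<noteq> 0 \<Longrightarrow> d \<le> norm x \<and> norm x \<le> R"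
      using Ccom_plus_bounds[OF f] by metis
    define D where "D = 4 * sqrt pi * exp (64 * pi\<^sup>2 * A\<^sup>2 * t) / sqrt t"
    have D: "0 \<le> D" using t by (simp add: D_def)
    \<comment> \<open>The bracket in \<open>rescaled_kernel_le\<close> evaluated at the worst points
      of the support d <= |y| <= R, times the bound C on f.\<close>
    define h where "h = C * (R * t powr (- 3 / 2) + 1 / t + D / d)"
    define w where "w = (\<lambda>(x, y::real^3). ennreal (weight x) * (ennreal h * indicator (cball 0 R) y))"
    have wm: "weight \<in> borel_measurable \<mu>"
      unfolding measurable_cong_sets[OF s\<mu>(1) refl] by (rule weight_measurable')
    have [measurable]: "cball 0 R \<inter> punctured \<in> sets punctured_lborel"
      unfolding sets_punctured_lborel by (auto simp: sets_restrict_space_iff)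
    have im [measurable]: "indicator (cball 0 R) \<in> borel_measurable punctured_lborel"
      by (intro measurable_restrict_space1 borel_measurable_indicator) simp
    note wm [measurable]
    have w_meas [measurable]: "w \<in> borel_measurable ?M"
      unfolding w_def by measurable
    have le: "u n p \<le> w p" if "p \<in> space ?M" for n p
    proof -
      obtain x y where p: "p = (x, y)" by (cases p)
      have xy: "x \<noteq> 0" "y \<noteq> 0" using that s\<mu> by (auto simp: p space_pair_measure)
      show ?thesis
      proof (cases "f y = 0")
        case True then show ?thesis by (simp add: p u_def)
      next
        case False
        then have y: "d \<le> norm y" "norm y \<le> R" using C(5)[OF xy(2)] by auto
        have w0: "0 \<le> weight x" by (simp add: weight_def)
        have "1 / sqrt (k n) * point_kernel (b n) t (x /\<^sub>R sqrt (k n)) y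
            \<le> weight x * (norm y * t powr (- 3 / 2) + 1 / t + D / norm y)"
          unfolding D_def by (rule rescaled_kernel_le[OF k(2) t xy(1) A(1) A(2)[OF \<open>bs \<noteq> - \<infinity>\<close>]])
        also have "\<dots> \<le> weight x * (R * t powr (- 3 / 2) + 1 / t + D / d)"
        proof (intro mult_left_mono add_mono order_refl)
          show "norm y * t powr (- 3 / 2) \<le> R * t powr (- 3 / 2)"
            by (rule mult_right_mono[OF y(2)]) simp
          show "D / norm y \<le> D / d"
            using y C D xy by (intro divide_left_mono mult_pos_pos) auto
        qed (simp add: weight_def)
        finally have le1: "1 / sqrt (k n) * point_kernel (b n) t (x /\<^sub>R sqrt (k n)) y
            \<le> weight x * (R * t powr (- 3 / 2) + 1 / t + D / d)" .
        have "f y * (1 / sqrt (k n) * point_kernel (b n) t (x /\<^sub>R sqrt (k n)) y)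
            \<le> C * (weight x * (R * t powr (- 3 / 2) + 1 / t + D / d))"
          by (rule mult_mono[OF C(4)[OF xy(2)] le1])
             (use C(3) k(2)[of n] point_kernel_nonneg[OF t] in auto)
        also have "\<dots> = weight x * h" unfolding h_def by (rule mult.left_commute)
        finally have "u n p \<le> ennreal (weight x * h)"
          unfolding p u_def prod.case by (rule ennreal_leI)
        also have "\<dots> = w p"
          using y by (simp add: p w_def ennreal_mult'[OF w0])
        finally show ?thesis .
      qed
    qed
    have "integral\<^sup>N ?M w = (\<integral>\<^sup>+x. \<integral>\<^sup>+y. w (x, y) \<partial>punctured_lborel \<partial>\<mu>)"
      by (rule M2.nn_integral_fst[symmetric]) simp
    also have "\<dots> = (\<integral>\<^sup>+x. ennreal (weight x) * (\<integral>\<^sup>+y. ennreal h * indicator (cball 0 R) y \<partial>punctured_lborel) \<partial>\<mu>)"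
      unfolding w_def prod.case by (intro nn_integral_cong nn_integral_cmult) measurable
    also have "\<dots> = (\<integral>\<^sup>+x. ennreal (weight x) \<partial>\<mu>) * (\<integral>\<^sup>+y. ennreal h * indicator (cball 0 R) y \<partial>punctured_lborel)"
      by (rule nn_integral_multc) measurable
    also have "\<dots> < \<infinity>"
    proof -
      have "(\<integral>\<^sup>+y. ennreal h * indicator (cball 0 R) y \<partial>punctured_lborel)
          \<le> (\<integral>\<^sup>+(y::real^3). ennreal h * indicator (cball 0 R) y \<partial>lborel)"
        by (rule nn_integral_punctured_lborel_le) simp
      also have "\<dots> = ennreal h * emeasure lborel (cball 0 R :: (real^3) set)"
        by (rule nn_integral_cmult_indicator) simp
      also have "\<dots> < \<infinity>"
        using emeasure_lborel_cball_finite[of "0::real^3" R] by (simp add: ennreal_mult_less_top)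
      finally show ?thesis using \<mu>(2) by (simp add: ennreal_mult_less_top)
    qed
    finally have wfin: "integral\<^sup>N ?M w < \<infinity>" .
    show ?thesis
      by (rule nn_integral_dominated_convergence[OF um vm w_meas _ wfin]) (use le uv in auto)
  next
    \<comment> \<open>No majorant is at hand when the couplings tend to -infinity. Fatou suffices
      because v takes only the values 0 and infinity, so that its integral is 0 or infinity.\<close>
    case True
    have "integral\<^sup>N ?M v = (\<integral>\<^sup>+p. liminf (\<lambda>n. u n p) \<partial>?M)"
      by (rule nn_integral_cong) (rule lim_imp_Liminf[OF sequentially_bot uv, symmetric])
    also have "\<dots> \<le> liminf (\<lambda>n. integral\<^sup>N ?M (u n))"
      by (rule nn_integral_liminf[OF um])
    finally have fatou: "integral\<^sup>N ?M v \<le> liminf (\<lambda>n. integral\<^sup>N ?M (u n))" .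
    show ?thesis
    proof (cases "integral\<^sup>N ?M v = \<infinity>")
      case True
      have "limsup (\<lambda>n. integral\<^sup>N ?M (u n)) = \<infinity>" "liminf (\<lambda>n. integral\<^sup>N ?M (u n)) = \<infinity>"
        using fatou Liminf_le_Limsup[of sequentially "\<lambda>n. integral\<^sup>N ?M (u n)"] True
        by (auto simp: top_unique)
      then show ?thesis unfolding True by (subst tendsto_iff_Liminf_eq_Limsup) auto
    next
      \<comment> \<open>A finite integral forces v to be finite almost everywhere. Since v is
        infinite wherever f is positive, f y = 0 almost everywhere on the product, and all the
        integrals vanish.\<close>
      case False
      have "AE p in ?M. v p \<noteq> \<infinity>"
        by (rule nn_integral_PInf_AE[OF vm]) (use False in simp)
      then have "AE p in ?M. v p = 0 \<and> (\<forall>n. u n p = 0)"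
      proof (rule AE_mp, intro AE_I2 impI)
        fix p assume p: "p \<in> space ?M" "v p \<noteq> \<infinity>"
        obtain x y where xy: "p = (x, y)" by (cases p)
        have "f y = 0"
        proof (rule ccontr)
          assume "f y \<noteq> 0"
          moreover have "y \<noteq> 0" using p(1) by (auto simp: xy space_pair_measure)
          ultimately have "0 < f y" using Ccom_plus_nonneg[OF f, of y] by simp
          then have "v p = \<infinity>"
            using \<open>bs = - \<infinity>\<close> by (simp add: v_def xy ext_vartheta_def ennreal_mult_top)
          with p(2) show False ..
        qed
        then show "v p = 0 \<and> (\<forall>n. u n p = 0)" by (simp add: v_def u_def xy)
      qed
      then have "integral\<^sup>N ?M v = 0" "integral\<^sup>N ?M (u n) = 0" for n
        by (subst nn_integral_0_iff_AE; auto elim: AE_mp)+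
      then show ?thesis by simp
    qed
  qed
  have "integral\<^sup>N ?M (u n) = (\<integral>\<^sup>+x. \<integral>\<^sup>+y. u n (x, y) \<partial>punctured_lborel \<partial>\<mu>)" for n
    by (rule M2.nn_integral_fst[symmetric]) simp
  note U = this[unfolded u_def prod.case, folded u_def]
  have "integral\<^sup>N ?M v = (\<integral>\<^sup>+y. \<integral>\<^sup>+x. v (x, y) \<partial>\<mu> \<partial>punctured_lborel)"
    by (rule nn_integral_snd[symmetric]) simp
  also have "\<dots> = (\<integral>\<^sup>+y. ennreal (f y) * (\<integral>\<^sup>+x. ext_vartheta bs t x y \<partial>\<mu>) \<partial>punctured_lborel)"
  proof (rule nn_integral_cong)
    fix y assume "y \<in> space punctured_lborel"
    then show "(\<integral>\<^sup>+x. v (x, y) \<partial>\<mu>) = ennreal (f y) * (\<integral>\<^sup>+x. ext_vartheta bs t x y \<partial>\<mu>)"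
      unfolding v_def prod.case by (intro nn_integral_cmult) measurable
  qed
  finally show ?thesis using lim unfolding U by (simp only:)
qed

end

lemma rescaled_integral_tendsto:
  assumes t: "0 < t" and \<mu>: "\<mu> \<in> tempered_measures \<rho>" "(\<integral>\<^sup>+x. ennreal (weight x) \<partial>\<mu>) < \<infinity>"
    and f: "f \<in> Ccom_plus" and k: "filterlim k at_top sequentially"
    and b: "(\<lambda>n. ereal (b n)) \<longlonglongrightarrow> bs"
  shows "(\<lambda>n. \<integral>\<^sup>+x. \<integral>\<^sup>+y. ennreal (f y * (1 / sqrt (k n) * point_kernel (b n) t (x /\<^sub>R sqrt (k n)) y))
      \<partial>punctured_lborel \<partial>\<mu>)
    \<longlonglongrightarrow> (\<integral>\<^sup>+y. ennreal (f y) * (\<integral>\<^sup>+x. ext_vartheta bs t x y \<partial>\<mu>) \<partial>punctured_lborel)"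
proof -
  \<comment> \<open>A number strictly below the limit bounds the couplings from below from some
    index on.\<close>
  obtain A where A: "0 \<le> A" "bs \<noteq> - \<infinity> \<Longrightarrow> ereal (- A) < bs"
  proof (cases bs)
    case (real a)
    then show ?thesis by (intro that[of "\<bar>a\<bar> + 1"]) auto
  qed (auto intro: that[of 0])
  have "\<forall>\<^sub>F n in sequentially. bs \<noteq> - \<infinity> \<longrightarrow> - A \<le> b n"
  proof (cases "bs = - \<infinity>")
    case False
    from order_tendstoD(1)[OF b A(2)[OF this]] show ?thesis by eventually_elim simp
  qed simp
  moreover have "\<forall>\<^sub>F n in sequentially. 0 < k n"
    using k unfolding filterlim_at_top_dense by blast
  ultimately have "\<forall>\<^sub>F n in sequentially. (bs \<noteq> - \<infinity> \<longrightarrow> - A \<le> b n) \<and> 0 < k n"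
    by eventually_elim simp
  then obtain N where N: "\<And>n. N \<le> n \<Longrightarrow> (bs \<noteq> - \<infinity> \<longrightarrow> - A \<le> b n) \<and> 0 < k n"
    unfolding eventually_sequentially by blast
  show ?thesis
  \<comment> \<open>The bounds hold only eventually; shifting by N makes them hold for every
    index.\<close>
  proof (rule LIMSEQ_offset[of _ N], rule rescaled_integral_tendsto_aux[OF t \<mu> f _ _ _ A(1)])
    show "filterlim (\<lambda>n. k (n + N)) at_top sequentially"
      by (rule filterlim_compose[OF k filterlim_add_const_nat_at_top])
    show "(\<lambda>n. ereal (b (n + N))) \<longlonglongrightarrow> bs" by (rule LIMSEQ_ignore_initial_segment[OF b])
  qed (use N in auto)
qed

lemma ext_vartheta_integral_measurable:
  assumes t: "0 < t" and \<mu>: "\<mu> \<in> tempered_measures \<rho>"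
  shows "(\<lambda>y. \<integral>\<^sup>+x. ext_vartheta bs t x y \<partial>\<mu>) \<in> borel_measurable punctured_lborel"
proof -
  interpret sigma_finite_measure \<mu> by (rule sigma_finite_tempered[OF \<mu>])
  have "(\<lambda>(x, y). ext_vartheta bs t x y) \<in> borel_measurable (\<mu> \<Otimes>\<^sub>M punctured_lborel)"
    by (rule ext_vartheta_measurable[OF t tempered_measures_sets[OF \<mu>] sets_punctured_lborel])
  from measurable_compose[OF measurable_pair_swap' this]
  have "(\<lambda>(y, x). ext_vartheta bs t x y) \<in> borel_measurable (punctured_lborel \<Otimes>\<^sub>M \<mu>)"
    by (simp add: case_prod_beta)
  then show ?thesis by (rule borel_measurable_nn_integral)
qed

text \<open>For finite coupling the limit kernel is a product of a function of x and one of y, so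
  the density is the profile at |y| over |y| times the integral of the weight. Integrating it
  against 1/|y| meets |y|^(-2) under a Gaussian, which is integrable in dimension three.\<close>

lemma limit_density_tempered:
  assumes t: "0 < t" and \<mu>: "\<mu> \<in> tempered_measures \<rho>" "(\<integral>\<^sup>+x. ennreal (weight x) \<partial>\<mu>) < \<infinity>"
    and bs: "bs \<noteq> - \<infinity>"
  shows "density punctured_lborel (\<lambda>y. \<integral>\<^sup>+x. ext_vartheta bs t x y \<partial>\<mu>) \<in> tempered_measures \<rho>"
proof (rule tempered_measuresI)
  let ?g = "\<lambda>y. \<integral>\<^sup>+x. ext_vartheta bs t x y \<partial>\<mu>"
  show "sets (density punctured_lborel ?g) = sets punctured_borel"
    by (simp add: sets_punctured_lborel)
  have wl: "weight \<in> borel_measurable punctured_lborel"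
    unfolding measurable_cong_sets[OF sets_punctured_lborel refl] by (rule weight_measurable')
  have wm: "weight \<in> borel_measurable \<mu>"
    unfolding measurable_cong_sets[OF tempered_measures_sets[OF \<mu>(1)] refl] by (rule weight_measurable')
  have "(\<integral>\<^sup>+y. ennreal (weight y) \<partial>density punctured_lborel ?g) = (\<integral>\<^sup>+y. ?g y * ennreal (weight y) \<partial>punctured_lborel)"
    by (rule nn_integral_density[OF ext_vartheta_integral_measurable[OF t \<mu>(1)]]) (use wl in measurable)
  also have "\<dots> < \<infinity>"
  proof (cases bs)
    case (real a)
    let ?W = "\<integral>\<^sup>+x. ennreal (weight x) \<partial>\<mu>"
    define D where "D = 4 * sqrt pi * exp (64 * pi\<^sup>2 * \<bar>a\<bar>\<^sup>2 * t) / sqrt t * (8 * pi * t) powr (3 / 2)"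
    have D: "0 \<le> D" using t by (simp add: D_def)
    \<comment> \<open>The exponent 2 collects 1/|y| from the density and 1/|y| from the weight being
      integrated.\<close>
    obtain C where C: "0 \<le> C" "\<And>s x::real^3 . 0 < s \<Longrightarrow>
      (\<integral>\<^sup>+y. ennreal (gauss s (norm (y - x)) * norm y powr (- 2)) \<partial>lborel) \<le> ennreal (C * s powr (- 2 / 2))"
      using nn_integral_gauss_powr_le[of 2] by auto
    have "(\<integral>\<^sup>+y. ?g y * ennreal (weight y) \<partial>punctured_lborel)
      \<le> (\<integral>\<^sup>+(y::real^3). (ennreal D * ?W) * ennreal (gauss (2 * t) (norm (y - 0)) * norm y powr (- 2)) \<partial>lborel)"
    proof (rule nn_integral_punctured_lborel_le)
      fix y :: "real^3" assume y: "y \<noteq> 0"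
      have "?g y = (\<integral>\<^sup>+x. ennreal (profile a t (norm y) * weight y) * ennreal (weight x) \<partial>\<mu>)"
        unfolding real ext_vartheta_def
        by (rule nn_integral_cong)
           (simp add: vartheta_eq[OF t] weight_def profile_nonneg ac_simps flip: ennreal_mult')
      also have "\<dots> = ennreal (profile a t (norm y) * weight y) * ?W"
        by (rule nn_integral_cmult) (use wm in measurable)
      finally have g: "?g y = ennreal (profile a t (norm y) * weight y) * ?W" .
      have e: "ennreal (profile a t (norm y) * weight y * weight y)
          = ennreal (profile a t (norm y) * weight y) * ennreal (weight y)"
        by (rule ennreal_mult'') (simp add: weight_def)
      have "?g y * ennreal (weight y) = ennreal (profile a t (norm y) * weight y * weight y) * ?W"
        unfolding g e by (simp only: ac_simps)
      also have "ennreal (profile a t (norm y) * weight y * weight y)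
          \<le> ennreal (D * (gauss (2 * t) (norm (y - 0)) * norm y powr (- 2)))"
      proof (rule ennreal_leI)
        have "profile a t (norm y) \<le> 4 * sqrt pi * exp (64 * pi\<^sup>2 * \<bar>a\<bar>\<^sup>2 * t) / sqrt t * exp (- ((norm y)\<^sup>2 / (8 * t)))"
          by (rule profile_le[OF t]) auto
        also have "\<dots> = D * gauss (2 * t) (norm y)"
          unfolding D_def exp_square_eq_gauss[OF t] by (simp only: mult.assoc)
        finally have "profile a t (norm y) * (weight y * weight y) \<le> D * gauss (2 * t) (norm y) * (weight y * weight y)"
          by (rule mult_right_mono) simp
        moreover have "weight y * weight y = norm y powr (- 2)"
          using y powr_minus[of "norm y" 2] by (simp add: weight_def power2_eq_square divide_inverse)
        ultimately show "profile a t (norm y) * weight y * weight y \<le> D * (gauss (2 * t) (norm (y - 0)) * norm y powr (- 2))"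
          by (simp add: mult.assoc)
      qed
      then have "ennreal (profile a t (norm y) * weight y * weight y) * ?W
          \<le> ennreal (D * (gauss (2 * t) (norm (y - 0)) * norm y powr (- 2))) * ?W"
        by (rule mult_right_mono) simp
      finally show "?g y * ennreal (weight y)
          \<le> (ennreal D * ?W) * ennreal (gauss (2 * t) (norm (y - 0)) * norm y powr (- 2))"
        using D by (simp add: ennreal_mult' ac_simps)
    qed
    also have "\<dots> = (ennreal D * ?W) * (\<integral>\<^sup>+(y::real^3). ennreal (gauss (2 * t) (norm (y - 0)) * norm y powr (- 2)) \<partial>lborel)"
      by (rule nn_integral_cmult) measurable
    also have "\<dots> \<le> (ennreal D * ?W) * ennreal (C * (2 * t) powr (- 2 / 2))"
      by (intro mult_left_mono C(2)) (use t in auto)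
    also have "\<dots> < \<infinity>" using \<mu>(2) by (simp add: ennreal_mult_less_top)
    finally show ?thesis .
  qed (use bs in \<open>simp_all add: ext_vartheta_def\<close>)
  finally show "(\<integral>\<^sup>+y. ennreal (weight y) \<partial>density punctured_lborel ?g) < \<infinity>" .
qed

section \<open>Rescaled mean measures and the limit theorem\<close>

lemma point_source_measurable:
  assumes "point_source_super_brownian \<rho> \<eta> \<beta> a \<Omega> P X" "\<mu> \<in> tempered_measures \<rho>" "0 \<le> t"
  shows "X t \<in> measurable (P \<mu>) (vague_borel \<rho>)"
proof -
  interpret point_source_super_brownian \<rho> \<eta> \<beta> a \<Omega> P X by fact
  have "sets (P \<mu>) = sets \<Omega>" using laws[of \<mu>] assms by (simp add: space_prob_algebra)
  then show ?thesis
    using random_variable[OF assms(3)] by (simp cong: measurable_cong_sets)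
qed

text \<open>The dilation is moved onto the test function, which stays in \<open>Ccom_plus\<close>,
  so the first moment formula applies at time k t; the scaling of the kernel then returns to time t
  with coupling sqrt k times \<open>a\<close>.\<close>

lemma nn_integral_rescaled_mean:
  assumes psb: "point_source_super_brownian \<rho> \<eta> \<beta> a \<Omega> P X"
    and p: "0 < \<rho>" "0 \<le> \<eta>" "0 < \<beta>" "\<beta> < 1" and t: "0 < t" and k: "0 < k"
    and \<mu>: "\<mu> \<in> tempered_measures \<rho>" "(\<integral>\<^sup>+x. ennreal (weight x) \<partial>\<mu>) < \<infinity>"
    and f: "f \<in> Ccom_plus"
  shows "(\<integral>\<^sup>+y. ennreal (f y) \<partial>scale_measure (ennreal (1 / sqrt k)) (dilate (sqrt k) (mean_measure (P \<mu>) (X (k * t)))))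
    = (\<integral>\<^sup>+x. \<integral>\<^sup>+y. ennreal (f y * (1 / sqrt k * point_kernel (sqrt k * a) t (x /\<^sub>R sqrt k) y)) \<partial>punctured_lborel \<partial>\<mu>)"
proof -
  have kt: "0 < k * t" using k t by simp
  have X: "X (k * t) \<in> measurable (P \<mu>) (vague_borel \<rho>)"
    by (rule point_source_measurable[OF psb \<mu>(1)]) (use kt in simp)
  let ?f = "\<lambda>y. f (y /\<^sub>R sqrt k)"
  have f': "?f \<in> Ccom_plus" by (rule Ccom_plus_scale[OF f]) (use k in simp)
  have "(\<integral>\<^sup>+y. ennreal (f y) \<partial>scale_measure (ennreal (1 / sqrt k)) (dilate (sqrt k) (mean_measure (P \<mu>) (X (k * t)))))
    = ennreal (1 / sqrt k) * (\<integral>\<^sup>+x. ennreal (?f x) \<partial>mean_measure (P \<mu>) (X (k * t)))"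
    by (rule nn_integral_scale_dilate[OF sets_mean_measure[OF X] _ Ccom_plus_measurable[OF f]]) (use k in simp)
  also have "(\<integral>\<^sup>+x. ennreal (?f x) \<partial>mean_measure (P \<mu>) (X (k * t)))
      = (\<integral>\<^sup>+\<omega>. \<integral>\<^sup>+x. ennreal (?f x) \<partial>X (k * t) \<omega> \<partial>P \<mu>)"
    by (rule nn_integral_mean_measure[OF X]) (use Ccom_plus_measurable[OF f'] in measurable)
  also have "\<dots> = (\<integral>\<^sup>+x. kernel_integral a (k * t) ?f x \<partial>\<mu>)"
    by (rule first_moment[OF psb p kt \<mu> f'])
  also have "ennreal (1 / sqrt k) * \<dots> = (\<integral>\<^sup>+x. ennreal (1 / sqrt k) * kernel_integral a (k * t) ?f x \<partial>\<mu>)"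
    by (rule nn_integral_cmult[symmetric])
       (rule kernel_integral_measurable[OF kt Ccom_plus_measurable[OF f'] tempered_measures_sets[OF \<mu>(1)]])
  also have "\<dots> = (\<integral>\<^sup>+x. \<integral>\<^sup>+y. ennreal (f y * (1 / sqrt k * point_kernel (sqrt k * a) t (x /\<^sub>R sqrt k) y)) \<partial>punctured_lborel \<partial>\<mu>)"
  proof (rule nn_integral_cong)
    fix x
    let ?p = "point_kernel (sqrt k * a) t (x /\<^sub>R sqrt k)"
    have [measurable]: "f \<in> borel_measurable punctured_borel" "?p \<in> borel_measurable punctured_borel"
      by (fact Ccom_plus_measurable[OF f] point_kernel_measurable_snd[OF t])+
    have "(\<lambda>y. ennreal (f y * ?p y)) \<in> borel_measurable punctured_borel" by measurable
    then have m: "(\<lambda>y. ennreal (f y * ?p y)) \<in> borel_measurable punctured_lborel"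
      unfolding measurable_cong_sets[OF sets_punctured_lborel refl] .
    have "ennreal (1 / sqrt k) * kernel_integral a (k * t) ?f x = (\<integral>\<^sup>+y. ennreal (1 / sqrt k) * ennreal (f y * ?p y) \<partial>punctured_lborel)"
      unfolding kernel_integral_scale[OF k t f] by (rule nn_integral_cmult[OF m, symmetric])
    also have "\<dots> = (\<integral>\<^sup>+y. ennreal (f y * (1 / sqrt k * ?p y)) \<partial>punctured_lborel)"
      using k by (intro nn_integral_cong) (simp add: mult.left_commute flip: ennreal_mult')
    finally show "ennreal (1 / sqrt k) * kernel_integral a (k * t) ?f x
        = (\<integral>\<^sup>+y. ennreal (f y * (1 / sqrt k * ?p y)) \<partial>punctured_lborel)" .
  qed
  finally show ?thesis .
qed

text \<open>The weight is homogeneous of degree -1, so dilation changes its integral only by a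
  constant, and finiteness is inherited from the unscaled mean.\<close>

lemma rescaled_mean_tempered:
  assumes psb: "point_source_super_brownian \<rho> \<eta> \<beta> a \<Omega> P X"
    and p: "0 < \<rho>" "0 \<le> \<eta>" "0 < \<beta>" "\<beta> < 1" and t: "0 < t" and k: "0 < k"
    and \<mu>: "\<mu> \<in> tempered_measures \<rho>" "(\<integral>\<^sup>+x. ennreal (weight x) \<partial>\<mu>) < \<infinity>"
  shows "scale_measure (ennreal (1 / sqrt k)) (dilate (sqrt k) (mean_measure (P \<mu>) (X (k * t)))) \<in> tempered_measures \<rho>"
proof (rule tempered_measuresI)
  have kt: "0 < k * t" using k t by simp
  have X: "X (k * t) \<in> measurable (P \<mu>) (vague_borel \<rho>)"
    by (rule point_source_measurable[OF psb \<mu>(1)]) (use kt in simp)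
  let ?M = "mean_measure (P \<mu>) (X (k * t))"
  have wm: "weight \<in> borel_measurable ?M"
    unfolding measurable_cong_sets[OF sets_mean_measure[OF X] refl] by (rule weight_measurable')
  show "sets (scale_measure (ennreal (1 / sqrt k)) (dilate (sqrt k) ?M)) = sets punctured_borel"
    by (simp add: dilate_def)
  have "(\<integral>\<^sup>+x. ennreal (weight x) \<partial>scale_measure (ennreal (1 / sqrt k)) (dilate (sqrt k) ?M))
      = ennreal (1 / sqrt k) * (\<integral>\<^sup>+x. ennreal (weight (x /\<^sub>R sqrt k)) \<partial>?M)"
    by (rule nn_integral_scale_dilate[OF sets_mean_measure[OF X] _ weight_measurable']) (use k in simp)
  also have "(\<lambda>x. ennreal (weight (x /\<^sub>R sqrt k))) = (\<lambda>x. ennreal (sqrt k) * ennreal (weight x))"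
    using k by (auto simp: weight_def divide_inverse simp flip: ennreal_mult')
  also have "(\<integral>\<^sup>+x. ennreal (sqrt k) * ennreal (weight x) \<partial>?M) = ennreal (sqrt k) * (\<integral>\<^sup>+x. ennreal (weight x) \<partial>?M)"
    by (rule nn_integral_cmult) (use wm in measurable)
  also have "ennreal (1 / sqrt k) * \<dots> < \<infinity>"
    using nn_integral_mean_weight_finite[OF psb p kt \<mu> X] by (simp add: ennreal_mult_less_top)
  finally show "(\<integral>\<^sup>+x. ennreal (weight x) \<partial>scale_measure (ennreal (1 / sqrt k)) (dilate (sqrt k) ?M)) < \<infinity>" .
qed

theorem theorem3:
  fixes \<rho> \<eta> \<beta> t \<alpha> :: real and lam :: "real \<Rightarrow> real" and \<alpha>star :: ereal
    and \<Omega> :: "real \<Rightarrow> 'w measure"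
    and P :: "real \<Rightarrow> (real^3) measure \<Rightarrow> 'w measure"
    and X :: "real \<Rightarrow> real \<Rightarrow> 'w \<Rightarrow> (real^3) measure"
    and \<mu> :: "(real^3) measure"
  assumes "1 < \<rho>" "\<rho> < 2" and "0 < \<eta>" and "0 < \<beta>" "\<beta> < 1"
    and "\<And>a. point_source_super_brownian \<rho> \<eta> \<beta> a (\<Omega> a) (P a) (X a)"
    and "0 < t"
    and "((\<lambda>k. ereal (sqrt k * lam k * \<alpha>)) \<longlongrightarrow> \<alpha>star) at_top"
    and "\<mu> \<in> tempered_measures \<rho>"
    and "(\<integral>\<^sup>+x. ennreal (weight x) \<partial>\<mu>) < \<infinity>"
  defines "N \<equiv> \<lambda>k. scale_measure (ennreal (1 / sqrt k))
                     (dilate (sqrt k) (mean_measure (P (lam k * \<alpha>) \<mu>) (X (lam k * \<alpha>) (k * t))))"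
    and "\<nu> \<equiv> density punctured_lborel (\<lambda>y. \<integral>\<^sup>+x. ext_vartheta \<alpha>star t x y \<partial>\<mu>)"
  shows "(\<forall>k>0. N k \<in> tempered_measures \<rho>)
    \<and> (\<alpha>star \<noteq> -\<infinity> \<longrightarrow> \<nu> \<in> tempered_measures \<rho>)
    \<and> vague_tendsto N \<nu> at_top"
proof (intro conjI allI impI)
  have p: "0 < \<rho>" "0 \<le> \<eta>" using assms by auto
  show "N k \<in> tempered_measures \<rho>" if "0 < k" for k
    unfolding N_def
    by (rule rescaled_mean_tempered[OF assms(6) p assms(4,5,7) that assms(9,10)])
  show "\<nu> \<in> tempered_measures \<rho>" if "\<alpha>star \<noteq> - \<infinity>"
    unfolding \<nu>_def by (rule limit_density_tempered[OF assms(7,9,10) that])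
  show "vague_tendsto N \<nu> at_top"
    unfolding vague_tendsto_def
  proof
    fix f assume f: "f \<in> Ccom_plus"
    have "f \<in> borel_measurable punctured_lborel"
      unfolding measurable_cong_sets[OF sets_punctured_lborel refl] by (rule Ccom_plus_measurable[OF f])
    then have m: "(\<lambda>y. ennreal (f y)) \<in> borel_measurable punctured_lborel"
      by (rule measurable_compose) simp
    have "(\<integral>\<^sup>+y. ennreal (f y) \<partial>\<nu>)
        = (\<integral>\<^sup>+y. (\<integral>\<^sup>+x. ext_vartheta \<alpha>star t x y \<partial>\<mu>) * ennreal (f y) \<partial>punctured_lborel)"
      unfolding \<nu>_def
      by (rule nn_integral_density[OF ext_vartheta_integral_measurable[OF assms(7,9)] m])
    then have \<nu>: "(\<integral>\<^sup>+y. ennreal (f y) \<partial>\<nu>)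
        = (\<integral>\<^sup>+y. ennreal (f y) * (\<integral>\<^sup>+x. ext_vartheta \<alpha>star t x y \<partial>\<mu>) \<partial>punctured_lborel)"
      by (simp add: mult.commute)
    show "((\<lambda>k. \<integral>\<^sup>+y. ennreal (f y) \<partial>N k) \<longlongrightarrow> (\<integral>\<^sup>+y. ennreal (f y) \<partial>\<nu>)) at_top"
    \<comment> \<open>Dominated convergence and Fatou are used for sequences, so the limit over real
      k is tested along an arbitrary sequence tending to infinity.\<close>
    proof (rule tendsto_at_topI_sequentially)
      fix k :: "nat \<Rightarrow> real" assume k: "filterlim k at_top sequentially"
      let ?b = "\<lambda>n. sqrt (k n) * lam (k n) * \<alpha>"
      have b: "(\<lambda>n. ereal (?b n)) \<longlonglongrightarrow> \<alpha>star"
        by (rule filterlim_compose[OF assms(8) k])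
      have "\<forall>\<^sub>F n in sequentially. 0 < k n"
        using k unfolding filterlim_at_top_dense by blast
      then have "\<forall>\<^sub>F n in sequentially.
          (\<integral>\<^sup>+x. \<integral>\<^sup>+y. ennreal (f y * (1 / sqrt (k n) * point_kernel (?b n) t (x /\<^sub>R sqrt (k n)) y)) \<partial>punctured_lborel \<partial>\<mu>)
          = (\<integral>\<^sup>+y. ennreal (f y) \<partial>N (k n))"
      proof eventually_elim
        case (elim n)
        show ?case
          unfolding N_def nn_integral_rescaled_mean[OF assms(6) p assms(4,5,7) elim assms(9,10) f] mult.assoc ..
      qed
      with rescaled_integral_tendsto[OF assms(7,9,10) f k b]
      show "(\<lambda>n. \<integral>\<^sup>+y. ennreal (f y) \<partial>N (k n)) \<longlonglongrightarrow> (\<integral>\<^sup>+y. ennreal (f y) \<partial>\<nu>)"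
        unfolding \<nu> by (rule Lim_transform_eventually)
    qed
  qed
qed

end
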